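(* There is a one-to-one correspondence between the set $\mathbb{Q}_{>0}$ of positive rational numbers and the set $\mathbb{ALG}(dP3_0)$ of families of algebroid solutions of $$\left(\frac{t\,y'(t)}{y(t)}\right)'=y(t)-\frac{t}{(y(t))^2},$$ given by $$\mathbb{Q}_{>0}\to\mathbb{ALG}(dP3_0),\qquad q\mapsto y(t)\underset{t\to 0}{\sim}-a_0\,t^{1-4\rho},\qquad a_0\in\mathbb{C}\setminus\{0\},\quad 2\rho=\frac{1}{1+2q},$$ where $y(t)=y(t;a_0)$ is a representative of the corresponding family.
   Context: For every pair $(n,m)\in\mathbb{Z}_{\geqslant0}^2$ put $\alpha=(m+2n+3)/4$. For every $a_0\in\mathbb{C}\setminus\{0\}$ there is a unique solution $w(x)=w_{n,m}(x;a_0)$, holomorphic at $x=0$ with $w(0)=-a_0$, of the equation $\left(\frac{x w'(x)}{w(x)}\right)'=\alpha^2\left(x^n w(x)-\frac{x^m}{(w(x))^2}\right)$, and then $y(t;a_0)=x^{n+1-\alpha}w(x)$, $t=x^{\alpha}$, is an algebroid solution of the equation for $y$ in the claim; every algebroid solution of that equation arises in this way from some $(n,m)$ and $a_0$. The elements of $\mathbb{ALG}(dP3_0)$ are the families $\{y(t;a_0)\}_{a_0\in\mathbb{C}\setminus\{0\}}$ so obtained from the pairs $(n,m)$ (different pairs producing the same family of functions give the same element). The map of the claim sends $q=\frac{n+1}{m+1}$, with $n+1$ and $m+1$ coprime, to the family constructed from $(n,m)$. An algebroid function is a function satisfying an irreducible polynomial equation with coefficients meromorphic on $\mathbb{C}$.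 *)

theory Defs
  imports "HOL-Complex_Analysis.Complex_Analysis" "HOL-Library.Landau_Symbols"
begin

section \<open>The field of meromorphic functions on the complex plane\<close>

text \<open>
  Functions that are meromorphic on \<open>\<complex>\<close>, identified when they agree outside a closed discrete set.
  This makes the junk values at poles irrelevant, so that the pointwise operations give a field.
\<close>

quotient_type mero = "complex \<Rightarrow> complex" /
  partial: "\<lambda>f g. f meromorphic_on UNIV \<and> g meromorphic_on UNIV \<and> (\<forall>\<^sub>\<approx>z. f z = g z)"
proof (rule part_equivpI)
  show "\<exists>f. f meromorphic_on UNIV \<and> f meromorphic_on UNIV \<and> (\<forall>\<^sub>\<approx>z::complex. f z = f z)"
    by (rule exI[of _ "\<lambda>_. 0"]) auto
  show "symp (\<lambda>f g. f meromorphic_on UNIV \<and> g meromorphic_on UNIV \<and> (\<forall>\<^sub>\<approx>z. f z = g z))"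
    by (auto simp: symp_def eq_commute)
  show "transp (\<lambda>f g. f meromorphic_on UNIV \<and> g meromorphic_on UNIV \<and> (\<forall>\<^sub>\<approx>z. f z = g z))"
  proof (rule transpI, intro conjI)
    fix f g h :: "complex \<Rightarrow> complex"
    assume "f meromorphic_on UNIV \<and> g meromorphic_on UNIV \<and> (\<forall>\<^sub>\<approx>z. f z = g z)"
      and "g meromorphic_on UNIV \<and> h meromorphic_on UNIV \<and> (\<forall>\<^sub>\<approx>z. g z = h z)"
    then show "f meromorphic_on UNIV" "h meromorphic_on UNIV" "\<forall>\<^sub>\<approx>z. f z = h z"
      by (auto elim: eventually_elim2)
  qed
qed

instantiation mero :: field
begin

lift_definition zero_mero :: mero is "\<lambda>_. 0" by auto
lift_definition one_mero :: mero is "\<lambda>_. 1" by auto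
lift_definition plus_mero :: "mero \<Rightarrow> mero \<Rightarrow> mero" is "\<lambda>f g z. f z + g z"
  by (auto intro!: meromorphic_intros elim: eventually_elim2)
lift_definition uminus_mero :: "mero \<Rightarrow> mero" is "\<lambda>f z. - f z"
  by (auto intro!: meromorphic_intros elim: eventually_mono)
lift_definition minus_mero :: "mero \<Rightarrow> mero \<Rightarrow> mero" is "\<lambda>f g z. f z - g z"
  by (auto intro!: meromorphic_intros elim: eventually_elim2)
lift_definition times_mero :: "mero \<Rightarrow> mero \<Rightarrow> mero" is "\<lambda>f g z. f z * g z"
  by (auto intro!: meromorphic_intros elim: eventually_elim2)
lift_definition inverse_mero :: "mero \<Rightarrow> mero" is "\<lambda>f z. inverse (f z)"
  by (auto intro!: meromorphic_intros elim: eventually_mono)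
lift_definition divide_mero :: "mero \<Rightarrow> mero \<Rightarrow> mero" is "\<lambda>f g z. f z / g z"
  by (auto intro!: meromorphic_intros elim: eventually_elim2)

instance
proof
  fix a b c :: mero
  show "a * b * c = a * (b * c)" by transfer (auto intro!: meromorphic_intros simp: mult.assoc)
  show "a * b = b * a" by transfer (auto intro!: meromorphic_intros simp: mult.commute)
  show "1 * a = a" by transfer auto
  show "a + b + c = a + (b + c)" by transfer (auto intro!: meromorphic_intros simp: add.assoc)
  show "a + b = b + a" by transfer (auto intro!: meromorphic_intros simp: add.commute)
  show "0 + a = a" by transfer auto
  show "- a + a = 0" by transfer (auto intro!: meromorphic_intros)
  show "a - b = a + - b" by transfer (auto intro!: meromorphic_intros)
  show "(a + b) * c = a * c + b * c"
    by transfer (auto intro!: meromorphic_intros simp: algebra_simps)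
  show "(0::mero) \<noteq> 1" by transfer auto
  show "inverse a * a = 1" if "a \<noteq> 0"
    using that
  proof transfer
    fix f :: "complex \<Rightarrow> complex"
    assume f: "f meromorphic_on UNIV \<and> f meromorphic_on UNIV \<and> (\<forall>\<^sub>\<approx>z. f z = f z)"
      and nz: "\<not> (f meromorphic_on UNIV \<and> (\<lambda>_. 0) meromorphic_on UNIV \<and> (\<forall>\<^sub>\<approx>z. f z = (0::complex)))"
    from f nz have "\<forall>\<^sub>\<approx>z. f z \<noteq> 0"
      using meromorphic_imp_constant_or_avoid[of f UNIV 0] by auto
    then have "\<forall>\<^sub>\<approx>z. inverse (f z) * f z = 1" by (auto elim: eventually_mono)
    with f show "(\<lambda>z. inverse (f z) * f z) meromorphic_on UNIV \<and> (\<lambda>_. 1) meromorphic_on UNIV \<and>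
        (\<forall>\<^sub>\<approx>z. inverse (f z) * f z = 1)"
      by (auto intro!: meromorphic_intros)
  qed
  show "a div b = a * inverse b"
    by transfer (auto intro!: meromorphic_intros simp: divide_inverse)
  show "inverse (0::mero) = 0" by transfer auto
qed

end


section \<open>Algebroid solutions\<close>

text \<open>
  Multivalued functions \<open>y(t)\<close> that branch only over \<open>t = 0\<close> and \<open>t = \<infinity>\<close> are represented by
  single-valued functions \<open>Y\<close> on the Riemann surface of the logarithm, with the coordinate
  \<open>T = ln t\<close>, i.e. \<open>Y T = y (exp T)\<close>. The branches of \<open>y\<close> over an open set \<open>U\<close> are the functions
  \<open>Y \<circ> l\<close>, where \<open>l\<close> is a branch of the logarithm on \<open>U\<close>.
  By the definition of \<open>nicely_meromorphic_on\<close>, \<open>Y\<close> takes the value \<open>0\<close> at its poles, so meromorphic functions that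
  agree off a discrete set are equal.
\<close>

definition algebroid :: "(complex \<Rightarrow> complex) \<Rightarrow> bool" where
  "algebroid Y \<longleftrightarrow> Y nicely_meromorphic_on UNIV \<and>
     (\<exists>P :: mero poly. irreducible P \<and>
       (\<forall>\<^sub>\<approx>T. (\<Sum>k\<le>degree P. rep_mero (coeff P k) (exp T) * Y T ^ k) = 0))"

text \<open>
  The condition \<open>Y (l t) \<noteq> 0\<close> excludes the zeros and, by the convention above, also the poles.
\<close>

definition dP3_solution :: "(complex \<Rightarrow> complex) \<Rightarrow> bool" where
  "dP3_solution Y \<longleftrightarrow> (\<exists>T. Y T \<noteq> 0) \<and>
     (\<forall>U l. open U \<longrightarrow> l holomorphic_on U \<longrightarrow> (\<forall>t\<in>U. exp (l t) = t) \<longrightarrow>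
       (let y = (\<lambda>t. Y (l t)) in
         \<forall>t\<in>U. y t \<noteq> 0 \<longrightarrow>
           deriv (\<lambda>s. s * deriv y s / y s) t = y t - t / (y t)\<^sup>2))"

definition algebroid_solution :: "(complex \<Rightarrow> complex) \<Rightarrow> bool" where
  "algebroid_solution Y \<longleftrightarrow> algebroid Y \<and> dP3_solution Y"


section \<open>The families\<close>

definition alpha :: "nat \<Rightarrow> nat \<Rightarrow> complex" where
  "alpha n m = (of_nat m + 2 * of_nat n + 3) / 4"

text \<open>Only the germ of \<open>w\<close> at \<open>0\<close> matters.\<close>

definition w_solution :: "nat \<Rightarrow> nat \<Rightarrow> complex \<Rightarrow> (complex \<Rightarrow> complex) \<Rightarrow> bool" where
  "w_solution n m a0 w \<longleftrightarrow> w analytic_on {0} \<and> w 0 = - a0 \<and>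
     (\<forall>\<^sub>F x in nhds 0.
        deriv (\<lambda>z. z * deriv w z / w z) x = (alpha n m)\<^sup>2 * (x ^ n * w x - x ^ m / (w x)\<^sup>2))"

text \<open>
  \<open>y(t) = x\<^bsup>n+1-\<alpha>\<^esup> w(x)\<close>, \<open>t = x\<^sup>\<alpha>\<close> for small \<open>\<bar>x\<bar>\<close>, with \<open>x = exp X\<close> and hence \<open>T = \<alpha> X\<close>.
\<close>

definition arises_from :: "nat \<Rightarrow> nat \<Rightarrow> complex \<Rightarrow> (complex \<Rightarrow> complex) \<Rightarrow> bool" where
  "arises_from n m a0 Y \<longleftrightarrow>
     (\<exists>w. w_solution n m a0 w \<and>
       (\<exists>R::real. \<forall>X. Re X < R \<longrightarrow>
          Y (alpha n m * X) = exp ((of_nat n + 1 - alpha n m) * X) * w (exp X)))"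

definition family :: "nat \<Rightarrow> nat \<Rightarrow> (complex \<Rightarrow> complex) set" where
  "family n m = {Y. algebroid_solution Y \<and> (\<exists>a0. a0 \<noteq> 0 \<and> arises_from n m a0 Y)}"

definition ALG_dP3 :: "(complex \<Rightarrow> complex) set set" where
  "ALG_dP3 = {family n m | n m. True}"

definition family_of_rat :: "rat \<Rightarrow> (complex \<Rightarrow> complex) set" where
  "family_of_rat q = (case quotient_of q of (a, b) \<Rightarrow> family (nat a - 1) (nat b - 1))"

text \<open>The filter \<open>t \<rightarrow> 0\<close> on the Riemann surface of the logarithm, in the coordinate \<open>T = ln t\<close>.\<close>

definition t_to_0 :: "complex filter" where
  "t_to_0 = filtercomap Re at_bot"

end

theory Submission
  imports Defs
begin

text \<open>
  In the coordinate \<open>T = ln t\<close> the equation reads \<open>u'' = e\<^bsup>T+u\<^esup> - e\<^bsup>2T-2u\<^esup>\<close> with \<open>u = ln y\<close>. The heart of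
  the matter is its Painleve property. With the energy \<open>E = u'\<^sup>2/2 - e\<^bsup>T+u\<^esup> - e\<^bsup>2T-2u\<^esup>/2\<close>, the function
  \<open>E + u'\<close> is regular at the poles of \<open>y\<close> and \<open>E - u'\<close> at its zeros; the interpolation \<open>E + \<phi> u'\<close> with
  \<open>\<phi> = (|y|\<^sup>2 - 1) / (|y|\<^sup>2 + 1)\<close> grows at most exponentially along every segment avoiding zeros and poles.
  In the coordinates \<open>(y, y', E - u')\<close> for \<open>|y| \<le> 1\<close> and \<open>(q, q', E + u')\<close>, \<open>y = q\<^sup>-\<^sup>2\<close>, for \<open>|y| \<ge> 1\<close> the
  equation becomes a polynomial system, so bounded data give a solution on a disc of uniform
  radius, and every solution extends meromorphically to the whole \<open>T\<close>-plane. The solution coming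
  from \<open>w\<close> is periodic with period \<open>2\<pi>i(m+2n+3)\<close>, hence algebroid. Pairs with the same quotient
  \<open>(n+1)/(m+1)\<close> give the same functions by the substitution \<open>x \<mapsto> x\<^sup>d\<close>, and different quotients are
  told apart by the exponent at \<open>t = 0\<close>.
\<close>
section \<open>Power series estimates for quadratic systems\<close>

text \<open>Along a solution E' = -e^T y - e^(2T)/y^2 and u'' = e^T y - e^(2T)/y^2. Hence (E + u')'
  = -2 e^(2T)/y^2 and (E - u')' = -2 e^T y: each combination loses exactly the term that blows up at
  the poles, respectively at the zeros. This is why the weight \<phi> has to tend to 1 at the poles
  and to -1 at the zeros. The obstacle is that a power series argument gives a disc whose radius
  depends on the size of the data, while y may come arbitrarily close to 0 and \<infinity>. A bound
  on E + \<phi> u' along a segment controls u' in terms of |y| alone, and this keeps the data of one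
  of the two charts bounded whatever |y| is. So the radius does not shrink towards the end of the
  segment. The zeros of y are simple, since y'^2 = e^(2T) there; its poles are double, whence the
  chart q with y = q^-2.\<close>

lemma has_fps_expansion_sum_list:
  fixes f :: "'b \<Rightarrow> complex \<Rightarrow> complex"
  assumes "\<And>x. x \<in> set xs \<Longrightarrow> f x has_fps_expansion F x"
  shows "(\<lambda>z. \<Sum>x\<leftarrow>xs. f x z) has_fps_expansion (\<Sum>x\<leftarrow>xs. F x)"
  using assms by (induction xs) (auto intro!: fps_expansion_intros)

lemma fps_nth_sum_list: "fps_nth (\<Sum>x\<leftarrow>xs. F x) n = (\<Sum>x\<leftarrow>xs. fps_nth (F x) n)"
  by (induction xs) auto

lemma norm_sum_list_le:
  fixes f :: "'b \<Rightarrow> 'a::real_normed_vector"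
  shows "norm (\<Sum>x\<leftarrow>xs. f x) \<le> (\<Sum>x\<leftarrow>xs. norm (f x))"
  by (induction xs) (auto intro: norm_triangle_mono)

lemma has_fps_expansion_unique:
  fixes f :: "complex \<Rightarrow> complex"
  assumes "f has_fps_expansion F" "g has_fps_expansion G" "\<forall>\<^sub>F z in nhds 0. f z = g z"
  shows "F = G"
proof -
  have "g has_fps_expansion F"
    using assms has_fps_expansion_cong[of f g F F] by simp
  then show ?thesis
    using assms(2) fps_expansion_eqI by metis
qed

lemma eventually_nhds_shift_0:
  fixes a :: "'a::real_normed_vector"
  shows "(\<forall>\<^sub>F x in nhds 0. P (a + x)) \<longleftrightarrow> (\<forall>\<^sub>F z in nhds a. P z)"
  by (simp add: nhds_to_0'[of a] eventually_filtermap)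

lemma fps_conv_radius_ge_geometric:
  fixes F :: "complex fps"
  assumes "\<And>k. norm (fps_nth F k) \<le> M * K ^ k" "K > 0"
  shows "fps_conv_radius F \<ge> ereal (1 / K)"
  unfolding fps_conv_radius_def
proof (rule conv_radius_geI_ex')
  fix r :: real assume r: "0 < r" "ereal r < ereal (1 / K)"
  then have "norm (K * r) < 1" using assms(2) by (simp add: field_simps)
  then have "summable (\<lambda>n. M * (K * r) ^ n)"
    by (intro summable_mult summable_geometric)
  moreover have "norm (fps_nth F n * of_real r ^ n) \<le> M * (K * r) ^ n" for n
    using assms(1)[of n] r
    by (simp add: norm_mult norm_power power_mult_distrib mult_right_mono mult.assoc[symmetric])
  ultimately show "summable (\<lambda>n. fps_nth F n * of_real r ^ n)"
    by (rule summable_comparison_test'[where N = 0])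
qed

text \<open>
  For a quadratic system the bound \<open>M (C M)\<^sup>k\<close> on the Taylor coefficients reproduces itself: the Cauchy
  product contributes \<open>k + 1\<close> equal terms, which cancel against the factor \<open>k + 1\<close> of the derivative.
\<close>

lemma quadratic_ode_extension:
  fixes Z :: "nat \<Rightarrow> complex \<Rightarrow> complex" and L :: "nat \<Rightarrow> (complex \<times> nat \<times> nat) list"
  assumes an: "\<And>i. i < N \<Longrightarrow> Z i analytic_on {a}"
    and ode: "\<And>i. i < N \<Longrightarrow>
      \<forall>\<^sub>F z in nhds a. deriv (Z i) z = (\<Sum>(c, j, l)\<leftarrow>L i. c * (Z j z * Z l z))"
    and idx: "\<And>i c j l. i < N \<Longrightarrow> (c, j, l) \<in> set (L i) \<Longrightarrow> j < N \<and> l < N"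
    and C: "\<And>i. i < N \<Longrightarrow> (\<Sum>(c, j, l)\<leftarrow>L i. norm c) \<le> C"
    and M: "\<And>i. i < N \<Longrightarrow> norm (Z i a) \<le> M"
    and pos: "C > 0" "M > 0"
  obtains F where "\<And>i. i < N \<Longrightarrow> F i holomorphic_on ball a (1 / (C * M))"
    and "\<And>i. i < N \<Longrightarrow> \<forall>\<^sub>F z in nhds a. F i z = Z i z"
proof -
  define f where "f i = fps_expansion (Z i) a" for i
  have f: "(\<lambda>x. Z i (a + x)) has_fps_expansion f i" if "i < N" for i
    using analytic_at_imp_has_fps_expansion[OF an[OF that]] by (simp add: f_def)
  have f0: "fps_nth (f i) 0 = Z i a" if "i < N" for i
    using fps_nth_fps_expansion[OF f[OF that], of 0] by simp
  have df: "fps_deriv (f i) = (\<Sum>(c, j, l)\<leftarrow>L i. fps_const c * (f j * f l))" if i: "i < N" for i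
  proof (rule has_fps_expansion_unique)
    show "deriv (\<lambda>x. Z i (a + x)) has_fps_expansion fps_deriv (f i)"
      using f[OF i] by (rule has_fps_expansion_deriv)
    show "(\<lambda>x. \<Sum>(c, j, l)\<leftarrow>L i. c * (Z j (a + x) * Z l (a + x))) has_fps_expansion
        (\<Sum>(c, j, l)\<leftarrow>L i. fps_const c * (f j * f l))"
      unfolding case_prod_unfold
      by (intro has_fps_expansion_sum_list fps_expansion_intros f) (use idx[OF i] in force)+
    have "deriv (\<lambda>x. Z i (a + x)) x = deriv (Z i) (a + x)" for x
      by (simp add: deriv_shift_0' add_ac o_def)
    with ode[OF i] show "\<forall>\<^sub>F x in nhds 0. deriv (\<lambda>x. Z i (a + x)) x
        = (\<Sum>(c, j, l)\<leftarrow>L i. c * (Z j (a + x) * Z l (a + x)))"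
      by (simp only: eventually_nhds_shift_0[where P = "\<lambda>z. deriv (Z i) z = (\<Sum>(c, j, l)\<leftarrow>L i. c * (Z j z * Z l z))"])
  qed
  define K where "K = C * M"
  have K: "K > 0" using pos by (simp add: K_def)
  have bound: "\<forall>i<N. norm (fps_nth (f i) k) \<le> M * K ^ k" for k
  proof (induction k rule: less_induct)
    case (less k)
    show ?case
    proof (intro allI impI)
      fix i assume i: "i < N"
      show "norm (fps_nth (f i) k) \<le> M * K ^ k"
      proof (cases k)
        case 0
        then show ?thesis using f0[OF i] M[OF i] by simp
      next
        case (Suc m)
        have prod: "norm (fps_nth (f j * f l) m) \<le> real (Suc m) * (M * M * K ^ m)"
          if "j < N" "l < N" for j l
        proof -
          have "norm (fps_nth (f j * f l) m) \<le> (\<Sum>s=0..m. norm (fps_nth (f j) s * fps_nth (f l) (m - s)))"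
            by (simp only: fps_mult_nth) (rule norm_sum)
          also have "\<dots> \<le> (\<Sum>s=0..m. (M * K ^ s) * (M * K ^ (m - s)))"
            unfolding norm_mult using that less Suc K pos
            by (intro sum_mono mult_mono) auto
          also have "\<dots> = (\<Sum>s=0..m. M * M * K ^ m)"
            by (intro sum.cong refl) (simp add: power_add[symmetric] mult_ac)
          finally show ?thesis by simp
        qed
        have "norm (of_nat (Suc m) * fps_nth (f i) (Suc m)) = norm (fps_nth (fps_deriv (f i)) m)"
          by simp
        also have "\<dots> = norm (\<Sum>(c, j, l)\<leftarrow>L i. c * fps_nth (f j * f l) m)"
          by (simp add: df[OF i] fps_nth_sum_list case_prod_unfold)
        also have "\<dots> \<le> (\<Sum>(c, j, l)\<leftarrow>L i. norm (c * fps_nth (f j * f l) m))"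
          unfolding case_prod_unfold by (rule norm_sum_list_le)
        also have "\<dots> \<le> (\<Sum>(c, j, l)\<leftarrow>L i. norm c * (real (Suc m) * (M * M * K ^ m)))"
        proof (rule sum_list_mono, clarify)
          fix c j l assume "(c, j, l) \<in> set (L i)"
          then have "norm (fps_nth (f j * f l) m) \<le> real (Suc m) * (M * M * K ^ m)"
            using idx[OF i] prod by blast
          then show "norm (c * fps_nth (f j * f l) m) \<le> norm c * (real (Suc m) * (M * M * K ^ m))"
            unfolding norm_mult by (rule mult_left_mono) simp
        qed
        also have "\<dots> = (\<Sum>(c, j, l)\<leftarrow>L i. norm c) * (real (Suc m) * (M * M * K ^ m))"
          by (simp add: case_prod_unfold sum_list_mult_const)
        also have "\<dots> \<le> C * (real (Suc m) * (M * M * K ^ m))"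
          using C[OF i] pos K by (intro mult_right_mono) auto
        also have "\<dots> = real (Suc m) * (M * K ^ k)"
          using Suc by (simp add: K_def mult_ac)
        finally show ?thesis
          unfolding Suc norm_mult norm_of_nat by (rule mult_left_le_imp_le) auto
      qed
    qed
  qed
  define F where "F i z = eval_fps (f i) (z - a)" for i z
  show thesis
  proof (rule that)
    fix i assume i: "i < N"
    have rad: "fps_conv_radius (f i) \<ge> ereal (1 / K)"
      using bound i K by (intro fps_conv_radius_ge_geometric[where M = M]) auto
    have "(eval_fps (f i) \<circ> (\<lambda>z. z - a)) holomorphic_on ball a (1 / K)"
    proof (rule holomorphic_on_compose_gen)
      show "eval_fps (f i) holomorphic_on eball 0 (fps_conv_radius (f i))"
        by (intro holomorphic_intros) auto
      show "(\<lambda>z. z - a) ` ball a (1 / K) \<subseteq> eball 0 (fps_conv_radius (f i))"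
        using rad order.strict_trans2[of "ereal _" "ereal (1 / K)"]
        by (auto simp: dist_norm norm_minus_commute)
    qed (intro holomorphic_intros)
    then show "F i holomorphic_on ball a (1 / (C * M))"
      by (simp add: F_def[abs_def] o_def K_def)
    have "\<forall>\<^sub>F x in nhds 0. eval_fps (f i) x = Z i (a + x)"
      using f[OF i] by (simp add: has_fps_expansion_def)
    then have "\<forall>\<^sub>F x in nhds 0. F i (a + x) = Z i (a + x)"
      by (simp add: F_def)
    then show "\<forall>\<^sub>F z in nhds a. F i z = Z i z"
      by (rule eventually_nhds_shift_0[THEN iffD1])
  qed
qed

section \<open>Regular coordinates at zeros and poles\<close>

definition dlog :: "(complex \<Rightarrow> complex) \<Rightarrow> complex \<Rightarrow> complex" where
  "dlog f z = deriv f z / f z"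

text \<open>The equation u'' = e^(z+u) - e^(2z-2u) for u = ln f, multiplied by f^2, since f f'' -
  f'^2 = f^2 u''. Neither a branch of ln f nor a quotient occurs.\<close>

definition dP3_ode :: "(complex \<Rightarrow> complex) \<Rightarrow> complex \<Rightarrow> bool" where
  "dP3_ode f z \<longleftrightarrow> f z * deriv (deriv f) z - (deriv f z)\<^sup>2 = exp z * f z ^ 3 - exp z ^ 2"

definition energy :: "(complex \<Rightarrow> complex) \<Rightarrow> complex \<Rightarrow> complex" where
  "energy f z = (dlog f z)\<^sup>2 / 2 - exp z * f z - exp z ^ 2 / (2 * (f z)\<^sup>2)"

lemma analytic_has_deriv:
  assumes "f analytic_on {z}"
  shows "(f has_field_derivative deriv f z) (at z)"
  using assms analytic_on_imp_differentiable_at DERIV_deriv_iff_field_differentiable by blast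

lemma dlog_has_deriv:
  assumes "f analytic_on {z}" "f z \<noteq> 0"
  shows "(dlog f has_field_derivative
     (f z * deriv (deriv f) z - (deriv f z)\<^sup>2) / (f z)\<^sup>2) (at z)"
  unfolding dlog_def[abs_def]
  by (rule derivative_eq_intros analytic_has_deriv analytic_deriv assms refl)+
     (use assms in \<open>simp add: power2_eq_square mult_ac\<close>)

lemma dlog_has_deriv_ode:
  assumes "f analytic_on {z}" "f z \<noteq> 0" "dP3_ode f z"
  shows "(dlog f has_field_derivative (exp z * f z - exp z ^ 2 / (f z)\<^sup>2)) (at z)"
proof -
  have "(f z * deriv (deriv f) z - (deriv f z)\<^sup>2) / (f z)\<^sup>2 = exp z * f z - exp z ^ 2 / (f z)\<^sup>2"
    using assms by (simp add: dP3_ode_def field_simps power2_eq_square power3_eq_cube)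
  then show ?thesis
    using dlog_has_deriv[OF assms(1,2)] by simp
qed

text \<open>By the equation all terms with u' cancel; only the explicit dependence of E on z
  contributes.\<close>

lemma energy_has_deriv:
  assumes "f analytic_on {z}" "f z \<noteq> 0" "dP3_ode f z"
  shows "(energy f has_field_derivative (- exp z * f z - exp z ^ 2 / (f z)\<^sup>2)) (at z)"
proof -
  have f: "(f has_field_derivative dlog f z * f z) (at z)"
    using analytic_has_deriv[OF assms(1)] assms(2) by (simp add: dlog_def)
  show ?thesis
    unfolding energy_def[abs_def]
    by (rule derivative_eq_intros dlog_has_deriv_ode[OF assms] f refl | simp add: assms(2))+
       (use assms(2) in \<open>simp add: field_simps power2_eq_square power4_eq_xxxx\<close>)
qed

lemma dlog_analytic:
  assumes "f analytic_on {z}" "f z \<noteq> 0"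
  shows "dlog f analytic_on {z}"
  unfolding dlog_def[abs_def] using assms by (intro analytic_intros) auto

lemma energy_analytic:
  assumes "f analytic_on {z}" "f z \<noteq> 0"
  shows "energy f analytic_on {z}"
  unfolding energy_def[abs_def] using assms dlog_analytic[OF assms] by (intro analytic_intros) auto

lemma eventually_analytic_nonzero:
  assumes "f analytic_on {a}" "f a \<noteq> 0"
  shows "\<forall>\<^sub>F z in nhds a. f analytic_on {z} \<and> f z \<noteq> 0"
proof -
  obtain A where A: "open A" "a \<in> A" "f holomorphic_on A"
    using assms(1) by (auto simp: analytic_at)
  have "\<forall>\<^sub>F z in nhds a. f analytic_on {z}"
    by (rule eventually_mono[OF eventually_nhds_in_open[OF A(1,2)]]) (use A in \<open>auto simp: analytic_at\<close>)
  moreover have "\<forall>\<^sub>F z in nhds a. f z \<noteq> 0"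
    using analytic_at_neq_imp_eventually_neq[OF assms] assms(2)
    by (simp add: eventually_nhds_conv_at)
  ultimately show ?thesis by eventually_elim simp
qed

lemma eventually_regular:
  assumes "f analytic_on {a}" "f a \<noteq> 0" "\<forall>\<^sub>F z in nhds a. dP3_ode f z"
  shows "\<forall>\<^sub>F z in nhds a. f analytic_on {z} \<and> f z \<noteq> 0 \<and> dP3_ode f z"
  using eventually_analytic_nonzero[OF assms(1,2)] assms(3) by eventually_elim simp

text \<open>The value at a pole is 0 by convention, so a nonzero value excludes zeros and poles at
  once.\<close>

lemma nicely_meromorphic_nonzero_imp_analytic:
  assumes "f nicely_meromorphic_on A" "z \<in> A" "f z \<noteq> 0"
  shows "f analytic_on {z}"
  using nicely_meromorphic_on_imp_analytic_at is_pole_zero_at_nicely_mero assms by blast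

text \<open>Together with \<open>eval_nat_numeral\<close>, splits a claim about all components of a
  system of fixed size into its instances.\<close>

lemma all_less_Suc_iff: "(\<forall>i<Suc n. P i) \<longleftrightarrow> P n \<and> (\<forall>i<n. P i)"
  by (auto simp: less_Suc_eq)

text \<open>Put H = E - u'. Substituting y'^2 = 2 y^2 H + 2 y y' + 2 e^T y^3 + e^(2T) into the
  equation cancels e^(2T), and the rest is divisible by y: y'' = 2 y' + 3 e^T y^2 + 2 y H. With H' =
  -2 e^T y nothing singular at y = 0 remains.\<close>

lemma chart_zero:
  assumes f: "f analytic_on {a}" "f a \<noteq> 0" "\<forall>\<^sub>F z in nhds a. dP3_ode f z"
    and M: "1 \<le> M" "norm (exp a) \<le> M" "norm (f a) \<le> 1" "norm (deriv f a) \<le> M"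
      "norm (energy f a - dlog f a) \<le> M"
  obtains g where "g holomorphic_on ball a (1 / (7 * M))" "\<forall>\<^sub>F z in nhds a. g z = f z"
proof -
  \<comment> \<open>The constant 1 at index 0 pads linear terms to products; y^2 at index 4 makes
    e^T y^2 a product of two unknowns.\<close>
  define Z where "Z i = [\<lambda>z. 1, exp, f, deriv f, \<lambda>z. (f z)\<^sup>2, \<lambda>z. energy f z - dlog f z] ! i" for i
  define L :: "nat \<Rightarrow> (complex \<times> nat \<times> nat) list" where "L i = [[], [(1, 1, 0)], [(1, 3, 0)],
    [(2, 3, 0), (3, 1, 4), (2, 2, 5)], [(2, 2, 3)], [(-2, 1, 2)]] ! i" for i
  have an: "\<forall>i<6. Z i analytic_on {a}"
    unfolding Z_def using f dlog_analytic[OF f(1,2)] energy_analytic[OF f(1,2)]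
    by (simp add: eval_nat_numeral all_less_Suc_iff) (auto intro!: analytic_intros)
  have ode: "\<forall>i<6. \<forall>\<^sub>F z in nhds a. deriv (Z i) z = (\<Sum>(c, j, l)\<leftarrow>L i. c * (Z j z * Z l z))"
  proof -
    have "\<forall>\<^sub>F z in nhds a. \<forall>i<6. deriv (Z i) z = (\<Sum>(c, j, l)\<leftarrow>L i. c * (Z j z * Z l z))"
      using eventually_regular[OF f]
    proof eventually_elim
      case (elim z)
      note d1 = analytic_has_deriv[of f z] and d2 = analytic_has_deriv[OF analytic_deriv, of f z]
      have 1: "deriv exp z = exp z" by (rule DERIV_imp_deriv) simp
      have 2: "deriv (\<lambda>z. (f z)\<^sup>2) z = 2 * (f z * deriv f z)"
        by (rule DERIV_imp_deriv) (use elim d1 in \<open>auto intro!: derivative_eq_intros\<close>)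
      have 3: "deriv (\<lambda>z. energy f z - dlog f z) z = -2 * (exp z * f z)"
        by (rule DERIV_imp_deriv)
           (use elim in \<open>auto intro!: derivative_eq_intros energy_has_deriv dlog_has_deriv_ode\<close>)
      have 4: "deriv (deriv f) z = 2 * deriv f z + (3 * (exp z * (f z)\<^sup>2) + 2 * (f z * (energy f z - dlog f z)))"
        using elim unfolding dP3_ode_def energy_def dlog_def
        by (simp add: field_simps power2_eq_square power3_eq_cube) algebra
      show ?case
        unfolding Z_def L_def using 1 2 3 4 by (simp add: eval_nat_numeral all_less_Suc_iff)
    qed
    then show ?thesis by (auto elim: eventually_mono)
  qed
  have ix: "\<forall>i<6. \<forall>(c, j, l)\<in>set (L i). j < 6 \<and> l < 6"
    unfolding L_def by (simp add: eval_nat_numeral all_less_Suc_iff)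
  \<comment> \<open>7 = 2 + 3 + 2, from the equation for y''.\<close>
  have C: "\<forall>i<6. (\<Sum>(c, j, l)\<leftarrow>L i. norm c) \<le> 7"
    unfolding L_def by (simp add: eval_nat_numeral all_less_Suc_iff)
  have "norm (f a) ^ 2 \<le> 1" using M by (simp add: power_le_one)
  then have Mb: "\<forall>i<6. norm (Z i a) \<le> M"
    unfolding Z_def using M by (simp add: eval_nat_numeral all_less_Suc_iff norm_mult)
  obtain F where F: "\<And>i. i < 6 \<Longrightarrow> F i holomorphic_on ball a (1 / (7 * M))"
      "\<And>i. i < 6 \<Longrightarrow> \<forall>\<^sub>F z in nhds a. F i z = Z i z"
    by (rule quadratic_ode_extension[of 6 Z a L 7 M]) (use an ode ix C Mb M in \<open>force+\<close>)
  from F[of 2] show thesis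
    by (intro that[of "F 2"]) (simp_all add: Z_def)
qed

text \<open>With y = q^-2 one has u' = -2 q'/q, so |q'|^2 = |u'|^2 / (4 |y|) and the hypothesis on
  \<open>dlog f a\<close> is a bound on q'; likewise |y| >= 1 means |q| <= 1. The conclusion
  provides the continuation of q itself, because y may have poles in the larger disc.\<close>

lemma chart_pole:
  assumes f: "f analytic_on {a}" "f a \<noteq> 0" "\<forall>\<^sub>F z in nhds a. dP3_ode f z"
    and M: "1 \<le> M" "norm (exp a) \<le> M" "1 \<le> norm (f a)" "norm (dlog f a) ^ 2 \<le> M ^ 2 * norm (f a)"
      "norm (energy f a + dlog f a) \<le> M"
  obtains g where "g holomorphic_on ball a (1 / (7 * M))" "\<forall>\<^sub>F z in nhds a. inverse ((g z)\<^sup>2) = f z"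
proof -
  obtain e where e: "e > 0" "f holomorphic_on ball a e" "\<And>z. z \<in> ball a e \<Longrightarrow> f z \<noteq> 0"
  proof -
    obtain e where "e > 0" "\<forall>z. dist z a < e \<longrightarrow> f analytic_on {z} \<and> f z \<noteq> 0"
      using eventually_analytic_nonzero[OF f(1,2)] unfolding eventually_nhds_metric by blast
    moreover from this have "f analytic_on ball a e"
      by (subst analytic_on_analytic_at) (auto simp: dist_commute)
    ultimately show thesis
      by (intro that[of e]) (auto simp: analytic_imp_holomorphic dist_commute)
  qed
  obtain p where p: "p holomorphic_on ball a e" "\<And>z. z \<in> ball a e \<Longrightarrow> f z = (p z)\<^sup>2"
    using contractible_imp_holomorphic_sqrt[OF e(2) convex_imp_contractible e(3)] by auto
  define q where "q z = inverse (p z)" for z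
  have p0: "p z \<noteq> 0" if "z \<in> ball a e" for z
    using e(3)[OF that] p(2)[OF that] by auto
  have q: "q holomorphic_on ball a e"
    unfolding q_def using p p0 by (intro holomorphic_intros) auto
  have fq: "f z = inverse ((q z)\<^sup>2)" and q0: "q z \<noteq> 0" if "z \<in> ball a e" for z
    using p(2)[OF that] p0[OF that] by (auto simp: q_def power_inverse)
  have qa: "q analytic_on {z}" if "z \<in> ball a e" for z
    unfolding analytic_at using q that open_ball by blast
  have df: "deriv f z = -2 * deriv q z / q z ^ 3" if z: "z \<in> ball a e" for z
  proof -
    have "((\<lambda>z. inverse ((q z)\<^sup>2)) has_field_derivative -2 * deriv q z / q z ^ 3) (at z)"
      by (rule derivative_eq_intros analytic_has_deriv qa[OF z] refl | simp add: q0[OF z])+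
         (use q0[OF z] in \<open>simp add: field_simps power2_eq_square power3_eq_cube\<close>)
    then have "(f has_field_derivative -2 * deriv q z / q z ^ 3) (at z)"
      by (rule has_field_derivative_transform_within_open[OF _ open_ball z]) (simp add: fq)
    then show ?thesis by (rule DERIV_imp_deriv)
  qed
  have ddf: "deriv (deriv f) z = -2 * deriv (deriv q) z / q z ^ 3 + 6 * (deriv q z)\<^sup>2 / q z ^ 4"
    if z: "z \<in> ball a e" for z
  proof -
    have "((\<lambda>z. -2 * deriv q z / q z ^ 3) has_field_derivative
        -2 * deriv (deriv q) z / q z ^ 3 + 6 * (deriv q z)\<^sup>2 / q z ^ 4) (at z)"
      by (rule derivative_eq_intros analytic_has_deriv analytic_deriv qa[OF z] refl
          | simp add: q0[OF z])+
         (use q0[OF z] in \<open>simp add: field_simps eval_nat_numeral\<close>)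
    then have "(deriv f has_field_derivative
        -2 * deriv (deriv q) z / q z ^ 3 + 6 * (deriv q z)\<^sup>2 / q z ^ 4) (at z)"
      by (rule has_field_derivative_transform_within_open[OF _ open_ball z]) (simp add: df)
    then show ?thesis by (rule DERIV_imp_deriv)
  qed
  txt \<open>The energy eliminates the singular term \<open>(q'\<^sup>2 - e\<^sup>T / 2) / q\<close> of \<open>q''\<close>; the powers of \<open>q\<close> are extra
    unknowns that make the system quadratic.\<close>
  define Z where "Z i = [\<lambda>z. 1, exp, q, deriv q, \<lambda>z. exp z * q z, \<lambda>z. exp z * (q z)\<^sup>2,
    \<lambda>z. exp z * q z ^ 3, \<lambda>z. energy f z + dlog f z] ! i" for i
  \<comment> \<open>In q'' the term e^(2T) q^5 is the product of e^T q^2 and e^T q^3; the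
    derivatives of the functions e^T q^k are again quadratic in the listed unknowns.\<close>
  define L :: "nat \<Rightarrow> (complex \<times> nat \<times> nat) list" where "L i = [[], [(1, 1, 0)], [(1, 3, 0)],
    [(1, 3, 0), (3/4, 5, 6), (1/2, 2, 7)], [(1, 4, 0), (1, 1, 3)], [(1, 5, 0), (2, 4, 3)],
    [(1, 6, 0), (3, 5, 3)], [(-2, 5, 5)]] ! i" for i
  have ae: "a \<in> ball a e" using e(1) by simp
  have an: "\<forall>i<8. Z i analytic_on {a}"
    unfolding Z_def using qa[OF ae] dlog_analytic[OF f(1,2)] energy_analytic[OF f(1,2)]
    by (simp add: eval_nat_numeral all_less_Suc_iff) (auto intro!: analytic_intros)
  have ode: "\<forall>i<8. \<forall>\<^sub>F z in nhds a. deriv (Z i) z = (\<Sum>(c, j, l)\<leftarrow>L i. c * (Z j z * Z l z))"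
  proof -
    have "\<forall>\<^sub>F z in nhds a. z \<in> ball a e"
      using ae by (intro eventually_nhds_in_open) auto
    then have "\<forall>\<^sub>F z in nhds a. \<forall>i<8. deriv (Z i) z = (\<Sum>(c, j, l)\<leftarrow>L i. c * (Z j z * Z l z))"
      using eventually_regular[OF f]
    proof eventually_elim
      case (elim z)
      note dq = analytic_has_deriv[OF qa[OF elim(1)]] and q0z = q0[OF elim(1)]
      have 1: "deriv exp z = exp z" by (rule DERIV_imp_deriv) simp
      have 2: "deriv (\<lambda>z. exp z * q z) z = exp z * q z + exp z * deriv q z"
        by (rule DERIV_imp_deriv) (use dq in \<open>auto intro!: derivative_eq_intros\<close>)
      have 3: "deriv (\<lambda>z. exp z * (q z)\<^sup>2) z = exp z * (q z)\<^sup>2 + 2 * (exp z * q z * deriv q z)"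
        by (rule DERIV_imp_deriv) (use dq in \<open>auto intro!: derivative_eq_intros\<close>)
      have 4: "deriv (\<lambda>z. exp z * q z ^ 3) z = exp z * q z ^ 3 + 3 * (exp z * (q z)\<^sup>2 * deriv q z)"
        by (rule DERIV_imp_deriv) (use dq in \<open>auto intro!: derivative_eq_intros\<close>)
      have 5: "deriv (\<lambda>z. energy f z + dlog f z) z = -2 * (exp z * (q z)\<^sup>2 * (exp z * (q z)\<^sup>2))"
        by (rule DERIV_imp_deriv)
           (use elim fq[OF elim(1)] in \<open>auto intro!: derivative_eq_intros energy_has_deriv dlog_has_deriv_ode
             simp: power2_eq_square divide_inverse mult_ac\<close>)
      have H: "energy f z + dlog f z
          = 2 * (deriv q z)\<^sup>2 / (q z)\<^sup>2 - exp z / (q z)\<^sup>2 - exp z ^ 2 * q z ^ 4 / 2 - 2 * deriv q z / q z"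
        using q0z unfolding energy_def dlog_def df[OF elim(1)] fq[OF elim(1)]
        by (simp add: field_simps eval_nat_numeral)
      have 6: "q z * (energy f z + dlog f z)
          = 2 * (deriv q z)\<^sup>2 / q z - exp z / q z - exp z ^ 2 * q z ^ 5 / 2 - 2 * deriv q z"
        unfolding H using q0z by (simp add: field_simps eval_nat_numeral)
      have "inverse ((q z)\<^sup>2) * (-2 * deriv (deriv q) z / q z ^ 3 + 6 * (deriv q z)\<^sup>2 / q z ^ 4)
         - (-2 * deriv q z / q z ^ 3)\<^sup>2 = exp z * inverse ((q z)\<^sup>2) ^ 3 - exp z ^ 2" (is "?l = ?r")
        using elim(2) unfolding dP3_ode_def ddf[OF elim(1)] df[OF elim(1)] fq[OF elim(1)] by simp
      then have H6: "?l * q z ^ 6 = ?r * q z ^ 6" by simp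
      have l6: "?l * q z ^ 6 = -2 * deriv (deriv q) z * q z + 2 * (deriv q z)\<^sup>2"
        using q0z by (simp add: field_simps eval_nat_numeral)
      have r6: "?r * q z ^ 6 = exp z - exp z ^ 2 * q z ^ 6"
        using q0z by (simp add: field_simps eval_nat_numeral)
      from H6[unfolded l6 r6]
      have "2 * q z * deriv (deriv q) z = 2 * (deriv q z)\<^sup>2 - exp z + exp z ^ 2 * q z ^ 6"
        by (simp add: algebra_simps)
      then have "deriv (deriv q) z = (2 * (deriv q z)\<^sup>2 - exp z + exp z ^ 2 * q z ^ 6) / (2 * q z)"
        using q0z by (simp add: eq_divide_eq mult_ac)
      also have "\<dots> = (deriv q z)\<^sup>2 / q z - exp z / (2 * q z) + exp z ^ 2 * q z ^ 5 / 2"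
        using q0z by (simp add: field_simps eval_nat_numeral)
      finally have 7: "deriv (deriv q) z = deriv q z + (3 * (exp z * (q z)\<^sup>2 * (exp z * q z ^ 3)) / 4
          + q z * (energy f z + dlog f z) / 2)"
        unfolding 6 using q0z by (simp add: field_simps eval_nat_numeral)
      show ?case
        unfolding Z_def L_def using 1 2 3 4 5 7 by (simp add: eval_nat_numeral all_less_Suc_iff)
    qed
    then show ?thesis by (auto elim: eventually_mono)
  qed
  have ix: "\<forall>i<8. \<forall>(c, j, l)\<in>set (L i). j < 8 \<and> l < 8"
    unfolding L_def by (simp add: eval_nat_numeral all_less_Suc_iff)
  \<comment> \<open>The same constant as in \<open>chart_zero\<close>, so that both charts have
    radius 1/(7M).\<close>
  have C: "\<forall>i<8. (\<Sum>(c, j, l)\<leftarrow>L i. norm c) \<le> 7"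
    unfolding L_def by (simp add: eval_nat_numeral all_less_Suc_iff norm_divide)
  have qf: "(norm (q a))\<^sup>2 * norm (f a) = 1"
    using fq[OF ae] q0[OF ae] by (simp add: norm_inverse norm_power)
  then have "(norm (q a))\<^sup>2 \<le> 1"
    using M(3) mult_left_mono[of 1 "norm (f a)" "(norm (q a))\<^sup>2"] by simp
  then have q1: "norm (q a) \<le> 1" by (simp add: abs_square_le_1)
  have "dlog f a = -2 * deriv q a / q a"
    using q0[OF ae] unfolding dlog_def df[OF ae] fq[OF ae] by (simp add: field_simps eval_nat_numeral)
  then have "deriv q a = - dlog f a * q a / 2"
    using q0[OF ae] by simp
  then have "(norm (deriv q a))\<^sup>2 = (norm (dlog f a))\<^sup>2 * (norm (q a))\<^sup>2 / 4"
    by (simp add: norm_mult norm_divide power_divide power_mult_distrib)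
  also have "\<dots> \<le> (M ^ 2 * norm (f a)) * (norm (q a))\<^sup>2 / 4"
    using M(4) by (intro divide_right_mono mult_right_mono) auto
  also have "\<dots> = M ^ 2 * ((norm (q a))\<^sup>2 * norm (f a)) / 4"
    by (simp only: mult_ac)
  also have "\<dots> \<le> M ^ 2" using qf by simp
  finally have q2: "norm (deriv q a) \<le> M"
    using M(1) by (simp add: power2_le_iff_abs_le)
  have e_q: "norm (exp a * q a ^ k) \<le> M" for k
    using mult_mono[of "norm (exp a)" M "norm (q a ^ k)" 1] M q1
    by (simp add: norm_mult norm_power power_le_one)
  have Mb: "\<forall>i<8. norm (Z i a) \<le> M"
    unfolding Z_def using M q1 q2 e_q[of 1] e_q[of 2] e_q[of 3]
    by (simp add: eval_nat_numeral all_less_Suc_iff)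
  obtain F where F: "\<And>i. i < 8 \<Longrightarrow> F i holomorphic_on ball a (1 / (7 * M))"
      "\<And>i. i < 8 \<Longrightarrow> \<forall>\<^sub>F z in nhds a. F i z = Z i z"
    by (rule quadratic_ode_extension[of 8 Z a L 7 M]) (use an ode ix C Mb M in \<open>force+\<close>)
  have "\<forall>\<^sub>F z in nhds a. z \<in> ball a e"
    using ae by (intro eventually_nhds_in_open) auto
  moreover have "\<forall>\<^sub>F z in nhds a. F 2 z = q z"
    using F(2)[of 2] by (simp add: Z_def)
  ultimately have "\<forall>\<^sub>F z in nhds a. inverse ((F 2 z)\<^sup>2) = f z"
    by eventually_elim (simp add: fq)
  with F(1)[of 2] show thesis
    by (intro that[of "F 2"]) simp_all
qed

section \<open>The Lyapunov function\<close>

text \<open>At s = 1 the solution is not known to exist yet, so the bound B has to be uniform over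
  the half-open interval.\<close>

lemma affine_gronwall:
  fixes W :: "real \<Rightarrow> complex"
  assumes W: "\<And>s. 0 \<le> s \<Longrightarrow> s < 1 \<Longrightarrow> (W has_vector_derivative W' s) (at s)"
    and bound: "\<And>s. 0 \<le> s \<Longrightarrow> s < 1 \<Longrightarrow> norm (W' s) \<le> C * (norm (W s) + 1)"
    and C: "C \<ge> 0"
  obtains B where "B \<ge> 1" "\<And>s. 0 \<le> s \<Longrightarrow> s < 1 \<Longrightarrow> norm (W s) \<le> B"
proof -
  \<comment> \<open>Unlike |W|, the function 1 + |W|^2 is differentiable where W vanishes. The rate
    4C comes from 2 (W \<bullet> W') <= 2 C |W| (|W| + 1) <= 4 C (1 + |W|^2).\<close>
  define N where "N s = (1 + W s \<bullet> W s) * exp (- (4 * C) * s)" for s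
  have N: "N t \<le> N 0" if t: "0 \<le> t" "t < 1" for t
  proof (rule DERIV_nonpos_imp_nonincreasing[OF t(1)])
    fix s assume "0 \<le> s" "s \<le> t"
    with t have s: "0 \<le> s" "s < 1" by auto
    have "((\<lambda>s. W s \<bullet> W s) has_vector_derivative (W s \<bullet> W' s + W' s \<bullet> W s)) (at s)"
      by (rule bounded_bilinear.has_vector_derivative[OF bounded_bilinear_inner]) (use W[OF s] in auto)
    then have d: "((\<lambda>s. W s \<bullet> W s) has_real_derivative 2 * (W s \<bullet> W' s)) (at s)"
      by (simp add: has_real_derivative_iff_has_vector_derivative inner_commute)
    have D: "(N has_real_derivative (2 * (W s \<bullet> W' s) - 4 * C * (1 + W s \<bullet> W s)) * exp (- (4 * C) * s)) (at s)"
      unfolding N_def[abs_def]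
      by (rule derivative_eq_intros d refl)+ (simp add: algebra_simps)
    have "W s \<bullet> W' s \<le> norm (W s) * (C * (norm (W s) + 1))"
      using norm_cauchy_schwarz[of "W s" "W' s"] mult_left_mono[OF bound[OF s], of "norm (W s)"] by simp
    also have "\<dots> \<le> C * (2 * (1 + (norm (W s))\<^sup>2))"
    proof -
      have "norm (W s) * (norm (W s) + 1) \<le> 2 * (1 + (norm (W s))\<^sup>2)"
        using zero_le_power2[of "norm (W s) - 1"] zero_le_square[of "norm (W s)"]
        by (simp add: power2_eq_square algebra_simps del: zero_le_square) (use zero_le_square[of "norm (W s)"] in linarith)
      from mult_left_mono[OF this C] show ?thesis by (simp add: mult_ac)
    qed
    finally have "(2 * (W s \<bullet> W' s) - 4 * C * (1 + W s \<bullet> W s)) \<le> 0"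
      by (simp add: dot_square_norm algebra_simps)
    then show "\<exists>y. (N has_real_derivative y) (at s) \<and> y \<le> 0"
      using D by (intro exI[of _ "(2 * (W s \<bullet> W' s) - 4 * C * (1 + W s \<bullet> W s)) * exp (- (4 * C) * s)"])
        (auto intro: mult_nonpos_nonneg)
  qed
  define B where "B = (1 + (norm (W 0))\<^sup>2) * exp (4 * C)"
  have B1: "1 \<le> B"
    unfolding B_def using mult_mono[of 1 "1 + (norm (W 0))\<^sup>2" 1 "exp (4 * C)"] C by simp
  show thesis
  proof (rule that[OF B1])
    fix s :: real assume s: "0 \<le> s" "s < 1"
    have "(1 + (norm (W s))\<^sup>2) * exp (- (4 * C) * s) \<le> 1 + (norm (W 0))\<^sup>2"
      using N[OF s] by (simp add: N_def dot_square_norm)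
    then have "1 + (norm (W s))\<^sup>2 \<le> (1 + (norm (W 0))\<^sup>2) * exp (4 * C * s)"
      by (simp add: exp_minus field_simps)
    also have "\<dots> \<le> B"
      unfolding B_def using s C by (intro mult_left_mono) (auto intro: mult_left_le)
    finally have "(norm (W s))\<^sup>2 \<le> B" by simp
    also have "\<dots> \<le> B ^ 2" using B1 by (simp add: power2_eq_square)
    finally show "norm (W s) \<le> B"
      using B1 by (simp add: power2_le_iff_abs_le)
  qed
qed

text \<open>
  A holomorphic weight would have poles of its own, forcing detours of the path of continuation;
  \<open>interp\<close> is smooth on the whole Riemann sphere.
\<close>

definition interp :: "complex \<Rightarrow> real" where
  "interp y = ((norm y)\<^sup>2 - 1) / ((norm y)\<^sup>2 + 1)"

definition lyap :: "(complex \<Rightarrow> complex) \<Rightarrow> complex \<Rightarrow> complex" where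
  "lyap f z = energy f z + of_real (interp (f z)) * dlog f z"

lemma abs_interp_le: "\<bar>interp y\<bar> \<le> 1"
  by (simp add: interp_def abs_le_iff field_simps add_pos_nonneg)

lemma interp_add_1: "1 + interp y = 2 * (norm y)\<^sup>2 / ((norm y)\<^sup>2 + 1)"
  by (simp add: interp_def field_simps add_nonneg_eq_0_iff)

lemma interp_diff_1: "1 - interp y = 2 / ((norm y)\<^sup>2 + 1)"
  by (simp add: interp_def field_simps add_nonneg_eq_0_iff)

text \<open>The definition of \<open>lyap\<close> is a quadratic equation for u' =
  \<open>dlog f z\<close>. As |\<phi>| <= 1, its linear term is absorbed by 2 |u'| <= |u'|^2 / 2 +
  2.\<close>

lemma dlog_bound:
  assumes "f z \<noteq> 0" "norm (exp z) \<le> K" "K \<ge> 1"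
  shows "(norm (dlog f z))\<^sup>2 \<le> 4 * norm (lyap f z) + 4 + 4 * K * norm (f z) + 2 * K\<^sup>2 / (norm (f z))\<^sup>2"
proof -
  define u where "u = dlog f z"
  define p where "p = interp (f z)"
  have eq: "u\<^sup>2 = 2 * lyap f z - 2 * (of_real p * u) + (2 * (exp z * f z) + exp z ^ 2 / (f z)\<^sup>2)"
    using assms(1) by (simp add: lyap_def energy_def u_def p_def field_simps)
  have n1: "norm (exp z * f z) \<le> K * norm (f z)"
    using assms by (simp add: norm_mult mult_right_mono)
  have "(norm (exp z))\<^sup>2 \<le> K\<^sup>2" using assms by (intro power_mono) auto
  then have n2: "norm (exp z ^ 2 / (f z)\<^sup>2) \<le> K\<^sup>2 / (norm (f z))\<^sup>2"
    by (simp add: norm_divide norm_power divide_right_mono)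
  have n3: "norm (of_real p * u) \<le> norm u"
    using mult_right_mono[OF abs_interp_le[of "f z"], of "norm u"] by (simp add: norm_mult p_def)
  have "(norm u)\<^sup>2 = norm (2 * lyap f z - 2 * (of_real p * u) + (2 * (exp z * f z) + exp z ^ 2 / (f z)\<^sup>2))"
    unfolding eq[symmetric] by (simp add: norm_power)
  also have "\<dots> \<le> norm (2 * lyap f z) + norm (2 * (of_real p * u))
      + (norm (2 * (exp z * f z)) + norm (exp z ^ 2 / (f z)\<^sup>2))"
    by (intro order.trans[OF norm_triangle_ineq] add_mono norm_triangle_ineq4 norm_triangle_ineq)
  also have "\<dots> \<le> 2 * norm (lyap f z) + 2 * norm u + (2 * (K * norm (f z)) + K\<^sup>2 / (norm (f z))\<^sup>2)"
    using n1 n2 n3 by (simp add: norm_mult)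
  finally have "(norm u)\<^sup>2 \<le> 2 * norm (lyap f z) + 2 * norm u + (2 * (K * norm (f z)) + K\<^sup>2 / (norm (f z))\<^sup>2)" .
  moreover have "2 * norm u \<le> (norm u)\<^sup>2 / 2 + 2"
    using zero_le_power2[of "norm u - 2"] by (simp add: power2_eq_square algebra_simps)
  ultimately show ?thesis by (simp add: u_def)
qed

text \<open>The weight is not holomorphic, so the derivative is taken in the real parameter s. The
  delicate contribution is \<phi>' u', of size at most 4 |\<delta>| b |u'|^2 / (b + 1)^2 with b =
  |y|^2. The factor b / (b + 1)^2 tames both |y| and 1/|y|^2 in \<open>dlog_bound\<close>, which
  leaves a bound affine in \<open>lyap\<close>.\<close>

lemma lyap_has_vector_derivative:
  fixes p \<delta> :: complex and s :: real
  defines "z \<equiv> p + of_real s * \<delta>"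
  assumes f: "f analytic_on {z}" "f z \<noteq> 0" "dP3_ode f z"
    and K: "norm (exp z) \<le> K" "K \<ge> 1"
  obtains w where "((\<lambda>s. lyap f (p + of_real s * \<delta>)) has_vector_derivative w) (at s)"
    "norm w \<le> norm \<delta> * (16 + 17 * K + 10 * K\<^sup>2) * (norm (lyap f z) + 1)"
proof -
  define b where "b = (norm (f z))\<^sup>2"
  define u where "u = dlog f z"
  define b' where "b' = 2 * (f z \<bullet> (\<delta> * (f z * u)))"
  have b: "b > 0" using f(2) by (simp add: b_def)
  have chain: "((\<lambda>s. g (p + of_real s * \<delta>)) has_vector_derivative \<delta> * g') (at s)"
    if "(g has_field_derivative g') (at z)" for g g'
  proof -
    have "((\<lambda>s. p + of_real s * \<delta>) has_vector_derivative \<delta>) (at s)"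
      by (auto intro!: derivative_eq_intros has_vector_derivative_of_real)
    from field_vector_diff_chain_at[OF this, of g g'] that show ?thesis
      by (simp add: o_def z_def)
  qed
  have df: "(f has_field_derivative f z * u) (at z)"
    using analytic_has_deriv[OF f(1)] f(2) by (simp add: dlog_def u_def)
  note vf = chain[OF df]
  have "((\<lambda>s. f (p + of_real s * \<delta>) \<bullet> f (p + of_real s * \<delta>)) has_vector_derivative
      (f z \<bullet> (\<delta> * (f z * u)) + (\<delta> * (f z * u)) \<bullet> f z)) (at s)"
    using bounded_bilinear.has_vector_derivative[OF bounded_bilinear_inner vf vf] by (simp add: z_def)
  then have vb: "((\<lambda>s. (norm (f (p + of_real s * \<delta>)))\<^sup>2) has_real_derivative b') (at s)"
    by (simp add: has_real_derivative_iff_has_vector_derivative inner_commute b'_def dot_square_norm)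
  have "((\<lambda>s. interp (f (p + of_real s * \<delta>))) has_real_derivative 2 * b' / (b + 1)\<^sup>2) (at s)"
    unfolding interp_def
    by (rule derivative_eq_intros vb refl)+
       (use b in \<open>auto simp: b_def z_def add_nonneg_eq_0_iff field_simps power2_eq_square\<close>)
  then have vi: "((\<lambda>s. of_real (interp (f (p + of_real s * \<delta>))) :: complex) has_vector_derivative
      of_real (2 * b' / (b + 1)\<^sup>2)) (at s)"
    by (rule has_vector_derivative_of_real)
  define w where "w = \<delta> * (- exp z * f z - exp z ^ 2 / (f z)\<^sup>2)
    + (of_real (interp (f z)) * (\<delta> * (exp z * f z - exp z ^ 2 / (f z)\<^sup>2)) + of_real (2 * b' / (b + 1)\<^sup>2) * u)"
  have "((\<lambda>s. lyap f (p + of_real s * \<delta>)) has_vector_derivative w) (at s)"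
    unfolding lyap_def w_def
    using has_vector_derivative_add[OF chain[OF energy_has_deriv[OF f]]
      has_vector_derivative_mult[OF vi chain[OF dlog_has_deriv_ode[OF f]]]]
    by (simp add: z_def u_def)
  moreover have "norm w \<le> norm \<delta> * (16 + 17 * K + 10 * K\<^sup>2) * (norm (lyap f z) + 1)"
  proof -
    \<comment> \<open>Here 1 - \<phi> = 2 / (|y|^2 + 1) compensates the growth of y near poles, and
      1 + \<phi> = 2 |y|^2 / (|y|^2 + 1) that of 1/y^2 near zeros.\<close>
    have w: "w = \<delta> * (- (of_real (1 - interp (f z)) * (exp z * f z)) - of_real (1 + interp (f z)) * (exp z ^ 2 / (f z)\<^sup>2))
      + of_real (2 * b' / (b + 1)\<^sup>2) * u"
      unfolding w_def by (simp add: algebra_simps add_divide_distrib)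
    have Ke: "(norm (exp z))\<^sup>2 \<le> K\<^sup>2" using K by (intro power_mono) auto
    have yb: "2 * norm (f z) \<le> b + 1"
      using zero_le_power2[of "norm (f z) - 1"] by (simp add: b_def power2_eq_square algebra_simps)
    have t1: "norm (of_real (1 - interp (f z)) * (exp z * f z)) \<le> K"
    proof -
      have "norm (of_real (1 - interp (f z)) * (exp z * f z)) = 2 * norm (f z) / (b + 1) * norm (exp z)"
        unfolding interp_diff_1 using b by (simp add: norm_mult norm_divide b_def del: of_real_add of_real_divide)
      also have "\<dots> \<le> 1 * K"
        using yb b K by (intro mult_mono) auto
      finally show ?thesis by simp
    qed
    have t2: "norm (of_real (1 + interp (f z)) * (exp z ^ 2 / (f z)\<^sup>2)) \<le> 2 * K\<^sup>2"
    proof -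
      have "norm (of_real (1 + interp (f z)) * (exp z ^ 2 / (f z)\<^sup>2)) = 2 * b / (b + 1) * ((norm (exp z))\<^sup>2 / b)"
        unfolding interp_add_1 using b
        by (simp only: norm_mult norm_divide norm_power norm_of_real b_def) simp
      also have "\<dots> = 2 / (b + 1) * (norm (exp z))\<^sup>2" using b by simp
      also have "\<dots> \<le> 2 * K\<^sup>2"
        using b Ke by (intro mult_mono) (auto simp: field_simps)
      finally show ?thesis .
    qed
    have "\<bar>b'\<bar> \<le> 2 * (norm (f z) * norm (\<delta> * (f z * u)))"
      using Cauchy_Schwarz_ineq2[of "f z" "\<delta> * (f z * u)"] by (simp add: b'_def)
    then have b': "\<bar>b'\<bar> \<le> 2 * (norm \<delta> * b * norm u)"
      by (simp add: norm_mult b_def power2_eq_square mult_ac)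
    have b1: "b / (b + 1)\<^sup>2 \<le> 1" "1 / (b + 1)\<^sup>2 \<le> 1" 
      using b by (auto simp: divide_le_eq power2_eq_square algebra_simps)
    have b2: "norm (f z) * b / (b + 1)\<^sup>2 \<le> 1"
    proof -
      have "norm (f z) * b \<le> (b + 1) * (b + 1)"
        using yb b norm_ge_zero[of "f z"] by (intro mult_mono) linarith+
      then show ?thesis using b by (simp add: divide_le_eq power2_eq_square)
    qed
    have "(norm u)\<^sup>2 * (b / (b + 1)\<^sup>2)
      \<le> (4 * norm (lyap f z) + 4 + 4 * K * norm (f z) + 2 * K\<^sup>2 / b) * (b / (b + 1)\<^sup>2)"
      using dlog_bound[of f z, OF f(2) K] b by (intro mult_right_mono) (auto simp: u_def b_def)
    also have "\<dots> = (4 * norm (lyap f z) + 4) * (b / (b + 1)\<^sup>2) + 4 * K * (norm (f z) * b / (b + 1)\<^sup>2)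
        + 2 * K\<^sup>2 * (1 / (b + 1)\<^sup>2)"
      using b by (simp add: field_simps)
    also have "\<dots> \<le> (4 * norm (lyap f z) + 4) * 1 + 4 * K * 1 + 2 * K\<^sup>2 * 1"
      using b1 b2 K by (intro add_mono mult_left_mono) auto
    finally have t3: "(norm u)\<^sup>2 * (b / (b + 1)\<^sup>2) \<le> 4 * norm (lyap f z) + 4 + 4 * K + 2 * K\<^sup>2" by simp
    have "norm (of_real (2 * b' / (b + 1)\<^sup>2) * u) = 2 * \<bar>b'\<bar> / (b + 1)\<^sup>2 * norm u"
      by (simp only: norm_mult norm_of_real abs_divide abs_mult) simp
    also have "\<dots> \<le> 2 * (2 * (norm \<delta> * b * norm u)) / (b + 1)\<^sup>2 * norm u"
      using b' by (intro mult_right_mono divide_right_mono mult_left_mono) auto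
    also have "\<dots> = 4 * norm \<delta> * ((norm u)\<^sup>2 * (b / (b + 1)\<^sup>2))"
      by (simp add: power2_eq_square)
    also have "\<dots> \<le> 4 * norm \<delta> * (4 * norm (lyap f z) + 4 + 4 * K + 2 * K\<^sup>2)"
      using t3 by (intro mult_left_mono) auto
    finally have t4: "norm (of_real (2 * b' / (b + 1)\<^sup>2) * u)
      \<le> 4 * norm \<delta> * (4 * norm (lyap f z) + 4 + 4 * K + 2 * K\<^sup>2)" .
    have "norm (- (of_real (1 - interp (f z)) * (exp z * f z)) - of_real (1 + interp (f z)) * (exp z ^ 2 / (f z)\<^sup>2))
      \<le> K + 2 * K\<^sup>2"
      by (intro order.trans[OF norm_triangle_ineq4] add_mono) (use t1 t2 in auto)
    \<comment> \<open>Adding K + 2 K^2 to 4 (4 + 4 K + 2 K^2) gives the constant 16 + 17 K + 10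
      K^2.\<close>
    then have "norm w \<le> norm \<delta> * (K + 2 * K\<^sup>2) + 4 * norm \<delta> * (4 * norm (lyap f z) + 4 + 4 * K + 2 * K\<^sup>2)"
      unfolding w using t4
      by (intro order.trans[OF norm_triangle_ineq] add_mono) (auto simp: norm_mult intro: mult_left_mono)
    also have "\<dots> = norm \<delta> * (16 * norm (lyap f z) + (16 + 17 * K + 10 * K\<^sup>2))"
      by (simp add: algebra_simps)
    also have "\<dots> \<le> norm \<delta> * ((16 + 17 * K + 10 * K\<^sup>2) * (norm (lyap f z) + 1))"
      using K by (intro mult_left_mono) (auto simp: algebra_simps)
    finally show ?thesis by (simp add: mult_ac)
  qed
  ultimately show thesis by (rule that)
qed

section \<open>The Painleve property\<close>

text \<open>The end point p + \<delta> is exempt from the hypotheses. Since one radius serves all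
  other points of the segment, the disc about a point close to the end contains it.\<close>

lemma segment_extension:
  fixes p \<delta> :: complex
  assumes reg: "\<And>s. 0 \<le> s \<Longrightarrow> s < 1 \<Longrightarrow> f analytic_on {p + of_real s * \<delta>}"
      "\<And>s. 0 \<le> s \<Longrightarrow> s < 1 \<Longrightarrow> f (p + of_real s * \<delta>) \<noteq> 0"
      "\<And>s. 0 \<le> s \<Longrightarrow> s < 1 \<Longrightarrow> \<forall>\<^sub>F z in nhds (p + of_real s * \<delta>). dP3_ode f z"
  obtains \<rho> where "\<rho> > 0"
    "\<And>s. 0 \<le> s \<Longrightarrow> s < 1 \<Longrightarrow> \<exists>g. g meromorphic_on ball (p + of_real s * \<delta>) \<rho> \<and>
       (\<forall>\<^sub>F z in nhds (p + of_real s * \<delta>). g z = f z)"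
proof -
  define \<gamma> where "\<gamma> s = p + of_real s * \<delta>" for s :: real
  define K where "K = exp (norm p + norm \<delta>)"
  have K1: "K \<ge> 1" by (simp add: K_def)
  have K: "norm (exp (\<gamma> s)) \<le> K" if "0 \<le> s" "s < 1" for s
  proof -
    have "Re (\<gamma> s) \<le> norm (\<gamma> s)" by (rule complex_Re_le_cmod)
    also have "\<dots> \<le> norm p + s * norm \<delta>"
      unfolding \<gamma>_def using that by (intro order.trans[OF norm_triangle_ineq]) (simp add: norm_mult)
    also have "\<dots> \<le> norm p + norm \<delta>" using that by (simp add: mult_left_le_one_le)
    finally show ?thesis by (simp add: K_def)
  qed
  have ode: "dP3_ode f (\<gamma> s)" if "0 \<le> s" "s < 1" for s
    using reg(3)[OF that] eventually_nhds_x_imp_x unfolding \<gamma>_def by blast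
  \<comment> \<open>\<open>affine_gronwall\<close> expects the derivative as a function of s,
    whereas the preceding lemma yields a value for each s separately.\<close>
  define w where "w s = (SOME w. ((\<lambda>s. lyap f (\<gamma> s)) has_vector_derivative w) (at s) \<and>
    norm w \<le> norm \<delta> * (16 + 17 * K + 10 * K\<^sup>2) * (norm (lyap f (\<gamma> s)) + 1))" for s
  have w: "((\<lambda>s. lyap f (\<gamma> s)) has_vector_derivative w s) (at s) \<and>
    norm (w s) \<le> norm \<delta> * (16 + 17 * K + 10 * K\<^sup>2) * (norm (lyap f (\<gamma> s)) + 1)"
    if s: "0 \<le> s" "s < 1" for s
    unfolding w_def
    by (rule someI_ex, rule lyap_has_vector_derivative[of f p s \<delta> K])
       (use reg[OF s] K[OF s] K1 ode[OF s] in \<open>auto simp: \<gamma>_def\<close>)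
  obtain B where B: "B \<ge> 1" "\<And>s. 0 \<le> s \<Longrightarrow> s < 1 \<Longrightarrow> norm (lyap f (\<gamma> s)) \<le> B"
    by (rule affine_gronwall[of "\<lambda>s. lyap f (\<gamma> s)" w "norm \<delta> * (16 + 17 * K + 10 * K\<^sup>2)"])
       (use w K1 in auto)
  \<comment> \<open>By \<open>dlog_bound\<close>, S bounds |u' y|^2 where |y| <= 1 and |u'|^2 / |y|
    where |y| >= 1.\<close>
  define S where "S = 4 * B + 4 + 4 * K + 2 * K\<^sup>2"
  have S1: "S \<ge> 1" "K \<le> S" using B K1 by (auto simp: S_def intro: add_increasing2)
  \<comment> \<open>With L = \<open>lyap\<close> one has E - u' = L - (1 + \<phi>) u' and E + u' = L
    + (1 - \<phi>) u'. Since |1 + \<phi>| <= 2 |y| for |y| <= 1 and |1 - \<phi>| <= 2 / |y| for |y|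
    >= 1, the correction to L is at most 2S in the respective chart.\<close>
  define M where "M = B + 2 * S"
  have M1: "M \<ge> 1" "S \<le> M" using S1 B by (auto simp: M_def)
  have sqrtS: "x \<le> S" if "x\<^sup>2 \<le> S" for x
  proof -
    have "x\<^sup>2 \<le> S\<^sup>2" using that S1 by (simp add: power2_eq_square) (smt (verit) mult_left_le_one_le mult_le_cancel_left1)
    then show ?thesis using S1 by (meson power2_le_imp_le order.trans zero_le_one)
  qed
  show thesis
  proof (rule that)
    show "1 / (7 * M) > 0" using M1 by simp
    fix s :: real assume s: "0 \<le> s" "s < 1"
    note r = reg[OF s, folded \<gamma>_def] and Ks = K[OF s] and Bs = B(2)[OF s]
    define Y where "Y = norm (f (\<gamma> s))"
    define u where "u = norm (dlog f (\<gamma> s))"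
    have Y: "Y > 0" using r by (simp add: Y_def)
    have u: "u\<^sup>2 \<le> 4 * B + 4 + 4 * K * Y + 2 * K\<^sup>2 / Y\<^sup>2"
      using dlog_bound[of f "\<gamma> s" K] r Ks K1 Bs by (simp add: u_def Y_def)
    show "\<exists>g. g meromorphic_on ball (p + of_real s * \<delta>) (1 / (7 * M)) \<and>
       (\<forall>\<^sub>F z in nhds (p + of_real s * \<delta>). g z = f z)"
      unfolding \<gamma>_def[symmetric]
    proof (cases "Y \<le> 1")
      case True
      have "(u * Y)\<^sup>2 \<le> (4 * B + 4 + 4 * K * Y + 2 * K\<^sup>2 / Y\<^sup>2) * Y\<^sup>2"
        unfolding power_mult_distrib using u by (intro mult_right_mono) auto
      also have "\<dots> = (4 * B + 4) * Y\<^sup>2 + 4 * K * (Y * Y\<^sup>2) + 2 * K\<^sup>2"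
        using Y by (simp add: field_simps)
      also have "\<dots> \<le> (4 * B + 4) * 1 + 4 * K * 1 + 2 * K\<^sup>2"
      proof -
        have "Y\<^sup>2 \<le> 1" using True Y by (intro power_le_one) auto
        moreover from this have "Y * Y\<^sup>2 \<le> 1" using True Y by (intro mult_le_one) auto
        ultimately show ?thesis
          using B(1) K1 by (intro add_mono mult_left_mono order.refl) auto
      qed
      finally have "(u * Y)\<^sup>2 \<le> S" by (simp add: S_def)
      then have uY: "u * Y \<le> S" by (rule sqrtS)
      have "dlog f (\<gamma> s) * f (\<gamma> s) = deriv f (\<gamma> s)" using r by (simp add: dlog_def)
      then have d: "norm (deriv f (\<gamma> s)) \<le> M"
        using uY M1 by (metis u_def Y_def norm_mult order.trans)
      have "energy f (\<gamma> s) - dlog f (\<gamma> s) = lyap f (\<gamma> s) - of_real (1 + interp (f (\<gamma> s))) * dlog f (\<gamma> s)"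
        by (simp add: lyap_def algebra_simps)
      also have "norm \<dots> \<le> norm (lyap f (\<gamma> s)) + \<bar>1 + interp (f (\<gamma> s))\<bar> * u"
        by (rule order.trans[OF norm_triangle_ineq4]) (simp only: norm_mult norm_of_real u_def)
      also have "\<bar>1 + interp (f (\<gamma> s))\<bar> \<le> 2 * Y"
      proof -
        have "2 * Y\<^sup>2 / (Y\<^sup>2 + 1) \<le> 2 * Y\<^sup>2"
          using Y by (simp add: pos_divide_le_eq add_nonneg_pos algebra_simps)
        also have "\<dots> \<le> 2 * Y" using Y True by (simp add: power2_eq_square)
        finally have "2 * Y\<^sup>2 / (Y\<^sup>2 + 1) \<le> 2 * Y" .
        moreover have "0 \<le> 2 * Y\<^sup>2 / (Y\<^sup>2 + 1)" by (intro divide_nonneg_nonneg) auto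
        ultimately show ?thesis unfolding interp_add_1 Y_def[symmetric] by (simp only: abs_of_nonneg)
      qed
      finally have "norm (energy f (\<gamma> s) - dlog f (\<gamma> s)) \<le> norm (lyap f (\<gamma> s)) + 2 * Y * u"
        by (simp add: u_def mult_right_mono)
      also have "\<dots> \<le> M" using Bs uY by (simp add: M_def mult_ac)
      finally have h: "norm (energy f (\<gamma> s) - dlog f (\<gamma> s)) \<le> M" .
      obtain g where "g holomorphic_on ball (\<gamma> s) (1 / (7 * M))" "\<forall>\<^sub>F z in nhds (\<gamma> s). g z = f z"
        by (rule chart_zero[OF r M1(1) _ _ d h]) (use Ks S1 M1 True in \<open>auto simp: Y_def\<close>)
      then show "\<exists>g. g meromorphic_on ball (\<gamma> s) (1 / (7 * M)) \<and> (\<forall>\<^sub>F z in nhds (\<gamma> s). g z = f z)"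
        by (metis analytic_on_imp_meromorphic_on analytic_on_open open_ball)
    next
      case False
      then have Y1: "Y \<ge> 1" by simp
      have "2 * K\<^sup>2 / Y\<^sup>2 \<le> 2 * K\<^sup>2" using Y1 by (simp add: divide_le_eq mult_le_cancel_left1)
      then have "u\<^sup>2 \<le> (4 * B + 4 + 2 * K\<^sup>2) * 1 + 4 * K * Y" using u by simp
      also have "\<dots> \<le> (4 * B + 4 + 2 * K\<^sup>2) * Y + 4 * K * Y"
        using Y1 B(1) K1 by (intro add_mono mult_left_mono) auto
      finally have uS: "u\<^sup>2 \<le> S * Y" by (simp add: S_def algebra_simps)
      also have "\<dots> \<le> M ^ 2 * Y"
        using M1 S1 Y by (intro mult_right_mono) (auto simp: power2_eq_square intro: order.trans[OF M1(2)])
      finally have d: "(norm (dlog f (\<gamma> s)))\<^sup>2 \<le> M ^ 2 * norm (f (\<gamma> s))" by (simp add: u_def Y_def)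
      have "(u / Y)\<^sup>2 \<le> S * Y / Y\<^sup>2" unfolding power_divide using uS by (intro divide_right_mono) auto
      also have "\<dots> \<le> S" using Y1 S1 by (simp add: power2_eq_square divide_le_eq mult_le_cancel_left1)
      finally have uY: "u / Y \<le> S" by (rule sqrtS)
      have "energy f (\<gamma> s) + dlog f (\<gamma> s) = lyap f (\<gamma> s) + of_real (1 - interp (f (\<gamma> s))) * dlog f (\<gamma> s)"
        by (simp add: lyap_def algebra_simps)
      also have "norm \<dots> \<le> norm (lyap f (\<gamma> s)) + \<bar>1 - interp (f (\<gamma> s))\<bar> * u"
        by (rule order.trans[OF norm_triangle_ineq]) (simp only: norm_mult norm_of_real u_def)
      also have "\<bar>1 - interp (f (\<gamma> s))\<bar> \<le> 2 / Y"
      proof -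
        have "2 / (Y\<^sup>2 + 1) \<le> 2 / Y" using Y1 by (intro frac_le) (auto simp: power2_eq_square intro: add_increasing2)
        moreover have "0 \<le> 2 / (Y\<^sup>2 + 1)" by (intro divide_nonneg_nonneg) auto
        ultimately show ?thesis unfolding interp_diff_1 Y_def[symmetric] by (simp only: abs_of_nonneg)
      qed
      finally have "norm (energy f (\<gamma> s) + dlog f (\<gamma> s)) \<le> norm (lyap f (\<gamma> s)) + 2 / Y * u"
        by (simp add: u_def mult_right_mono divide_right_mono)
      also have "\<dots> = norm (lyap f (\<gamma> s)) + 2 * (u / Y)" by simp
      also have "\<dots> \<le> M" using Bs uY unfolding M_def by linarith
      finally have h: "norm (energy f (\<gamma> s) + dlog f (\<gamma> s)) \<le> M" .
      obtain g where g: "g holomorphic_on ball (\<gamma> s) (1 / (7 * M))" "\<forall>\<^sub>F z in nhds (\<gamma> s). inverse ((g z)\<^sup>2) = f z"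
        by (rule chart_pole[OF r M1(1) _ _ d h]) (use Ks S1 M1 Y1 in \<open>auto simp: Y_def\<close>)
      have "g meromorphic_on ball (\<gamma> s) (1 / (7 * M))"
        using g by (metis analytic_on_imp_meromorphic_on analytic_on_open open_ball)
      then have "(\<lambda>z. inverse ((g z)\<^sup>2)) meromorphic_on ball (\<gamma> s) (1 / (7 * M))"
        by (intro meromorphic_intros)
      with g(2) show "\<exists>g. g meromorphic_on ball (\<gamma> s) (1 / (7 * M)) \<and> (\<forall>\<^sub>F z in nhds (\<gamma> s). g z = f z)"
        by blast
    qed
  qed
qed

section \<open>Identity theorem for meromorphic functions normalised to vanish at their
  poles\<close>

lemma nicely_meromorphic_eq_at:
  assumes "f nicely_meromorphic_on A" "g nicely_meromorphic_on B" "z \<in> A" "z \<in> B"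
    and "\<forall>\<^sub>F w in at z. f w = g w"
  shows "f z = g z"
proof -
  have "is_pole f z \<longleftrightarrow> is_pole g z"
    using assms(5) by (intro is_pole_cong) auto
  moreover have "(f \<longlongrightarrow> l) (at z) \<longleftrightarrow> (g \<longlongrightarrow> l) (at z)" for l
    using assms(5) by (rule tendsto_cong)
  ultimately show ?thesis
    using assms unfolding nicely_meromorphic_on_def
    by (metis LIM_unique at_neq_bot is_pole_def not_tendsto_and_filterlim_at_infinity)
qed

lemma nicely_meromorphic_unique:
  assumes f: "f nicely_meromorphic_on A" and g: "g nicely_meromorphic_on A"
    and A: "open A" "connected A" "z \<in> A"
    and eq: "\<forall>\<^sub>F w in at z. f w = g w"
    and w: "w \<in> A"
  shows "f w = g w"
proof -
  have "(\<lambda>z. f z - g z) meromorphic_on A"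
    using f g by (intro meromorphic_intros) (auto simp: nicely_meromorphic_on_def)
  then have "(\<forall>\<^sub>\<approx>z\<in>A. f z - g z = 0) \<or> (\<forall>\<^sub>\<approx>z\<in>A. f z - g z \<noteq> 0)"
    by (rule meromorphic_imp_constant_or_avoid) fact+
  moreover have "\<not> (\<forall>\<^sub>\<approx>z\<in>A. f z - g z \<noteq> 0)"
  proof
    assume "\<forall>\<^sub>\<approx>z\<in>A. f z - g z \<noteq> 0"
    then have "\<forall>\<^sub>F w in at z. f w - g w \<noteq> 0"
      using A by (simp add: eventually_cosparse_open_eq)
    with eq have "\<forall>\<^sub>F w in at z. False" by eventually_elim simp
    then show False by simp
  qed
  ultimately have "\<forall>\<^sub>\<approx>z\<in>A. f z - g z = 0" by blast
  then have "\<forall>\<^sub>F x in at w. f x = g x"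
    using A w by (simp add: eventually_cosparse_open_eq)
  then show ?thesis
    by (rule nicely_meromorphic_eq_at[OF f g w w])
qed

lemma nicely_meromorphic_local:
  assumes "\<And>z. z \<in> A \<Longrightarrow> \<exists>B g. open B \<and> z \<in> B \<and> g nicely_meromorphic_on B \<and> (\<forall>w\<in>B. f w = g w)"
  shows "f nicely_meromorphic_on A"
proof -
  have "f meromorphic_on {z} \<and> ((is_pole f z \<and> f z = 0) \<or> f \<midarrow>z\<rightarrow> f z)" if z: "z \<in> A" for z
  proof -
    obtain B g where B: "open B" "z \<in> B" "g nicely_meromorphic_on B" "\<forall>w\<in>B. f w = g w"
      using assms[OF z] by blast
    have "\<forall>\<^sub>F w in at z. w \<in> B"
      using B by (intro eventually_at_in_open') auto
    then have ev: "\<forall>\<^sub>F w in at z. f w = g w"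
      by eventually_elim (use B in auto)
    have "f meromorphic_on {z} \<longleftrightarrow> g meromorphic_on {z}"
      using ev by (intro meromorphic_on_cong) auto
    moreover have "g meromorphic_on {z}"
      using B(2,3) by (auto simp: nicely_meromorphic_on_def intro: meromorphic_on_subset)
    moreover have "is_pole f z \<longleftrightarrow> is_pole g z"
      using ev by (intro is_pole_cong) auto
    moreover have "f \<midarrow>z\<rightarrow> f z \<longleftrightarrow> g \<midarrow>z\<rightarrow> f z"
      using ev by (rule tendsto_cong)
    ultimately show ?thesis
      using B by (auto simp: nicely_meromorphic_on_def)
  qed
  then show ?thesis
    unfolding nicely_meromorphic_on_def using meromorphic_on_meromorphic_at by blast
qed

text \<open>A segment inside the ball that ends at T and meets no zero or pole turns the uniform
  radius of \<open>segment_extension\<close> into an extension around T.\<close>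

lemma boundary_extension:
  assumes f: "f nicely_meromorphic_on ball c R" and R: "R > 0" and T: "T \<in> sphere c R"
    and nz: "\<exists>z\<in>ball c R. f z \<noteq> 0"
    and ode: "\<And>z. z \<in> ball c R \<Longrightarrow> f z \<noteq> 0 \<Longrightarrow> dP3_ode f z"
  obtains \<rho> g where "\<rho> > 0" "g nicely_meromorphic_on ball T \<rho>" "\<And>z. z \<in> ball T \<rho> \<inter> ball c R \<Longrightarrow> g z = f z"
proof -
  define S where "S = {z \<in> ball c R. f z = 0}"
  have "\<forall>\<^sub>\<approx>z\<in>ball c R. f z \<noteq> 0"
    using nicely_meromorphic_imp_constant_or_avoid[OF f, of 0] nz by auto
  then have "{z. f z = 0} sparse_in ball c R" by (simp add: eventually_cosparse)
  then have S: "S sparse_in ball c R"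
    by (rule sparse_in_subset2) (auto simp: S_def)
  have "countable S"
    using sparse_imp_countable[OF open_ball S] by (simp add: S_def Int_def)
  define v where "v = c - T"
  have v: "norm v = R" "v \<noteq> 0" using T R by (auto simp: v_def dist_norm)
  \<comment> \<open>On the segment from c - i t v to T one has (z - T) / v = (1 - s) (1 - i t), so
    \<open>h\<close> recovers the parameter t; each zero or pole rules out a single t.\<close>
  define h where "h z = - Im ((z - T) / v) / Re ((z - T) / v)" for z
  txt \<open>The countably many zeros and poles cannot block all segments ending at \<open>T\<close>.\<close>
  have "uncountable {0..1/2::real}" by (simp add: uncountable_closed_interval)
  then have "\<not> {0..1/2} \<subseteq> h ` S"
    using \<open>countable S\<close> countable_subset by blast
  then obtain t where t: "0 \<le> t" "t \<le> 1/2" "t \<notin> h ` S"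
    unfolding subset_iff atLeastAtMost_iff by blast
  \<comment> \<open>Because t <= 1/2, the starting point has distance at most R/2 from c.\<close>
  define p where "p = c - \<i> * of_real t * v"
  define \<delta> where "\<delta> = T - p"
  have inb: "p + of_real s * \<delta> \<in> ball c R" if s: "0 \<le> s" "s < 1" for s
  proof -
    have "p + of_real s * \<delta> - c = of_real (1 - s) * (- \<i> * of_real t * v) - of_real s * v"
      by (simp add: p_def \<delta>_def v_def algebra_simps)
    also have "norm \<dots> \<le> norm (of_real (1 - s) * (- \<i> * of_real t * v)) + norm (of_real s * v)"
      by (rule norm_triangle_ineq4)
    also have "\<dots> = (1 - s) * (t * R) + s * R"
      using s t v by (simp add: norm_mult del: of_real_diff)
    also have "\<dots> \<le> (1 - s) * (1/2 * R) + s * R"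
      using s t R by (intro add_mono mult_left_mono mult_right_mono) auto
    also have "\<dots> < (1 - s) * R + s * R" using s R by simp
    also have "\<dots> = R" by (simp add: algebra_simps)
    finally show ?thesis by (simp add: dist_norm norm_minus_commute)
  qed
  have nzs: "f (p + of_real s * \<delta>) \<noteq> 0" if s: "0 \<le> s" "s < 1" for s
  proof
    assume "f (p + of_real s * \<delta>) = 0"
    then have "p + of_real s * \<delta> \<in> S" using inb[OF s] by (simp add: S_def)
    moreover have "h (p + of_real s * \<delta>) = t"
    proof -
      have "p + of_real s * \<delta> - T = of_real (1 - s) * (1 - \<i> * of_real t) * v"
        by (simp add: p_def \<delta>_def v_def algebra_simps)
      then have "(p + of_real s * \<delta> - T) / v = of_real (1 - s) * (1 - \<i> * of_real t)"
        using v by simp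
      then show ?thesis using s by (simp add: h_def)
    qed
    ultimately show False using t by force
  qed
  have an: "f analytic_on {z}" if "z \<in> ball c R" "f z \<noteq> 0" for z
    using nicely_meromorphic_nonzero_imp_analytic[OF f that] .
  have nzev: "\<forall>\<^sub>F w in nhds z. w \<in> ball c R \<and> f w \<noteq> 0" if z: "z \<in> ball c R" "f z \<noteq> 0" for z
    using eventually_analytic_nonzero[OF an[OF z] z(2)] eventually_nhds_in_open[OF open_ball z(1)]
    by eventually_elim simp
  obtain \<rho> where \<rho>: "\<rho> > 0"
    "\<And>s. 0 \<le> s \<Longrightarrow> s < 1 \<Longrightarrow> \<exists>g. g meromorphic_on ball (p + of_real s * \<delta>) \<rho> \<and>
       (\<forall>\<^sub>F z in nhds (p + of_real s * \<delta>). g z = f z)"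
  proof (rule segment_extension[of f p \<delta>])
    fix s :: real assume s: "0 \<le> s" "s < 1"
    show "f analytic_on {p + of_real s * \<delta>}" "f (p + of_real s * \<delta>) \<noteq> 0"
      using an inb nzs s by auto
    show "\<forall>\<^sub>F z in nhds (p + of_real s * \<delta>). dP3_ode f z"
      using nzev[OF inb[OF s] nzs[OF s]] by eventually_elim (use ode in auto)
  qed blast
  \<comment> \<open>Close enough to 1 that the point a has distance at most \<rho>/2 from T; then
    the disc of radius \<rho>/2 about T lies in the disc of radius \<rho> about a. Adding 1 to the
    norm of \<delta> keeps the denominator positive.\<close>
  define s where "s = max 0 (1 - \<rho> / (2 * (norm \<delta> + 1)))"
  have s: "0 \<le> s" "s < 1" using \<rho> by (auto simp: s_def add_nonneg_pos)
  define a where "a = p + of_real s * \<delta>"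
  have "T - a = of_real (1 - s) * \<delta>" by (simp add: a_def \<delta>_def algebra_simps)
  then have "dist T a = (1 - s) * norm \<delta>" using s by (simp add: dist_norm norm_mult del: of_real_diff)
  also have "\<dots> \<le> (\<rho> / (2 * (norm \<delta> + 1))) * norm \<delta>"
    by (intro mult_right_mono) (auto simp: s_def)
  also have "\<dots> = \<rho> / 2 * (norm \<delta> / (norm \<delta> + 1))" by simp
  also have "\<dots> \<le> \<rho> / 2 * 1"
  proof (rule mult_left_mono)
    have "norm \<delta> + 1 > 0" by (simp add: add_nonneg_pos)
    then show "norm \<delta> / (norm \<delta> + 1) \<le> 1" by (simp add: divide_le_eq)
  qed (use \<rho> in simp)
  finally have Ta: "dist T a \<le> \<rho> / 2" by simp
  obtain g where g: "g meromorphic_on ball a \<rho>" "\<forall>\<^sub>F z in nhds a. g z = f z"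
    using \<rho>(2)[OF s] by (auto simp: a_def)
  \<comment> \<open>\<open>remove_sings\<close> puts the value 0 at poles, which is the
    normalisation required.\<close>
  have gn: "remove_sings g nicely_meromorphic_on ball a \<rho>"
    using g(1) by (rule remove_sings_nicely_meromorphic)
  have aR: "a \<in> ball c R" and fa: "f analytic_on {a}" using inb[OF s] nzs[OF s] an by (auto simp: a_def)
  have "g analytic_on {a}"
    using fa analytic_at_cong[OF g(2) refl] by simp
  then have "\<forall>\<^sub>F z in nhds a. remove_sings g z = g z"
    by (rule eventually_remove_sings_eq_nhds)
  with g(2) have "\<forall>\<^sub>F z in nhds a. remove_sings g z = f z"
    by eventually_elim simp
  then have ev: "\<forall>\<^sub>F z in at a. remove_sings g z = f z"
    by (simp add: eventually_nhds_conv_at)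
  have sub: "ball T (\<rho> / 2) \<subseteq> ball a \<rho>"
  proof
    fix z assume "z \<in> ball T (\<rho> / 2)"
    then have "dist a T + dist T z < \<rho>" using Ta by (simp add: dist_commute)
    then show "z \<in> ball a \<rho>" using dist_triangle[of a z T] by simp
  qed
  show thesis
  proof (rule that[of "\<rho> / 2" "remove_sings g"])
    show "\<rho> / 2 > 0" using \<rho> by simp
    show "remove_sings g nicely_meromorphic_on ball T (\<rho> / 2)"
      using gn sub by (rule nicely_meromorphic_on_subset)
    fix z assume z: "z \<in> ball T (\<rho> / 2) \<inter> ball c R"
    show "remove_sings g z = f z"
    proof (rule nicely_meromorphic_unique[of "remove_sings g" "ball a \<rho> \<inter> ball c R" f a])
      show "remove_sings g nicely_meromorphic_on ball a \<rho> \<inter> ball c R"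
        using gn by (rule nicely_meromorphic_on_subset) auto
      show "f nicely_meromorphic_on ball a \<rho> \<inter> ball c R"
        using f by (rule nicely_meromorphic_on_subset) auto
      show "connected (ball a \<rho> \<inter> ball c R)"
        by (intro convex_connected convex_Int convex_ball)
    qed (use \<rho> aR ev z sub in auto)
  qed
qed

text \<open>Two discs about boundary points that meet also meet inside the ball, because the ball is
  strictly convex. There both extensions equal f, so they agree on their convex overlap. Compactness
  of the closed ball then provides a collar of width e.\<close>

lemma nicely_meromorphic_glue_ball:
  assumes f: "f nicely_meromorphic_on ball c R" and R: "R > 0"
    and ext: "\<And>T. T \<in> sphere c R \<Longrightarrow>
      \<exists>\<rho>>0. \<exists>g. g nicely_meromorphic_on ball T \<rho> \<and> (\<forall>z\<in>ball T \<rho> \<inter> ball c R. g z = f z)"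
  obtains e F where "e > 0" "F nicely_meromorphic_on ball c (R + e)" "\<And>z. z \<in> ball c R \<Longrightarrow> F z = f z"
proof -
  obtain \<rho> where "\<forall>T\<in>sphere c R. \<rho> T > 0 \<and>
      (\<exists>g. g nicely_meromorphic_on ball T (\<rho> T) \<and> (\<forall>z\<in>ball T (\<rho> T) \<inter> ball c R. g z = f z))"
    using ext by metis
  then obtain g where \<rho>: "\<And>T. T \<in> sphere c R \<Longrightarrow> \<rho> T > 0"
    and g: "\<And>T. T \<in> sphere c R \<Longrightarrow> g T nicely_meromorphic_on ball T (\<rho> T)"
    and gf: "\<And>T z. T \<in> sphere c R \<Longrightarrow> z \<in> ball T (\<rho> T) \<Longrightarrow> z \<in> ball c R \<Longrightarrow> g T z = f z"
    by (metis IntI)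
  have gg: "g T z = g T' z"
    if T: "T \<in> sphere c R" "T' \<in> sphere c R" "z \<in> ball T (\<rho> T)" "z \<in> ball T' (\<rho> T')" for T T' z
  proof (cases "T = T'")
    case False
    \<comment> \<open>Divides the segment between the two centres in the ratio of the radii, so that
      the point a below lies in both discs.\<close>
    define \<tau> where "\<tau> = \<rho> T / (\<rho> T + \<rho> T')"
    have r: "\<rho> T > 0" "\<rho> T' > 0" using \<rho> T by auto
    have \<tau>: "0 < \<tau>" "\<tau> < 1" using r by (auto simp: \<tau>_def)
    have d: "dist T T' < \<rho> T + \<rho> T'"
      using dist_triangle[of T T' z] T by (simp add: dist_commute)
    define a where "a = (1 - \<tau>) *\<^sub>R T + \<tau> *\<^sub>R T'"
    have "a - T = \<tau> *\<^sub>R (T' - T)" "a - T' = (1 - \<tau>) *\<^sub>R (T - T')"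
      by (simp_all add: a_def algebra_simps)
    then have "dist a T = \<tau> * dist T' T" "dist a T' = (1 - \<tau>) * dist T T'"
      using \<tau> by (simp_all add: dist_norm)
    then have "dist T a = \<tau> * dist T T'" "dist T' a = (1 - \<tau>) * dist T T'"
      by (simp_all add: dist_commute)
    moreover have "1 - \<tau> = \<rho> T' / (\<rho> T + \<rho> T')" using r by (simp add: \<tau>_def field_simps)
    moreover have "\<tau> * (\<rho> T + \<rho> T') = \<rho> T" using r by (simp add: \<tau>_def)
    ultimately have "dist T a < \<rho> T" "dist T' a < \<rho> T'"
      using mult_strict_left_mono[OF d \<tau>(1)] mult_strict_left_mono[OF d, of "1 - \<tau>"] \<tau> r by auto
    moreover have "a \<in> open_segment T T'"
      using False \<tau> by (auto simp: a_def in_segment)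
    then have "dist c a < R"
      using dist_decreases_open_segment[of a T T' c] T by (auto simp: sphere_def)
    ultimately have aA: "a \<in> (ball T (\<rho> T) \<inter> ball T' (\<rho> T')) \<inter> ball c R"
      by simp
    have "\<forall>\<^sub>F w in at a. w \<in> (ball T (\<rho> T) \<inter> ball T' (\<rho> T')) \<inter> ball c R"
      using aA by (intro eventually_at_in_open') auto
    then have ev: "\<forall>\<^sub>F w in at a. g T w = g T' w"
      by eventually_elim (use gf T in auto)
    show ?thesis
    proof (rule nicely_meromorphic_unique[of "g T" "ball T (\<rho> T) \<inter> ball T' (\<rho> T')" "g T'" a])
      show "g T nicely_meromorphic_on ball T (\<rho> T) \<inter> ball T' (\<rho> T')"
        using g[OF T(1)] by (rule nicely_meromorphic_on_subset) auto
      show "g T' nicely_meromorphic_on ball T (\<rho> T) \<inter> ball T' (\<rho> T')"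
        using g[OF T(2)] by (rule nicely_meromorphic_on_subset) auto
      show "connected (ball T (\<rho> T) \<inter> ball T' (\<rho> T'))"
        by (intro convex_connected convex_Int convex_ball)
    qed (use aA ev T in auto)
  qed simp
  define P where "P z T \<longleftrightarrow> T \<in> sphere c R \<and> z \<in> ball T (\<rho> T)" for z T
  define F where "F z = (if z \<in> ball c R then f z else g (SOME T. P z T) z)" for z
  have Fg: "F z = g T z" if T: "T \<in> sphere c R" "z \<in> ball T (\<rho> T)" for T z
  proof (cases "z \<in> ball c R")
    case True
    then show ?thesis using gf[OF T] by (simp add: F_def)
  next
    case False
    have "P z (SOME T. P z T)" by (rule someI[of "P z" T]) (use T in \<open>simp add: P_def\<close>)
    then have "g (SOME T. P z T) z = g T z"
      using T by (intro gg) (auto simp: P_def)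
    then show ?thesis using False by (simp add: F_def)
  qed
  define U where "U = ball c R \<union> (\<Union>T\<in>sphere c R. ball T (\<rho> T))"
  have FU: "F nicely_meromorphic_on U"
  proof (rule nicely_meromorphic_local)
    fix z assume "z \<in> U"
    then consider "z \<in> ball c R" | T where "T \<in> sphere c R" "z \<in> ball T (\<rho> T)"
      by (auto simp: U_def)
    then show "\<exists>B g. open B \<and> z \<in> B \<and> g nicely_meromorphic_on B \<and> (\<forall>w\<in>B. F w = g w)"
    proof cases
      case 1
      then show ?thesis using f by (intro exI[of _ "ball c R"] exI[of _ f]) (auto simp: F_def)
    next
      case 2
      then show ?thesis using g Fg by (intro exI[of _ "ball T (\<rho> T)"] exI[of _ "g T"]) auto
    qed
  qed
  have "open U" by (auto simp: U_def)
  have "cball c R \<subseteq> U"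
  proof
    fix z assume "z \<in> cball c R"
    then consider "z \<in> ball c R" | "z \<in> sphere c R" by fastforce
    then show "z \<in> U" using \<rho> by cases (force simp: U_def)+
  qed
  then obtain e where e: "e > 0" "(\<Union>x\<in>cball c R. ball x e) \<subseteq> U"
    using compact_subset_open_imp_ball_epsilon_subset[OF compact_cball \<open>open U\<close>] by metis
  have "ball c (R + e) \<subseteq> U"
  proof
    fix z assume z: "z \<in> ball c (R + e)"
    show "z \<in> U"
    proof (cases "z \<in> cball c R")
      case True
      then show ?thesis using \<open>cball c R \<subseteq> U\<close> by auto
    next
      case False
      \<comment> \<open>The radial projection x of z to the sphere is at distance |z - c| - R < e
        from z.\<close>
      define t where "t = R / dist c z"
      have D: "dist c z > R" "dist c z > 0" using False R by auto
      have t: "t * dist c z = R" "0 \<le> t" "t \<le> 1" using D R by (auto simp: t_def)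
      define x where "x = c + t *\<^sub>R (z - c)"
      have "dist c x = R" using t by (simp add: x_def dist_norm norm_minus_commute)
      moreover have "z - x = (1 - t) *\<^sub>R (z - c)" by (simp add: x_def algebra_simps)
      then have "dist z x = (1 - t) * dist z c" using t by (simp add: dist_norm)
      then have "dist x z = (1 - t) * dist c z" by (simp add: dist_commute)
      then have "dist x z < e" using t z by (simp add: algebra_simps)
      ultimately show ?thesis using e(2) by force
    qed
  qed
  then have "F nicely_meromorphic_on ball c (R + e)"
    using FU nicely_meromorphic_on_subset by blast
  with e(1) show thesis by (rule that) (simp add: F_def)
qed

text \<open>Extending through concentric balls instead of along paths avoids monodromy, since the
  intersection of two such balls is a ball. A finite supremum of the reachable radii is impossible,
  as gluing along the sphere would exceed it. The hypothesis \<open>step\<close> receives agreement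
  with f0, from which its user can recover the differential equation.\<close>

lemma nicely_meromorphic_continuation:
  assumes f0: "f0 nicely_meromorphic_on ball c r" "r > 0"
    and step: "\<And>f R T. R \<ge> r \<Longrightarrow> f nicely_meromorphic_on ball c R \<Longrightarrow> (\<forall>z\<in>ball c r. f z = f0 z) \<Longrightarrow>
      T \<in> sphere c R \<Longrightarrow>
      \<exists>\<rho>>0. \<exists>g. g nicely_meromorphic_on ball T \<rho> \<and> (\<forall>z\<in>ball T \<rho> \<inter> ball c R. g z = f z)"
  obtains F where "F nicely_meromorphic_on UNIV" "\<And>z. z \<in> ball c r \<Longrightarrow> F z = f0 z"
proof -
  define ext where "ext R f \<longleftrightarrow> R \<ge> r \<and> f nicely_meromorphic_on ball c R \<and> (\<forall>z\<in>ball c r. f z = f0 z)" for R f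
  define G where "G = {R. \<exists>f. ext R f}"
  define \<phi> where "\<phi> R = (SOME f. ext R f)" for R
  have \<phi>: "ext R (\<phi> R)" if "R \<in> G" for R
    using that unfolding G_def \<phi>_def mem_Collect_eq by (rule someI_ex)
  have rG: "r \<in> G" using f0 by (auto simp: G_def ext_def)
  have same: "\<phi> R z = \<phi> R' z" if R: "R \<in> G" "R' \<in> G" "z \<in> ball c R" "z \<in> ball c R'" for R R' z
  proof (rule nicely_meromorphic_unique[of "\<phi> R" "ball c R \<inter> ball c R'" "\<phi> R'" c])
    show "\<phi> R nicely_meromorphic_on ball c R \<inter> ball c R'"
      using \<phi>[OF R(1)] by (auto simp: ext_def intro: nicely_meromorphic_on_subset)
    show "\<phi> R' nicely_meromorphic_on ball c R \<inter> ball c R'"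
      using \<phi>[OF R(2)] by (auto simp: ext_def intro: nicely_meromorphic_on_subset)
    show "connected (ball c R \<inter> ball c R')"
      by (intro convex_connected convex_Int convex_ball)
    have "\<forall>\<^sub>F w in at c. w \<in> ball c r"
      using f0(2) by (intro eventually_at_in_open') auto
    then show "\<forall>\<^sub>F w in at c. \<phi> R w = \<phi> R' w"
      by eventually_elim (use \<phi> R in \<open>auto simp: ext_def\<close>)
    show "c \<in> ball c R \<inter> ball c R'"
      using \<phi>[OF R(1)] \<phi>[OF R(2)] f0(2) by (auto simp: ext_def)
  qed (use R in auto)
  define F where "F z = \<phi> (SOME R. R \<in> G \<and> z \<in> ball c R) z" for z
  have F: "F z = \<phi> R z" if "R \<in> G" "z \<in> ball c R" for R z
  proof -
    have "(SOME R. R \<in> G \<and> z \<in> ball c R) \<in> G \<and> z \<in> ball c (SOME R. R \<in> G \<and> z \<in> ball c R)"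
      by (rule someI[of "\<lambda>R. R \<in> G \<and> z \<in> ball c R" R]) (use that in auto)
    then show ?thesis unfolding F_def using same that by blast
  qed
  have F0: "F z = f0 z" if z: "z \<in> ball c r" for z
    using F[OF rG z] \<phi>[OF rG] z by (simp add: ext_def)
  have FU: "F nicely_meromorphic_on (\<Union>R\<in>G. ball c R)"
  proof (rule nicely_meromorphic_local)
    fix z assume "z \<in> (\<Union>R\<in>G. ball c R)"
    then obtain R where R: "R \<in> G" "z \<in> ball c R" by auto
    then show "\<exists>B g. open B \<and> z \<in> B \<and> g nicely_meromorphic_on B \<and> (\<forall>w\<in>B. F w = g w)"
      using F[OF R(1)] \<phi>[OF R(1)]
      by (intro exI[of _ "ball c R"] exI[of _ "\<phi> R"]) (auto simp: ext_def)
  qed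
  have "\<not> bdd_above G"
  proof
    assume bdd: "bdd_above G"
    define R where "R = Sup G"
    have "ball c R \<subseteq> (\<Union>R\<in>G. ball c R)"
    proof
      fix z assume "z \<in> ball c R"
      then have "dist c z < Sup G" by (simp add: R_def)
      then obtain R' where "R' \<in> G" "dist c z < R'"
        using less_cSup_iff[of G "dist c z"] rG bdd by auto
      then show "z \<in> (\<Union>R\<in>G. ball c R)" by auto
    qed
    then have FR: "F nicely_meromorphic_on ball c R"
      using FU nicely_meromorphic_on_subset by blast
    have Rr: "R \<ge> r" using rG bdd by (simp add: R_def cSup_upper)
    obtain e F' where e: "e > 0" "F' nicely_meromorphic_on ball c (R + e)" "\<And>z. z \<in> ball c R \<Longrightarrow> F' z = F z"
    proof (rule nicely_meromorphic_glue_ball[OF FR])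
      show "R > 0" using Rr f0(2) by simp
      show "\<exists>\<rho>>0. \<exists>g. g nicely_meromorphic_on ball T \<rho> \<and> (\<forall>z\<in>ball T \<rho> \<inter> ball c R. g z = F z)"
        if "T \<in> sphere c R" for T
        by (rule step[OF Rr FR _ that]) (use F0 in auto)
    qed blast
    have "R + e \<in> G"
      unfolding G_def ext_def using e Rr F0 by (auto intro!: exI[of _ F'])
    then have "R + e \<le> R" unfolding R_def using bdd by (rule cSup_upper)
    then show False using e(1) by simp
  qed
  then have "(\<Union>R\<in>G. ball c R) = UNIV"
    unfolding bdd_above_def by (auto simp: not_le)
  with FU F0 show thesis by (intro that[of F]) auto
qed

text \<open>The defect G of the equation is meromorphic and vanishes near c, hence off a sparse set.
  Where f is nonzero it is analytic, and G vanishes there too by continuity.\<close>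

lemma dP3_ode_propagate:
  assumes f: "f nicely_meromorphic_on A" and A: "open A" "connected A" "c \<in> A"
    and ev: "\<forall>\<^sub>F z in nhds c. dP3_ode f z"
    and z: "z \<in> A" "f z \<noteq> 0"
  shows "dP3_ode f z"
proof -
  define G where "G z = f z * deriv (deriv f) z - (deriv f z)\<^sup>2 - (exp z * f z ^ 3 - exp z ^ 2)" for z
  have "G meromorphic_on A"
    unfolding G_def[abs_def]
    using f by (intro meromorphic_intros analytic_on_imp_meromorphic_on[of exp])
      (auto simp: nicely_meromorphic_on_def intro: analytic_intros)
  then have "(\<forall>\<^sub>\<approx>z\<in>A. G z = 0) \<or> (\<forall>\<^sub>\<approx>z\<in>A. G z \<noteq> 0)"
    by (rule meromorphic_imp_constant_or_avoid) fact+
  moreover have "\<not> (\<forall>\<^sub>\<approx>z\<in>A. G z \<noteq> 0)"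
  proof
    assume "\<forall>\<^sub>\<approx>z\<in>A. G z \<noteq> 0"
    then have "\<forall>\<^sub>F w in at c. G w \<noteq> 0"
      using A by (simp add: eventually_cosparse_open_eq)
    moreover have "\<forall>\<^sub>F w in at c. G w = 0"
      using ev unfolding eventually_nhds_conv_at dP3_ode_def G_def by simp
    ultimately have "\<forall>\<^sub>F w in at c. False" by eventually_elim simp
    then show False by simp
  qed
  ultimately have "\<forall>\<^sub>F w in at z. G w = 0"
    using A z by (simp add: eventually_cosparse_open_eq)
  then have "(G \<longlongrightarrow> 0) (at z)" by (rule tendsto_eventually)
  moreover have "f analytic_on {z}"
    using f z by (rule nicely_meromorphic_nonzero_imp_analytic)
  then have "G analytic_on {z}"
    unfolding G_def[abs_def] by (intro analytic_intros)
  then have "(G \<longlongrightarrow> G z) (at z)"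
    by (intro isContD analytic_at_imp_isCont)
  ultimately have "G z = 0" using LIM_unique by blast
  then show ?thesis by (simp add: G_def dP3_ode_def)
qed

theorem dP3_painleve_property:
  assumes f: "f holomorphic_on ball c r" "r > 0" "\<And>z. z \<in> ball c r \<Longrightarrow> f z \<noteq> 0"
    and ode: "\<And>z. z \<in> ball c r \<Longrightarrow> dP3_ode f z"
  obtains F where "F nicely_meromorphic_on UNIV" "\<And>z. z \<in> ball c r \<Longrightarrow> F z = f z"
    "\<And>z. F z \<noteq> 0 \<Longrightarrow> dP3_ode F z"
proof -
  have fn: "f nicely_meromorphic_on ball c r"
    using f(1) by (intro analytic_on_imp_nicely_meromorphic_on) (simp add: analytic_on_open)
  \<comment> \<open>Needed for A a ball of radius R during the continuation and for the whole plane
    at the end.\<close>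
  have propagate: "dP3_ode g z"
    if g: "g nicely_meromorphic_on A" "open A" "connected A" "ball c r \<subseteq> A" "\<forall>z\<in>ball c r. g z = f z"
      "z \<in> A" "g z \<noteq> 0" for g z A
  proof (rule dP3_ode_propagate[OF g(1-3)])
    show "c \<in> A" using g(4) f(2) by auto
    have "\<forall>\<^sub>F z in nhds c. z \<in> ball c r" using f(2) by (intro eventually_nhds_in_open) auto
    then show "\<forall>\<^sub>F z in nhds c. dP3_ode g z"
    proof eventually_elim
      case (elim z)
      then have "\<forall>\<^sub>F w in nhds z. w \<in> ball c r" by (intro eventually_nhds_in_open) auto
      then have ev: "\<forall>\<^sub>F w in nhds z. g w = f w" by eventually_elim (use g(5) in auto)
      have "deriv g z = deriv f z" "deriv (deriv g) z = deriv (deriv f) z"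
        using higher_deriv_cong_ev[OF ev refl, of 1] higher_deriv_cong_ev[OF ev refl, of 2]
        by (simp_all add: eval_nat_numeral)
      then show ?case using ode[OF elim] g(5) elim by (simp add: dP3_ode_def)
    qed
  qed (use g in auto)
  obtain F where F: "F nicely_meromorphic_on UNIV" "\<And>z. z \<in> ball c r \<Longrightarrow> F z = f z"
  proof (rule nicely_meromorphic_continuation[OF fn f(2)])
    fix g R T
    assume R: "R \<ge> r" and g: "g nicely_meromorphic_on ball c R" "\<forall>z\<in>ball c r. g z = f z" "T \<in> sphere c R"
    have sub: "ball c r \<subseteq> ball c R" using R by auto
    show "\<exists>\<rho>>0. \<exists>h. h nicely_meromorphic_on ball T \<rho> \<and> (\<forall>z\<in>ball T \<rho> \<inter> ball c R. h z = g z)"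
    proof (rule boundary_extension[OF g(1) _ g(3)])
      show "R > 0" using R f(2) by simp
      show "\<exists>z\<in>ball c R. g z \<noteq> 0" using f g(2) R by (intro bexI[of _ c]) auto
      show "dP3_ode g z" if "z \<in> ball c R" "g z \<noteq> 0" for z
        using propagate[OF g(1) open_ball connected_ball sub g(2) that] .
    qed blast
  qed blast
  show thesis
    by (rule that[OF F]) (use propagate[OF F(1) open_UNIV connected_UNIV] F(2) in auto)
qed

section \<open>The holomorphic germ at the origin\<close>

text \<open>The system for W = w, P = w^-2 and G = x w'/w as formal power series. Treating w^-2 as
  an unknown of its own keeps the right-hand sides polynomial.\<close>

definition w_system :: "complex \<Rightarrow> nat \<Rightarrow> nat \<Rightarrow> complex fps \<Rightarrow> complex fps \<Rightarrow> complex fps \<Rightarrow> bool" where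
  "w_system A n m W P G \<longleftrightarrow> fps_X * fps_deriv W = W * G \<and> fps_X * fps_deriv P = - 2 * (P * G) \<and>
     fps_deriv G = fps_const A * (fps_X ^ n * W - fps_X ^ m * P) \<and> fps_nth G 0 = 0"

lemma fps_nth_X_deriv: "fps_nth (fps_X * fps_deriv F) k = of_nat k * fps_nth F k"
  for F :: "complex fps"
  by (cases k) auto

text \<open>The vanishing constant term of G removes the coefficient of F of order k from the
  convolution, which makes the equations for W and P recursive.\<close>

lemma fps_mult_nth_lt:
  fixes F G :: "complex fps"
  assumes "fps_nth G 0 = 0"
  shows "fps_nth (F * G) k = (\<Sum>i<k. fps_nth F i * fps_nth G (k - i))"
proof -
  have "{0..k} = insert k {..<k}" by auto
  then show ?thesis using assms by (simp add: fps_mult_nth)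
qed

lemma w_system_iff:
  "w_system A n m W P G \<longleftrightarrow> fps_nth G 0 = 0 \<and>
    (\<forall>k. of_nat k * fps_nth W k = (\<Sum>i<k. fps_nth W i * fps_nth G (k - i))) \<and>
    (\<forall>k. of_nat k * fps_nth P k = - 2 * (\<Sum>i<k. fps_nth P i * fps_nth G (k - i))) \<and>
    (\<forall>k. of_nat (Suc k) * fps_nth G (Suc k) =
       A * ((if k < n then 0 else fps_nth W (k - n)) - (if k < m then 0 else fps_nth P (k - m))))"
proof (cases "fps_nth G 0 = 0")
  case True
  have 2: "fps_nth (- 2 * (P * G)) k = - 2 * fps_nth (P * G) k" for k
    by (metis fps_mult_left_const_nth fps_const_neg numeral_fps_const)
  show ?thesis
    unfolding w_system_def fps_eq_iff fps_nth_X_deriv 2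
    by (simp add: fps_mult_nth_lt[OF True] True fps_X_power_mult_nth)
qed (simp add: w_system_def)

text \<open>The unknown coefficient of order k carries the factor k, so for k > 0 it is determined
  by earlier ones: there is no resonance, and only the constant terms of W and P are free.\<close>

lemma w_system_unique:
  assumes 1: "w_system A n m W P G" and 2: "w_system A n m W' P' G'"
    and eq: "fps_nth W 0 = fps_nth W' 0" "fps_nth P 0 = fps_nth P' 0"
  shows "W = W'"
proof -
  have "fps_nth W k = fps_nth W' k \<and> fps_nth P k = fps_nth P' k \<and> fps_nth G k = fps_nth G' k" for k
  proof (induction k rule: less_induct)
    case (less k)
    \<comment> \<open>G comes first: at i = 0 the sums for W and P contain its coefficient of the
      same order k, which itself needs only lower orders of W and P.\<close>
    have G: "fps_nth G k = fps_nth G' k"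
    proof (cases k)
      case 0
      then show ?thesis using 1 2 by (simp add: w_system_iff)
    next
      case (Suc l)
      have "of_nat (Suc l) * fps_nth G (Suc l) = of_nat (Suc l) * fps_nth G' (Suc l)"
        using 1 2 less[of "l - n"] less[of "l - m"] Suc by (simp only: w_system_iff)
      then show ?thesis using Suc by (simp del: of_nat_Suc)
    qed
    show ?case
    proof (cases "k = 0")
      case False
      have g: "fps_nth G (k - i) = fps_nth G' (k - i)" for i
        using less[of "k - i"] G by (cases "i = 0") (use False in auto)
      have "of_nat k * fps_nth W k = of_nat k * fps_nth W' k"
        using 1 2 less g by (simp only: w_system_iff) (auto intro!: sum.cong)
      moreover have "of_nat k * fps_nth P k = of_nat k * fps_nth P' k"
        using 1 2 less g by (simp only: w_system_iff) (auto intro!: sum.cong)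
      ultimately show ?thesis using G False by simp
    qed (use eq G in simp)
  qed
  then show ?thesis by (simp add: fps_eq_iff)
qed

section \<open>Recursive construction and convergence of the power series solution\<close>

context
  fixes A a0 :: complex and n m :: nat
begin

function wp_coeff :: "nat \<Rightarrow> complex \<times> complex" where
  \<comment> \<open>the guard \<open>k < j\<close> never applies; it is there for termination\<close>
  "wp_coeff k = (if k = 0 then (- a0, inverse (a0\<^sup>2)) else
    let g = (\<lambda>j. if j = 0 \<or> k < j then 0 else A * ((if j - 1 < n then 0 else fst (wp_coeff (j - 1 - n)))
                - (if j - 1 < m then 0 else snd (wp_coeff (j - 1 - m)))) / of_nat j)
    in ((\<Sum>i<k. fst (wp_coeff i) * g (k - i)) / of_nat k,
        - 2 * (\<Sum>i<k. snd (wp_coeff i) * g (k - i)) / of_nat k))"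
  by pat_completeness auto
termination by (relation "Wellfounded.measure id") auto

declare wp_coeff.simps [simp del]

text \<open>The coefficients of x w'/w. The local function g in \<open>wp_coeff\<close> agrees with
  it at all arguments used there.\<close>

definition g_coeff :: "nat \<Rightarrow> complex" where
  "g_coeff j = (if j = 0 then 0 else A * ((if j - 1 < n then 0 else fst (wp_coeff (j - 1 - n)))
                - (if j - 1 < m then 0 else snd (wp_coeff (j - 1 - m)))) / of_nat j)"

lemma wp_coeff_0: "wp_coeff 0 = (- a0, inverse (a0\<^sup>2))"
  by (subst wp_coeff.simps) simp

lemma wp_coeff_rec:
  assumes "k > 0"
  shows "wp_coeff k = ((\<Sum>i<k. fst (wp_coeff i) * g_coeff (k - i)) / of_nat k,
        - 2 * (\<Sum>i<k. snd (wp_coeff i) * g_coeff (k - i)) / of_nat k)"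
proof -
  have g: "(if k - i = 0 \<or> k < k - i then 0 else A * ((if k - i - 1 < n then 0 else fst (wp_coeff (k - i - 1 - n)))
      - (if k - i - 1 < m then 0 else snd (wp_coeff (k - i - 1 - m)))) / of_nat (k - i)) = g_coeff (k - i)" for i
  proof -
    have "\<not> k < k - i" by simp
    then show ?thesis by (simp only: g_coeff_def) simp
  qed
  show ?thesis
    by (subst wp_coeff.simps) (simp only: Let_def g, use assms in simp)
qed

text \<open>The sums have k terms, which the division by k cancels, so geometric bounds reproduce
  themselves. The factor 1/2 in the bound for \<open>g_coeff\<close> makes up for the factor 2 in
  the equation for w^-2, and it is secured by 2 |A| M <= K/2.\<close>

lemma wp_coeff_bound:
  assumes M: "norm a0 \<le> M" "norm (inverse (a0\<^sup>2)) \<le> M" and K: "K \<ge> 1" "4 * norm A * M \<le> K"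
  shows "norm (fst (wp_coeff k)) \<le> M * K ^ k \<and> norm (snd (wp_coeff k)) \<le> M * K ^ k
     \<and> norm (g_coeff k) \<le> 1 / 2 * K ^ k"
proof (induction k rule: less_induct)
  case (less k)
  have M0: "M \<ge> 0" using M(1) norm_ge_zero order.trans by blast
  have g: "norm (g_coeff k) \<le> 1 / 2 * K ^ k"
  proof (cases k)
    case 0
    then show ?thesis by (simp add: g_coeff_def)
  next
    case (Suc l)
    have mono: "M * K ^ (l - i) \<le> M * K ^ l" for i
      using K M0 by (intro mult_left_mono power_increasing) auto
    have IH: "norm (fst (wp_coeff i)) \<le> M * K ^ i" "norm (snd (wp_coeff i)) \<le> M * K ^ i" if "i < k" for i
      using less[OF that] by auto
    have b1: "norm (if l < n then 0 else fst (wp_coeff (l - n))) \<le> M * K ^ l"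
      using order.trans[OF IH(1) mono[of n]] Suc M0 K by simp
    have b2: "norm (if l < m then 0 else snd (wp_coeff (l - m))) \<le> M * K ^ l"
      using order.trans[OF IH(2) mono[of m]] Suc M0 K by simp
    have "norm (g_coeff k) = norm A * norm ((if l < n then 0 else fst (wp_coeff (l - n)))
        - (if l < m then 0 else snd (wp_coeff (l - m)))) / real (Suc l)"
      using Suc by (simp add: g_coeff_def norm_mult norm_divide del: of_nat_Suc)
    also have "\<dots> \<le> norm A * (M * K ^ l + M * K ^ l) / 1"
      using b1 b2 M0 K
      by (intro frac_le mult_left_mono order.trans[OF norm_triangle_ineq4] add_mono) auto
    also have "\<dots> = (4 * norm A * M) * K ^ l / 2" by simp
    also have "\<dots> \<le> K * K ^ l / 2"
      using K by (intro divide_right_mono mult_right_mono) auto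
    finally show ?thesis using Suc by simp
  qed
  show ?case
  proof (cases "k = 0")
    case True
    then show ?thesis using M g by (simp add: wp_coeff_0)
  next
    case False
    have sum: "norm (\<Sum>i<k. h i * g_coeff (k - i)) \<le> real k * (M * K ^ k / 2)"
      if h: "\<And>i. i < k \<Longrightarrow> norm (h i) \<le> M * K ^ i" for h
    proof -
      have "norm (\<Sum>i<k. h i * g_coeff (k - i)) \<le> (\<Sum>i<k. norm (h i * g_coeff (k - i)))"
        by (rule norm_sum)
      also have "\<dots> \<le> (\<Sum>i<k. (M * K ^ i) * (1 / 2 * K ^ (k - i)))"
      proof (rule sum_mono)
        fix i assume i: "i \<in> {..<k}"
        have "norm (g_coeff (k - i)) \<le> 1 / 2 * K ^ (k - i)"
          using less[of "k - i"] g by (cases "i = 0") (use i in auto)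
        then show "norm (h i * g_coeff (k - i)) \<le> (M * K ^ i) * (1 / 2 * K ^ (k - i))"
          unfolding norm_mult using h[of i] i M0 K by (intro mult_mono) auto
      qed
      also have "\<dots> = (\<Sum>i<k. M * K ^ k / 2)"
        by (intro sum.cong refl) (simp add: power_add[symmetric])
      finally show ?thesis by simp
    qed
    have s1: "norm (\<Sum>i<k. fst (wp_coeff i) * g_coeff (k - i)) \<le> real k * (M * K ^ k / 2)"
      and s2: "norm (\<Sum>i<k. snd (wp_coeff i) * g_coeff (k - i)) \<le> real k * (M * K ^ k / 2)"
      by (rule sum, use less in blast)+
    have "norm (fst (wp_coeff k)) = norm (\<Sum>i<k. fst (wp_coeff i) * g_coeff (k - i)) / real k"
      using False by (simp add: wp_coeff_rec norm_divide)
    also have "\<dots> \<le> real k * (M * K ^ k / 2) / real k"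
      using s1 by (rule divide_right_mono) simp
    also have "\<dots> \<le> M * K ^ k" using False M0 K by simp
    finally have 1: "norm (fst (wp_coeff k)) \<le> M * K ^ k" .
    have "norm (snd (wp_coeff k)) = 2 * norm (\<Sum>i<k. snd (wp_coeff i) * g_coeff (k - i)) / real k"
      using False by (simp add: wp_coeff_rec norm_divide norm_mult)
    also have "\<dots> \<le> 2 * (real k * (M * K ^ k / 2)) / real k"
      using s2 by (intro divide_right_mono mult_left_mono) auto
    also have "\<dots> = M * K ^ k" using False by simp
    finally show ?thesis using 1 g by simp
  qed
qed

lemma w_system_exists:
  obtains W P G where "w_system A n m W P G" "fps_nth W 0 = - a0" "fps_nth P 0 = inverse (a0\<^sup>2)"
    "fps_conv_radius W > 0" "fps_conv_radius P > 0" "fps_conv_radius G > 0"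
proof -
  define M where "M = max (norm a0) (norm (inverse (a0\<^sup>2)))"
  define K where "K = max 1 (4 * norm A * M)"
  note b = wp_coeff_bound[of M K]
  have bnd: "norm (fst (wp_coeff k)) \<le> M * K ^ k" "norm (snd (wp_coeff k)) \<le> M * K ^ k"
      "norm (g_coeff k) \<le> 1 / 2 * K ^ k" for k
    using b[of k] by (auto simp: M_def K_def)
  have K: "K > 0" by (simp add: K_def)
  have pos: "fps_conv_radius F > 0" if "\<And>k. norm (fps_nth F k) \<le> C * K ^ k" for F :: "complex fps" and C
  proof -
    have "(0::ereal) < ereal (1 / K)" using K by simp
    also have "\<dots> \<le> fps_conv_radius F" using that K by (rule fps_conv_radius_ge_geometric[of F C K])
    finally show ?thesis .
  qed
  define W where "W = Abs_fps (\<lambda>k. fst (wp_coeff k))"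
  define P where "P = Abs_fps (\<lambda>k. snd (wp_coeff k))"
  define G where "G = Abs_fps g_coeff"
  show thesis
  proof (rule that)
    have "of_nat k * fst (wp_coeff k) = (\<Sum>i<k. fst (wp_coeff i) * g_coeff (k - i))"
      "of_nat k * snd (wp_coeff k) = - 2 * (\<Sum>i<k. snd (wp_coeff i) * g_coeff (k - i))" for k
      by (cases "k = 0"; simp add: wp_coeff_rec)+
    moreover have "of_nat (Suc k) * g_coeff (Suc k) =
       A * ((if k < n then 0 else fst (wp_coeff (k - n))) - (if k < m then 0 else snd (wp_coeff (k - m))))" for k
      by (simp add: g_coeff_def del: of_nat_Suc)
    ultimately show "w_system A n m W P G"
      unfolding w_system_iff by (simp add: W_def P_def G_def g_coeff_def[of 0] del: of_nat_Suc)
    show "fps_conv_radius W > 0" "fps_conv_radius P > 0" "fps_conv_radius G > 0"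
      by (rule pos, unfold W_def P_def G_def fps_nth_Abs_fps, rule bnd)+
  qed (auto simp: W_def P_def wp_coeff_0)
qed

end

lemma w_solution_exists:
  assumes a0: "a0 \<noteq> 0"
  obtains w where "w_solution n m a0 w"
proof -
  define A where "A = (alpha n m)\<^sup>2"
  obtain W P G where sys: "w_system A n m W P G"
    and W0: "fps_nth W 0 = - a0" and P0: "fps_nth P 0 = inverse (a0\<^sup>2)"
    and rad: "fps_conv_radius W > 0" "fps_conv_radius P > 0" "fps_conv_radius G > 0"
    by (rule w_system_exists)
  \<comment> \<open>So far P is an independent unknown. The product P W^2 is conserved and equals 1
    at the origin, which identifies P with W^-2.\<close>
  have "fps_deriv (P * W\<^sup>2) = 0"
  proof -
    have "fps_X * fps_deriv (P * W\<^sup>2) = (fps_X * fps_deriv P) * W\<^sup>2 + 2 * P * W * (fps_X * fps_deriv W)"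
      by (simp add: power2_eq_square algebra_simps)
    also have "\<dots> = 0"
      using sys by (simp add: w_system_def power2_eq_square algebra_simps)
    finally show ?thesis by simp
  qed
  then have "P * W\<^sup>2 = fps_const (fps_nth (P * W\<^sup>2) 0)"
    by (simp only: fps_deriv_eq_0_iff)
  then have PW: "P * W\<^sup>2 = 1"
    using a0 W0 P0 by (simp add: fps_mult_nth_0 power2_eq_square field_simps)
  define w where "w = eval_fps W"
  define p where "p = eval_fps P"
  define g where "g = eval_fps G"
  have e: "w has_fps_expansion W" "p has_fps_expansion P" "g has_fps_expansion G"
    using rad by (auto simp: w_def p_def g_def intro: eval_fps_has_fps_expansion)
  have "\<forall>\<^sub>F z in nhds 0. p z * (w z)\<^sup>2 = 1"
  proof -
    have "(\<lambda>z. p z * (w z)\<^sup>2) has_fps_expansion 1"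
      using has_fps_expansion_mult[OF e(2) has_fps_expansion_power[OF e(1), of 2]] PW by simp
    then show ?thesis by (auto simp: has_fps_expansion_def elim: eventually_mono)
  qed
  moreover have "\<forall>\<^sub>F z in nhds 0. z * deriv w z = w z * g z"
  proof -
    have "(\<lambda>z. z * deriv w z) has_fps_expansion W * G"
      using has_fps_expansion_mult[OF has_fps_expansion_fps_X has_fps_expansion_deriv[OF e(1)]] sys
      by (simp add: w_system_def)
    moreover have "(\<lambda>z. w z * g z) has_fps_expansion W * G"
      using e by (intro fps_expansion_intros)
    ultimately show ?thesis
      unfolding has_fps_expansion_def by (auto elim: eventually_elim2)
  qed
  ultimately have g: "\<forall>\<^sub>F z in nhds 0. z * deriv w z / w z = g z \<and> p z = 1 / (w z)\<^sup>2"
    by eventually_elim (auto simp: field_simps)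
  have dg: "\<forall>\<^sub>F z in nhds 0. deriv g z = A * (z ^ n * w z - z ^ m * p z)"
  proof -
    have "deriv g has_fps_expansion fps_const A * (fps_X ^ n * W - fps_X ^ m * P)"
      using has_fps_expansion_deriv[OF e(3)] sys by (simp add: w_system_def)
    moreover have "(\<lambda>z. A * (z ^ n * w z - z ^ m * p z)) has_fps_expansion
        fps_const A * (fps_X ^ n * W - fps_X ^ m * P)"
      using e by (intro fps_expansion_intros)
    ultimately show ?thesis
      unfolding has_fps_expansion_def by (auto elim: eventually_elim2)
  qed
  have "\<forall>\<^sub>F x in nhds 0. deriv (\<lambda>z. z * deriv w z / w z) x = A * (x ^ n * w x - x ^ m / (w x)\<^sup>2)"
  proof -
    have "\<forall>\<^sub>F x in nhds 0. \<forall>\<^sub>F z in nhds x. z * deriv w z / w z = g z"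
      using g unfolding eventually_eventually by eventually_elim simp
    then show ?thesis
      using g dg
    proof eventually_elim
      case (elim x)
      then show ?case by (simp add: deriv_cong_ev[OF elim(1) refl])
    qed
  qed
  then have "w_solution n m a0 w"
    unfolding w_solution_def A_def
    using has_fps_expansion_imp_analytic_0[OF e(1)] W0 by (simp add: w_def eval_fps_at_0)
  then show thesis by (rule that)
qed

text \<open>Carries uniqueness from the formal system over to germs: P and G are the Taylor series
  of w^-2 and x w'/w.\<close>

lemma w_solution_system:
  assumes w: "w_solution n m a0 w" and a0: "a0 \<noteq> 0"
  obtains P G where "w_system ((alpha n m)\<^sup>2) n m (fps_expansion w 0) P G" "fps_nth P 0 = inverse (a0\<^sup>2)"
proof -
  have an: "w analytic_on {0}" and w0: "w 0 = - a0" using w by (auto simp: w_solution_def)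
  have nz: "w 0 \<noteq> 0" using w0 a0 by simp
  define g where "g z = z * deriv w z / w z" for z
  define p where "p z = inverse ((w z)\<^sup>2)" for z
  define W where "W = fps_expansion w 0"
  define P where "P = fps_expansion p 0"
  define G where "G = fps_expansion g 0"
  have e: "w has_fps_expansion W" "p has_fps_expansion P" "g has_fps_expansion G"
    unfolding W_def P_def G_def
    by (intro analytic_at_imp_has_fps_expansion_0; use an nz in \<open>auto simp: p_def[abs_def] g_def[abs_def] intro!: analytic_intros\<close>)+
  have wz: "\<forall>\<^sub>F z in nhds 0. w z \<noteq> 0"
    using analytic_at_neq_imp_eventually_neq[OF an nz] nz by (simp add: eventually_nhds_conv_at)
  have pw: "\<forall>\<^sub>F z in nhds 0. p z * (w z)\<^sup>2 = 1"
    using wz by eventually_elim (simp add: p_def)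
  have "P * W\<^sup>2 = 1"
    by (rule has_fps_expansion_unique[OF _ _ pw]) (use e in \<open>auto intro!: fps_expansion_intros\<close>)
  then have PW: "P * W * W = 1" by (simp add: power2_eq_square mult_ac)
  have XW: "fps_X * fps_deriv W = W * G"
  proof (rule has_fps_expansion_unique)
    show "(\<lambda>z. z * deriv w z) has_fps_expansion fps_X * fps_deriv W"
      "(\<lambda>z. w z * g z) has_fps_expansion W * G"
      using e by (auto intro!: fps_expansion_intros)
    show "\<forall>\<^sub>F z in nhds 0. z * deriv w z = w z * g z"
      using wz by eventually_elim (simp add: g_def)
  qed
  have "fps_deriv (P * W * W) = 0" by (simp add: PW)
  then have "fps_X * (fps_deriv P * W * W + 2 * P * W * fps_deriv W) = 0"
    by (simp add: algebra_simps)
  then have "(fps_X * fps_deriv P) * W * W + 2 * P * W * (fps_X * fps_deriv W) = 0"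
    by (simp add: algebra_simps)
  then have "(fps_X * fps_deriv P + 2 * (P * G)) * (W * W) = 0"
    unfolding XW by (simp add: algebra_simps)
  moreover have "W * W \<noteq> 0" using PW by auto
  ultimately have XP: "fps_X * fps_deriv P = - 2 * (P * G)"
    by (simp add: eq_neg_iff_add_eq_0)
  have dG: "fps_deriv G = fps_const ((alpha n m)\<^sup>2) * (fps_X ^ n * W - fps_X ^ m * P)"
  proof (rule has_fps_expansion_unique)
    show "deriv g has_fps_expansion fps_deriv G" using e(3) by (rule has_fps_expansion_deriv)
    show "(\<lambda>z. (alpha n m)\<^sup>2 * (z ^ n * w z - z ^ m * p z)) has_fps_expansion
        fps_const ((alpha n m)\<^sup>2) * (fps_X ^ n * W - fps_X ^ m * P)"
      using e by (intro fps_expansion_intros)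
    show "\<forall>\<^sub>F z in nhds 0. deriv g z = (alpha n m)\<^sup>2 * (z ^ n * w z - z ^ m * p z)"
      using w unfolding w_solution_def g_def[abs_def] p_def by (auto simp: divide_inverse)
  qed
  have "fps_nth G 0 = 0" using fps_nth_fps_expansion[OF e(3), of 0] by (simp add: g_def)
  moreover have "fps_nth P 0 = inverse (a0\<^sup>2)"
    using fps_nth_fps_expansion[OF e(2), of 0] by (simp add: p_def w0)
  ultimately show thesis
    using that[of P G] XW XP dG by (simp add: w_system_def W_def)
qed

lemma w_solution_unique:
  assumes "w_solution n m a0 w" "w_solution n m a0 w'" "a0 \<noteq> 0"
  shows "\<forall>\<^sub>F x in nhds 0. w x = w' x"
proof -
  have e: "w has_fps_expansion fps_expansion w 0" "w' has_fps_expansion fps_expansion w' 0"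
    using assms by (auto simp: w_solution_def intro: analytic_at_imp_has_fps_expansion_0)
  obtain P G where 1: "w_system ((alpha n m)\<^sup>2) n m (fps_expansion w 0) P G" "fps_nth P 0 = inverse (a0\<^sup>2)"
    by (rule w_solution_system[OF assms(1,3)])
  obtain P' G' where 2: "w_system ((alpha n m)\<^sup>2) n m (fps_expansion w' 0) P' G'" "fps_nth P' 0 = inverse (a0\<^sup>2)"
    by (rule w_solution_system[OF assms(2,3)])
  have "fps_expansion w 0 = fps_expansion w' 0"
    using w_system_unique[OF 1(1) 2(1)] 1(2) 2(2) fps_nth_fps_expansion[OF e(1), of 0]
      fps_nth_fps_expansion[OF e(2), of 0] assms
    by (simp add: w_solution_def)
  with e show ?thesis
    unfolding has_fps_expansion_def by (auto elim: eventually_elim2)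
qed

section \<open>Global solutions\<close>

lemma alpha_real: "alpha n m = of_real ((real m + 2 * real n + 3) / 4)"
  by (simp add: alpha_def)

lemma alpha_nz [simp]: "alpha n m \<noteq> 0"
  unfolding alpha_real of_real_eq_0_iff by (simp add: add_nonneg_eq_0_iff)

lemma Re_divide_alpha: "Re (T / alpha n m) = Re T / ((real m + 2 * real n + 3) / 4)"
  unfolding alpha_real by (rule Re_divide_of_real)

text \<open>The germ of y in the coordinate T, with x = exp (T / \<alpha>). It is meaningful only
  for Re T close to minus infinity, as only the germ of w at 0 is prescribed.\<close>

definition local_sol :: "nat \<Rightarrow> nat \<Rightarrow> (complex \<Rightarrow> complex) \<Rightarrow> complex \<Rightarrow> complex" where
  "local_sol n m w T = exp ((of_nat n + 1 - alpha n m) * (T / alpha n m)) * w (exp (T / alpha n m))"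

text \<open>Since \<open>alpha n m\<close> is a positive real, X = T / \<alpha> maps left half
  planes onto left half planes.\<close>

lemma arises_from_iff:
  "arises_from n m a0 Y \<longleftrightarrow>
     (\<exists>w. w_solution n m a0 w \<and> (\<exists>R. \<forall>T. Re T < R \<longrightarrow> Y T = local_sol n m w T))"
proof -
  define \<alpha> where "\<alpha> = (real m + 2 * real n + 3) / 4"
  have \<alpha>: "\<alpha> > 0" "alpha n m = of_real \<alpha>" by (auto simp: \<alpha>_def alpha_real)
  have "(\<exists>R::real. \<forall>X. Re X < R \<longrightarrow> Y (alpha n m * X) = exp ((of_nat n + 1 - alpha n m) * X) * w (exp X))
     \<longleftrightarrow> (\<exists>R. \<forall>T. Re T < R \<longrightarrow> Y T = local_sol n m w T)" for w
  proof
    assume "\<exists>R::real. \<forall>X. Re X < R \<longrightarrow> Y (alpha n m * X) = exp ((of_nat n + 1 - alpha n m) * X) * w (exp X)"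
    then obtain R where R: "\<And>X. Re X < R \<Longrightarrow> Y (alpha n m * X) = exp ((of_nat n + 1 - alpha n m) * X) * w (exp X)"
      by blast
    have "Y T = local_sol n m w T" if "Re T < R * \<alpha>" for T
      using R[of "T / alpha n m"] that \<alpha> by (simp add: local_sol_def Re_divide_of_real divide_less_eq)
    then show "\<exists>R. \<forall>T. Re T < R \<longrightarrow> Y T = local_sol n m w T" by blast
  next
    assume "\<exists>R. \<forall>T. Re T < R \<longrightarrow> Y T = local_sol n m w T"
    then obtain R where R: "\<And>T. Re T < R \<Longrightarrow> Y T = local_sol n m w T" by blast
    have "Y (alpha n m * X) = exp ((of_nat n + 1 - alpha n m) * X) * w (exp X)" if "Re X < R / \<alpha>" for X
      using R[of "alpha n m * X"] that \<alpha> by (simp add: local_sol_def less_divide_eq mult.commute)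
    then show "\<exists>R::real. \<forall>X. Re X < R \<longrightarrow> Y (alpha n m * X) = exp ((of_nat n + 1 - alpha n m) * X) * w (exp X)"
      by blast
  qed
  then show ?thesis by (simp add: arises_from_def)
qed

lemma t_to_0_iff: "eventually P t_to_0 \<longleftrightarrow> (\<exists>R::real. \<forall>T. Re T < R \<longrightarrow> P T)"
proof
  assume "eventually P t_to_0"
  then obtain Q where Q: "eventually Q at_bot" "\<And>x. Q (Re x) \<Longrightarrow> P x"
    unfolding t_to_0_def eventually_filtercomap by auto
  then obtain R where "\<And>r. r \<le> R \<Longrightarrow> Q r"
    unfolding eventually_at_bot_linorder by auto
  then have "\<forall>T. Re T < R \<longrightarrow> P T" using Q by simp
  then show "\<exists>R::real. \<forall>T. Re T < R \<longrightarrow> P T" ..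
next
  assume "\<exists>R::real. \<forall>T. Re T < R \<longrightarrow> P T"
  then obtain R where R: "\<And>T. Re T < R \<Longrightarrow> P T" by blast
  show "eventually P t_to_0"
    unfolding t_to_0_def eventually_filtercomap
    by (rule exI[of _ "\<lambda>r. r < R"]) (use R in \<open>simp add: eventually_gt_at_bot\<close>)
qed

lemma t_to_0_neq_bot: "t_to_0 \<noteq> bot"
proof
  assume "t_to_0 = bot"
  then have "eventually (\<lambda>_. False) t_to_0" by simp
  then obtain R :: real where "\<And>T. \<not> Re T < R" unfolding t_to_0_iff by blast
  from this[of "of_real (R - 1)"] show False by simp
qed

lemma exp_tendsto_t_to_0: "((\<lambda>T. exp (T / alpha n m)) \<longlongrightarrow> 0) t_to_0"
proof (rule tendsto_norm_zero_cancel)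
  define \<alpha> where "\<alpha> = (real m + 2 * real n + 3) / 4"
  have "\<alpha> > 0" by (simp add: \<alpha>_def)
  then have "((\<lambda>x. exp (x / \<alpha>)) \<longlongrightarrow> 0) at_bot"
    by real_asymp
  then have "((\<lambda>T. exp (Re T / \<alpha>)) \<longlongrightarrow> 0) t_to_0"
    unfolding t_to_0_def by (rule filterlim_compose) (rule filterlim_filtercomap)
  then show "((\<lambda>T. norm (exp (T / alpha n m))) \<longlongrightarrow> 0) t_to_0"
    by (simp add: Re_divide_alpha \<alpha>_def)
qed

lemma eventually_t_to_0_exp:
  assumes "eventually P (nhds 0)"
  shows "\<forall>\<^sub>F T in t_to_0. P (exp (T / alpha n m))"
  using exp_tendsto_t_to_0 assms by (rule eventually_compose_filterlim[rotated])

lemma dP3_odeI: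
  assumes "f analytic_on {z}" "f z \<noteq> 0"
    and "(dlog f has_field_derivative (exp z * f z - exp z ^ 2 / (f z)\<^sup>2)) (at z)"
  shows "dP3_ode f z"
proof -
  have "(f z * deriv (deriv f) z - (deriv f z)\<^sup>2) / (f z)\<^sup>2 = exp z * f z - exp z ^ 2 / (f z)\<^sup>2"
    using dlog_has_deriv[OF assms(1,2)] assms(3) by (rule DERIV_unique)
  then show ?thesis
    using assms(2) by (simp add: dP3_ode_def field_simps power2_eq_square power3_eq_cube)
qed

text \<open>Here u' = (n + 1 - \<alpha>)/\<alpha> + g(x)/\<alpha> with g = x w'/w, and d/dT =
  (x/\<alpha>) d/dx. The exponents fit: \<alpha> + (n + 1 - \<alpha>) = n + 1 gives e^T y = x^(n+1)
  w, and 4\<alpha> - 2(n + 1) = m + 1 gives e^(2T)/y^2 = x^(m+1)/w^2.\<close>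

lemma local_sol_regular:
  assumes w: "w_solution n m a0 w" and a0: "a0 \<noteq> 0"
  shows "\<forall>\<^sub>F T in t_to_0. local_sol n m w analytic_on {T} \<and> local_sol n m w T \<noteq> 0 \<and> dP3_ode (local_sol n m w) T"
proof -
  define \<alpha> where "\<alpha> = alpha n m"
  have \<alpha>: "\<alpha> \<noteq> 0" by (simp add: \<alpha>_def)
  have \<alpha>4: "4 * \<alpha> = of_nat m + 2 * of_nat n + 3" by (simp add: \<alpha>_def alpha_def)
  define g where "g z = z * deriv w z / w z" for z
  have an: "w analytic_on {0}" and w0: "w 0 \<noteq> 0"
    and ode: "\<forall>\<^sub>F x in nhds 0. deriv g x = \<alpha>\<^sup>2 * (x ^ n * w x - x ^ m / (w x)\<^sup>2)"
    using w a0 by (auto simp: w_solution_def g_def[abs_def] \<alpha>_def)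
  have "\<forall>\<^sub>F x in nhds 0. w analytic_on {x} \<and> w x \<noteq> 0"
    using an w0 by (rule eventually_analytic_nonzero)
  then have "\<forall>\<^sub>F x in nhds 0. \<forall>\<^sub>F z in nhds x. w analytic_on {z} \<and> w z \<noteq> 0"
    by (simp add: eventually_eventually)
  then have "\<forall>\<^sub>F x in nhds 0. (\<forall>\<^sub>F z in nhds x. w analytic_on {z} \<and> w z \<noteq> 0) \<and>
      deriv g x = \<alpha>\<^sup>2 * (x ^ n * w x - x ^ m / (w x)\<^sup>2)"
    using ode by eventually_elim simp
  from eventually_t_to_0_exp[OF this, of n m] show ?thesis
  proof eventually_elim
    case (elim T)
    define x where "x = exp (T / \<alpha>)"
    define f where "f = local_sol n m w"
    have f: "f S = exp ((of_nat n + 1 - \<alpha>) * (S / \<alpha>)) * w (exp (S / \<alpha>))" for S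
      by (simp add: f_def local_sol_def \<alpha>_def)
    have x: "\<forall>\<^sub>F z in nhds x. w analytic_on {z} \<and> w z \<noteq> 0"
      and gx: "deriv g x = \<alpha>\<^sup>2 * (x ^ n * w x - x ^ m / (w x)\<^sup>2)"
      using elim by (simp_all add: x_def \<alpha>_def)
    have wx: "w analytic_on {x}" "w x \<noteq> 0"
      using eventually_nhds_x_imp_x[OF x] by auto
    have fa: "f analytic_on {T}"
    proof -
      have "(\<lambda>S. w (exp (S / \<alpha>))) analytic_on {T}"
        by (rule analytic_on_compose_gen[of "\<lambda>S. exp (S / \<alpha>)" _ w "{x}", unfolded o_def])
           (use wx \<alpha> in \<open>auto intro!: analytic_intros simp: x_def\<close>)
      then show ?thesis unfolding f[abs_def] using \<alpha> by (intro analytic_intros) auto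
    qed
    have fT: "f T \<noteq> 0" using wx by (simp add: f x_def)
    have dl: "dlog f S = (of_nat n + 1 - \<alpha>) / \<alpha> + g (exp (S / \<alpha>)) / \<alpha>"
      if S: "w analytic_on {exp (S / \<alpha>)}" "w (exp (S / \<alpha>)) \<noteq> 0" for S
    proof -
      have "((\<lambda>S. w (exp (S / \<alpha>))) has_field_derivative deriv w (exp (S / \<alpha>)) * (exp (S / \<alpha>) * (1 / \<alpha>))) (at S)"
        by (rule DERIV_chain2[of w _ "\<lambda>S. exp (S / \<alpha>)", OF analytic_has_deriv[OF S(1)]]) (use \<alpha> in \<open>auto intro!: derivative_eq_intros\<close>)
      then have "(f has_field_derivative ((of_nat n + 1 - \<alpha>) / \<alpha>) * f S
          + exp ((of_nat n + 1 - \<alpha>) * (S / \<alpha>)) * (deriv w (exp (S / \<alpha>)) * (exp (S / \<alpha>) * (1 / \<alpha>)))) (at S)"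
        unfolding f[abs_def] by (auto intro!: derivative_eq_intros simp: \<alpha> mult_ac)
      then have "deriv f S = ((of_nat n + 1 - \<alpha>) / \<alpha>) * f S
          + exp ((of_nat n + 1 - \<alpha>) * (S / \<alpha>)) * (deriv w (exp (S / \<alpha>)) * (exp (S / \<alpha>) * (1 / \<alpha>)))"
        by (rule DERIV_imp_deriv)
      then show ?thesis
        using S(2) by (simp add: dlog_def f g_def add_divide_distrib mult.commute)
    qed
    have "isCont (\<lambda>S. exp (S / \<alpha>)) T" using \<alpha> by (intro continuous_intros) auto
    then have "filterlim (\<lambda>S. exp (S / \<alpha>)) (nhds x) (nhds T)"
      using tendsto_at_iff_tendsto_nhds[of "\<lambda>S. exp (S / \<alpha>)" T] by (simp add: isCont_def x_def)
    with x have "\<forall>\<^sub>F S in nhds T. w analytic_on {exp (S / \<alpha>)} \<and> w (exp (S / \<alpha>)) \<noteq> 0"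
      by (rule eventually_compose_filterlim)
    then have ev: "\<forall>\<^sub>F S in nhds T. dlog f S = (of_nat n + 1 - \<alpha>) / \<alpha> + g (exp (S / \<alpha>)) / \<alpha>"
      by eventually_elim (rule dl, auto)
    have "g analytic_on {x}" unfolding g_def[abs_def] using wx by (intro analytic_intros) auto
    then have "((\<lambda>S. g (exp (S / \<alpha>))) has_field_derivative deriv g x * (x * (1 / \<alpha>))) (at T)"
      unfolding x_def
      by (intro DERIV_chain2[of g _ "\<lambda>S. exp (S / \<alpha>)"] analytic_has_deriv) (use \<alpha> in \<open>auto intro!: derivative_eq_intros\<close>)
    then have "((\<lambda>S. (of_nat n + 1 - \<alpha>) / \<alpha> + g (exp (S / \<alpha>)) / \<alpha>) has_field_derivative
        deriv g x * (x * (1 / \<alpha>)) / \<alpha>) (at T)"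
      by (auto intro!: derivative_eq_intros simp: \<alpha>)
    then have D: "(dlog f has_field_derivative deriv g x * (x * (1 / \<alpha>)) / \<alpha>) (at T)"
      using DERIV_cong_ev[OF refl ev refl] by simp
    have e1: "exp T * f T = x ^ Suc n * w x"
    proof -
      have "exp T * exp ((of_nat n + 1 - \<alpha>) * (T / \<alpha>)) = exp (of_nat (Suc n) * (T / \<alpha>))"
        unfolding exp_add[symmetric] using \<alpha> by (intro arg_cong[of _ _ exp]) (simp add: field_simps)
      then show ?thesis by (simp only: f x_def exp_of_nat_mult mult.assoc[symmetric])
    qed
    have e2: "exp T ^ 2 / (f T)\<^sup>2 = x ^ Suc m / (w x)\<^sup>2"
    proof -
      have "exp T ^ 2 / (exp ((of_nat n + 1 - \<alpha>) * (T / \<alpha>)))\<^sup>2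
          = exp (2 * T - 2 * ((of_nat n + 1 - \<alpha>) * (T / \<alpha>)))"
        by (simp only: exp_diff exp_double)
      also have "2 * T - 2 * ((of_nat n + 1 - \<alpha>) * (T / \<alpha>)) = (4 * \<alpha> - 2 * (of_nat n + 1)) * (T / \<alpha>)"
        using \<alpha> by (simp add: field_simps)
      also have "\<dots> = of_nat (Suc m) * (T / \<alpha>)" unfolding \<alpha>4 by simp
      finally have e: "exp T ^ 2 / (exp ((of_nat n + 1 - \<alpha>) * (T / \<alpha>)))\<^sup>2 = x ^ Suc m"
        by (simp only: exp_of_nat_mult x_def)
      have "exp T ^ 2 / (f T)\<^sup>2 = exp T ^ 2 / (exp ((of_nat n + 1 - \<alpha>) * (T / \<alpha>)))\<^sup>2 / (w x)\<^sup>2"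
        by (simp add: f x_def power_mult_distrib)
      then show ?thesis by (simp only: e)
    qed
    have aB: "\<alpha>\<^sup>2 * B * (x * (1 / \<alpha>)) / \<alpha> = x * B" for B
      using \<alpha> by (simp add: power2_eq_square)
    have "deriv g x * (x * (1 / \<alpha>)) / \<alpha> = exp T * f T - exp T ^ 2 / (f T)\<^sup>2"
      unfolding e1 e2 gx aB by (simp add: right_diff_distrib)
    with D have "dP3_ode f T" by (intro dP3_odeI[OF fa fT]) simp
    with fa fT show ?case by (simp add: f_def)
  qed
qed

lemma halfplane_unique:
  assumes "Y nicely_meromorphic_on UNIV" "Y' nicely_meromorphic_on UNIV" "\<forall>\<^sub>F T in t_to_0. Y T = Y' T"
  shows "Y = Y'"
proof
  obtain R where R: "\<And>T. Re T < R \<Longrightarrow> Y T = Y' T" using assms(3) unfolding t_to_0_iff by blast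
  define c where "c = complex_of_real (R - 1)"
  have "\<forall>\<^sub>F T in at c. T \<in> {T. Re T < R}"
    by (intro eventually_at_in_open') (auto simp: c_def open_halfspace_Re_lt)
  then have "\<forall>\<^sub>F T in at c. Y T = Y' T" by eventually_elim (use R in auto)
  then show "Y T = Y' T" for T
    using nicely_meromorphic_unique[OF assms(1,2), of c T] connected_UNIV by simp
qed

lemma global_sol_exists:
  assumes w: "w_solution n m a0 w" and a0: "a0 \<noteq> 0"
  obtains Y where "Y nicely_meromorphic_on UNIV" "\<forall>\<^sub>F T in t_to_0. Y T = local_sol n m w T"
    "\<And>z. Y z \<noteq> 0 \<Longrightarrow> dP3_ode Y z"
proof -
  obtain R where R: "\<And>T. Re T < R \<Longrightarrow> local_sol n m w analytic_on {T}"
    "\<And>T. Re T < R \<Longrightarrow> local_sol n m w T \<noteq> 0" "\<And>T. Re T < R \<Longrightarrow> dP3_ode (local_sol n m w) T"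
    using local_sol_regular[OF w a0] unfolding t_to_0_iff by blast
  \<comment> \<open>The unit disc about R - 1 lies in the half plane Re T < R; the solution is
    continued from this disc and then compared with the germ on the whole half plane.\<close>
  define c where "c = complex_of_real (R - 1)"
  have ball: "Re T < R" if "T \<in> ball c 1" for T
    using that abs_Re_le_cmod[of "T - c"] by (auto simp: dist_norm c_def norm_minus_commute)
  have an: "local_sol n m w analytic_on {T. Re T < R}"
    using R(1) analytic_on_analytic_at by blast
  have "local_sol n m w holomorphic_on ball c 1"
    by (rule analytic_imp_holomorphic[OF analytic_on_subset[OF an]]) (use ball in blast)
  then obtain Y where Y: "Y nicely_meromorphic_on UNIV" "\<And>z. z \<in> ball c 1 \<Longrightarrow> Y z = local_sol n m w z"
    "\<And>z. Y z \<noteq> 0 \<Longrightarrow> dP3_ode Y z"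
    using dP3_painleve_property[of "local_sol n m w" c 1] R ball by (metis zero_less_one)
  have "Y T = local_sol n m w T" if T: "Re T < R" for T
  proof (rule nicely_meromorphic_unique[of Y "{T. Re T < R}" "local_sol n m w" c])
    show "Y nicely_meromorphic_on {T. Re T < R}"
      using Y(1) by (rule nicely_meromorphic_on_subset) auto
    show "local_sol n m w nicely_meromorphic_on {T. Re T < R}"
      using an by (rule analytic_on_imp_nicely_meromorphic_on)
    show "connected {T. Re T < R}" by (intro convex_connected convex_halfspace_Re_lt)
    have "\<forall>\<^sub>F T in at c. T \<in> ball c 1" by (intro eventually_at_in_open') auto
    then show "\<forall>\<^sub>F T in at c. Y T = local_sol n m w T" by eventually_elim (use Y(2) in auto)
  qed (use T in \<open>auto simp: open_halfspace_Re_lt c_def\<close>)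
  then have "\<forall>\<^sub>F T in t_to_0. Y T = local_sol n m w T" unfolding t_to_0_iff by blast
  with Y show thesis by (intro that) auto
qed

section \<open>Algebroid functions\<close>

text \<open>\<open>exp\<close> is injective on discs of radius \<open>pi\<close>, so near T it
  avoids the value exp T and maps punctured neighbourhoods into punctured neighbourhoods.\<close>

lemma eventually_cosparse_compose_exp:
  assumes "\<forall>\<^sub>\<approx>z. P z"
  shows "\<forall>\<^sub>\<approx>z. P (exp z :: complex)"
proof -
  have "\<forall>\<^sub>F z in at T. P (exp z)" for T :: complex
  proof -
    have "\<forall>\<^sub>F z in at T. z \<in> ball T pi - {T}"
      using eventually_at_in_open[of "ball T pi" T] by simp
    then have "\<forall>\<^sub>F z in at T. exp z \<noteq> exp T"
    proof eventually_elim
      case (elim z)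
      then show ?case using inj_on_exp_pi[of T] by (auto simp: inj_on_def)
    qed
    then have "filterlim exp (at (exp T)) (at T)"
      by (intro filterlim_atI tendsto_intros) auto
    moreover have "\<forall>\<^sub>F z in at (exp T). P z"
      using assms by (simp add: eventually_cosparse_open_eq)
    ultimately show ?thesis by (rule eventually_compose_filterlim[rotated])
  qed
  then show ?thesis by (simp add: eventually_cosparse_open_eq)
qed

lemma meromorphic_compose_exp:
  assumes "f meromorphic_on UNIV"
  shows "(\<lambda>z. f (exp z)) meromorphic_on UNIV"
  by (rule meromorphic_on_compose[OF assms]) (auto intro: analytic_intros)

text \<open>The pullback along t = exp T turns coefficients in t into functions of T. It is a
  homomorphism of fields, hence injective.\<close>

lift_definition comp_exp :: "mero \<Rightarrow> mero" is "\<lambda>f z. f (exp z)"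
  by (auto intro: meromorphic_compose_exp eventually_cosparse_compose_exp)

lemma comp_exp_hom:
  "comp_exp 0 = 0" "comp_exp 1 = 1" "comp_exp (a + b) = comp_exp a + comp_exp b"
  "comp_exp (a * b) = comp_exp a * comp_exp b"
  by (transfer; auto intro!: meromorphic_intros meromorphic_compose_exp)+

lemma comp_exp_eq_0_iff: "comp_exp a = 0 \<longleftrightarrow> a = 0"
proof
  assume "comp_exp a = 0"
  then have "comp_exp (a * inverse a) = 0" by (simp add: comp_exp_hom)
  then show "a = 0" using comp_exp_hom(2) by (cases "a = 0") auto
qed (simp add: comp_exp_hom)

section \<open>Polynomials over the field of meromorphic functions, evaluated at Y\<close>

lemma mero_rep: "rep_mero a meromorphic_on UNIV" "abs_mero (rep_mero a) = a"
  using Quotient_rep_reflp[OF Quotient_mero, of a] Quotient_abs_rep[OF Quotient_mero] by auto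

lemma abs_mero_eq_iff:
  assumes "f meromorphic_on UNIV" "g meromorphic_on UNIV"
  shows "abs_mero f = abs_mero g \<longleftrightarrow> (\<forall>\<^sub>\<approx>z. f z = g z)"
  using Quotient_rel[OF Quotient_mero, of f g] assms by auto

lemma abs_mero_hom:
  assumes "f meromorphic_on UNIV" "g meromorphic_on UNIV"
  shows "abs_mero f + abs_mero g = abs_mero (\<lambda>z. f z + g z)"
    "abs_mero f * abs_mero g = abs_mero (\<lambda>z. f z * g z)"
  using assms by (auto intro: plus_mero.abs_eq times_mero.abs_eq)

lemma abs_mero_power:
  assumes "f meromorphic_on UNIV"
  shows "abs_mero f ^ k = abs_mero (\<lambda>z. f z ^ k)"
  using assms by (induction k) (auto simp: one_mero_def abs_mero_hom meromorphic_on_power)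

lemma abs_mero_sum:
  assumes "\<And>i. i \<in> I \<Longrightarrow> f i meromorphic_on UNIV"
  shows "(\<Sum>i\<in>I. abs_mero (f i)) = abs_mero (\<lambda>z. \<Sum>i\<in>I. f i z)"
  using assms
proof (induction I rule: infinite_finite_induct)
  case (insert i I)
  then show ?case by (simp add: abs_mero_hom meromorphic_on_sum)
qed (auto simp: zero_mero_def)

lemma comp_exp_abs:
  assumes "f meromorphic_on UNIV"
  shows "comp_exp (abs_mero f) = abs_mero (\<lambda>z. f (exp z))"
  using assms by (intro comp_exp.abs_eq) auto

text \<open>Substitution of Y(T) into a polynomial with coefficients in t = exp T. Being a ring
  homomorphism into a field, it has a prime kernel.\<close>

definition ev_mero :: "(complex \<Rightarrow> complex) \<Rightarrow> mero poly \<Rightarrow> mero" where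
  "ev_mero Y P = poly (map_poly comp_exp P) (abs_mero Y)"

lemma ev_mero_add: "ev_mero Y (P + Q) = ev_mero Y P + ev_mero Y Q"
proof -
  have "map_poly comp_exp (P + Q) = map_poly comp_exp P + map_poly comp_exp Q"
    by (intro poly_eqI) (simp add: coeff_map_poly comp_exp_hom)
  then show ?thesis by (simp add: ev_mero_def)
qed

lemma ev_mero_mult: "ev_mero Y (P * Q) = ev_mero Y P * ev_mero Y Q"
proof (induction P rule: pCons_induct)
  case 0
  then show ?case by (simp add: ev_mero_def)
next
  case (pCons a P)
  then show ?case
    by (simp add: mult_pCons_left ev_mero_add)
       (simp add: ev_mero_def map_poly_pCons map_poly_smult comp_exp_hom algebra_simps)
qed

lemma ev_mero_sum: "finite I \<Longrightarrow> ev_mero Y (\<Sum>i\<in>I. f i) = (\<Sum>i\<in>I. ev_mero Y (f i))"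
  by (induction I rule: finite_induct) (simp_all add: ev_mero_add, simp add: ev_mero_def)

lemma ev_mero_monom: "ev_mero Y (monom c k) = comp_exp c * abs_mero Y ^ k"
  by (simp add: ev_mero_def map_poly_monom comp_exp_hom poly_monom)

lemma ev_mero_abs:
  assumes Y: "Y meromorphic_on UNIV"
  shows "ev_mero Y P = abs_mero (\<lambda>T. \<Sum>k\<le>degree P. rep_mero (coeff P k) (exp T) * Y T ^ k)"
proof -
  note m = meromorphic_compose_exp[OF mero_rep(1)]
  have "ev_mero Y P = ev_mero Y (\<Sum>k\<le>degree P. monom (coeff P k) k)"
    by (simp add: poly_as_sum_of_monoms)
  also have "\<dots> = (\<Sum>k\<le>degree P. comp_exp (abs_mero (rep_mero (coeff P k))) * abs_mero Y ^ k)"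
    by (simp add: ev_mero_sum ev_mero_monom mero_rep(2))
  also have "\<dots> = (\<Sum>k\<le>degree P. abs_mero (\<lambda>T. rep_mero (coeff P k) (exp T) * Y T ^ k))"
    unfolding comp_exp_abs[OF mero_rep(1)] abs_mero_power[OF Y]
    by (intro sum.cong refl abs_mero_hom m meromorphic_intros Y)
  also have "\<dots> = abs_mero (\<lambda>T. \<Sum>k\<le>degree P. rep_mero (coeff P k) (exp T) * Y T ^ k)"
    by (intro abs_mero_sum meromorphic_intros m Y)
  finally show ?thesis .
qed

text \<open>An annihilating polynomial of least degree is irreducible: one of two factors
  annihilates Y as well, so the other has degree 0 and is a unit.\<close>

lemma algebroidI:
  assumes Y: "Y nicely_meromorphic_on UNIV" and P: "P \<noteq> 0" "ev_mero Y P = 0"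
  shows "algebroid Y"
proof -
  have Ym: "Y meromorphic_on UNIV" using Y by (simp add: nicely_meromorphic_on_def)
  define Q where "Q = (ARG_MIN degree P. P \<noteq> 0 \<and> ev_mero Y P = 0)"
  have Q: "Q \<noteq> 0" "ev_mero Y Q = 0"
    and min: "\<And>P. P \<noteq> 0 \<Longrightarrow> ev_mero Y P = 0 \<Longrightarrow> degree Q \<le> degree P"
    using arg_min_nat_lemma[of "\<lambda>P. P \<noteq> 0 \<and> ev_mero Y P = 0" P degree] P unfolding Q_def by blast+
  have "irreducible Q"
  proof (rule irreducibleI)
    show "Q \<noteq> 0" by fact
    show "\<not> is_unit Q"
    proof
      assume "is_unit Q"
      then have "degree Q = 0" using Q(1) is_unit_iff_degree by blast
      then obtain c where c: "Q = [:c:]" using degree_eq_zeroE by blast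
      then have "comp_exp c = 0"
        using Q(2) by (simp add: ev_mero_def map_poly_pCons comp_exp_hom)
      then show False using c Q(1) by (simp add: comp_exp_eq_0_iff)
    qed
    fix A B assume AB: "Q = A * B"
    then have nz: "A \<noteq> 0" "B \<noteq> 0" using Q(1) by auto
    then have deg: "degree Q = degree A + degree B" using AB by (simp add: degree_mult_eq)
    have "ev_mero Y A = 0 \<or> ev_mero Y B = 0" using Q(2) AB by (simp add: ev_mero_mult)
    then have "degree B = 0 \<or> degree A = 0"
      using min[of A] min[of B] nz deg by auto
    then show "is_unit A \<or> is_unit B" using nz is_unit_iff_degree by blast
  qed
  moreover have "\<forall>\<^sub>\<approx>T. (\<Sum>k\<le>degree Q. rep_mero (coeff Q k) (exp T) * Y T ^ k) = 0"
  proof -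
    have "(\<lambda>T. \<Sum>k\<le>degree Q. rep_mero (coeff Q k) (exp T) * Y T ^ k) meromorphic_on UNIV"
      by (intro meromorphic_intros Ym meromorphic_compose_exp[OF mero_rep(1)])
    then show ?thesis
      using Q(2) unfolding ev_mero_abs[OF Ym] zero_mero_def
      by (subst (asm) abs_mero_eq_iff) auto
  qed
  ultimately show ?thesis using Y unfolding algebroid_def by blast
qed

text \<open>The bound reads |c| <= C |t|^(-K) near t = 0. It is what excludes an essential
  singularity at t = 0 once c descends to a function of t.\<close>

definition moderate :: "(complex \<Rightarrow> complex) \<Rightarrow> bool" where
  "moderate c \<longleftrightarrow> c meromorphic_on UNIV \<and>
    (\<exists>C K. \<forall>\<^sub>F T in t_to_0. c analytic_on {T} \<and> norm (c T) \<le> C * exp (- K * Re T))"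

text \<open>Enlarging K weakens the bound once Re T < 0, so both constants may be taken
  nonnegative.\<close>

lemma moderateE:
  assumes "moderate c"
  obtains C K where "c meromorphic_on UNIV" "C \<ge> 0" "K \<ge> 0"
    "\<forall>\<^sub>F T in t_to_0. c analytic_on {T} \<and> norm (c T) \<le> C * exp (- K * Re T)"
proof -
  obtain C K where c: "c meromorphic_on UNIV"
    "\<forall>\<^sub>F T in t_to_0. c analytic_on {T} \<and> norm (c T) \<le> C * exp (- K * Re T)"
    using assms by (auto simp: moderate_def)
  have "\<forall>\<^sub>F T in t_to_0. Re T < 0" unfolding t_to_0_iff by blast
  with c(2) have "\<forall>\<^sub>F T in t_to_0. c analytic_on {T} \<and> norm (c T) \<le> \<bar>C\<bar> * exp (- \<bar>K\<bar> * Re T)"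
  proof eventually_elim
    case (elim T)
    have "C * exp (- K * Re T) \<le> \<bar>C\<bar> * exp (- \<bar>K\<bar> * Re T)"
      using elim by (intro mult_mono) (auto simp: mult_right_mono_neg)
    then show ?case using elim by auto
  qed
  with c(1) show thesis by (intro that[of "\<bar>C\<bar>" "\<bar>K\<bar>"]) auto
qed

lemma moderate_const: "moderate (\<lambda>_. a)"
  unfolding moderate_def
  by (intro conjI exI[of _ "norm a"] exI[of _ 0]) auto

lemma moderate_add:
  assumes "moderate c" "moderate d"
  shows "moderate (\<lambda>T. c T + d T)"
proof -
  obtain C K where c: "c meromorphic_on UNIV" "C \<ge> 0" "K \<ge> 0"
    "\<forall>\<^sub>F T in t_to_0. c analytic_on {T} \<and> norm (c T) \<le> C * exp (- K * Re T)"
    using assms(1) by (rule moderateE)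
  obtain D L where d: "d meromorphic_on UNIV" "D \<ge> 0" "L \<ge> 0"
    "\<forall>\<^sub>F T in t_to_0. d analytic_on {T} \<and> norm (d T) \<le> D * exp (- L * Re T)"
    using assms(2) by (rule moderateE)
  have "\<forall>\<^sub>F T in t_to_0. Re T < 0" unfolding t_to_0_iff by blast
  with c(4) d(4) have "\<forall>\<^sub>F T in t_to_0. (\<lambda>T. c T + d T) analytic_on {T} \<and>
      norm (c T + d T) \<le> (C + D) * exp (- (K + L) * Re T)"
  proof eventually_elim
    case (elim T)
    have "K * Re T \<le> 0" "L * Re T \<le> 0"
      using elim c(3) d(3) by (auto simp: mult_nonneg_nonpos)
    then have "C * exp (- K * Re T) \<le> C * exp (- (K + L) * Re T)" "D * exp (- L * Re T) \<le> D * exp (- (K + L) * Re T)"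
      using c(2) d(2) by (intro mult_left_mono; simp add: algebra_simps)+
    then show ?case
      using elim norm_triangle_ineq[of "c T" "d T"] by (auto simp: algebra_simps intro!: analytic_intros)
  qed
  moreover have "(\<lambda>T. c T + d T) meromorphic_on UNIV"
    using c(1) d(1) by (intro meromorphic_intros)
  ultimately show ?thesis unfolding moderate_def by blast
qed

lemma moderate_mult:
  assumes "moderate c" "moderate d"
  shows "moderate (\<lambda>T. c T * d T)"
proof -
  obtain C K where c: "c meromorphic_on UNIV" "C \<ge> 0" "K \<ge> 0"
    "\<forall>\<^sub>F T in t_to_0. c analytic_on {T} \<and> norm (c T) \<le> C * exp (- K * Re T)"
    using assms(1) by (rule moderateE)
  obtain D L where d: "d meromorphic_on UNIV" "D \<ge> 0" "L \<ge> 0"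
    "\<forall>\<^sub>F T in t_to_0. d analytic_on {T} \<and> norm (d T) \<le> D * exp (- L * Re T)"
    using assms(2) by (rule moderateE)
  from c(4) d(4) have "\<forall>\<^sub>F T in t_to_0. (\<lambda>T. c T * d T) analytic_on {T} \<and>
      norm (c T * d T) \<le> (C * D) * exp (- (K + L) * Re T)"
  proof eventually_elim
    case (elim T)
    have "norm (c T) * norm (d T) \<le> (C * exp (- K * Re T)) * (D * exp (- L * Re T))"
      using elim c(2) by (intro mult_mono) auto
    also have "\<dots> = (C * D) * exp (- (K + L) * Re T)"
      by (simp add: algebra_simps exp_add[symmetric] exp_diff)
    finally show ?case using elim by (auto simp: norm_mult intro!: analytic_intros)
  qed
  moreover have "(\<lambda>T. c T * d T) meromorphic_on UNIV"
    using c(1) d(1) by (intro meromorphic_intros)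
  ultimately show ?thesis unfolding moderate_def by blast
qed

lemma moderate_shift:
  assumes "moderate c" "Re a = 0"
  shows "moderate (\<lambda>T. c (T + a))"
proof -
  obtain C K where c: "c meromorphic_on UNIV" 
    "\<forall>\<^sub>F T in t_to_0. c analytic_on {T} \<and> norm (c T) \<le> C * exp (- K * Re T)"
    using assms(1) by (rule moderateE)
  obtain R where R: "\<And>T. Re T < R \<Longrightarrow> c analytic_on {T} \<and> norm (c T) \<le> C * exp (- K * Re T)"
    using c(2) unfolding t_to_0_iff by blast
  have "(\<lambda>T. c (T + a)) analytic_on {T} \<and> norm (c (T + a)) \<le> C * exp (- K * Re T)" if "Re T < R" for T
  proof
    show "(\<lambda>T. c (T + a)) analytic_on {T}"
      by (rule analytic_on_compose_gen[of "\<lambda>T. T + a" _ c "{T + a}", unfolded o_def])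
         (use R[of "T + a"] that assms(2) in \<open>auto intro!: analytic_intros\<close>)
    show "norm (c (T + a)) \<le> C * exp (- K * Re T)"
      using R[of "T + a"] that assms(2) by simp
  qed
  then have "\<forall>\<^sub>F T in t_to_0. (\<lambda>T. c (T + a)) analytic_on {T} \<and> norm (c (T + a)) \<le> C * exp (- K * Re T)"
    unfolding t_to_0_iff by blast
  moreover have "(\<lambda>T. c (T + a)) meromorphic_on UNIV"
    by (rule meromorphic_on_compose[OF c(1)]) (auto intro: analytic_intros)
  ultimately show ?thesis unfolding moderate_def by blast
qed

text \<open>The period 2 \<pi> i makes c single-valued in t away from 0, whichever branch of ln t is
  used; the growth bound leaves at most a pole at t = 0.\<close>

lemma periodic_descends:
  assumes c: "moderate c" and per: "\<And>T. c (T + 2 * of_real pi * \<i>) = c T"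
  obtains h where "h meromorphic_on UNIV" "\<And>T. h (exp T) = c T"
proof -
  obtain C K where cm: "c meromorphic_on UNIV" "C \<ge> 0" "K \<ge> 0"
    and ev: "\<forall>\<^sub>F T in t_to_0. c analytic_on {T} \<and> norm (c T) \<le> C * exp (- K * Re T)"
    using c by (rule moderateE)
  have pern: "c (T + of_nat k * (2 * of_real pi * \<i>)) = c T" for T k
  proof (induction k)
    case (Suc k)
    then show ?case using per[of "T + of_nat k * (2 * of_real pi * \<i>)"] by (simp add: algebra_simps)
  qed simp
  have per_int: "c (T + of_int k * (2 * of_real pi * \<i>)) = c T" for T k
  proof (cases "k \<ge> 0")
    case True
    then show ?thesis using pern[of T "nat k"] by simp
  next
    case False
    then show ?thesis using pern[of "T + of_int k * (2 * of_real pi * \<i>)" "nat (- k)"] by simp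
  qed
  define h where "h t = c (Ln t)" for t
  have h: "h (exp T) = c T" for T
  proof -
    have "exp (Ln (exp T)) = exp T" by simp
    then obtain k :: int where "Ln (exp T) = T + of_int (2 * k) * of_real pi * \<i>"
      unfolding exp_eq by auto
    then show ?thesis using per_int[of T k] by (simp add: h_def mult_ac)
  qed
  \<comment> \<open>A branch of the logarithm that is analytic at t0 even when t0 lies on the cut of
    \<open>Ln\<close>.\<close>
  define l where "l t0 t = Ln (t / t0) + Ln t0" for t0 t :: complex
  have l: "l t0 analytic_on {t0}" "exp (l t0 t0) = t0" "\<forall>\<^sub>F t in nhds t0. h t = c (l t0 t)" if "t0 \<noteq> 0" for t0
  proof -
    show "l t0 analytic_on {t0}"
      unfolding l_def[abs_def] using that by (intro analytic_intros) auto
    show "exp (l t0 t0) = t0" using that by (simp add: l_def)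
    have "\<forall>\<^sub>F t in nhds t0. t \<in> - {0}" using that by (intro eventually_nhds_in_open) auto
    then show "\<forall>\<^sub>F t in nhds t0. h t = c (l t0 t)"
    proof eventually_elim
      case (elim t)
      then have "exp (l t0 t) = t" using that by (simp add: l_def exp_add)
      then show ?case using h[of "l t0 t"] by simp
    qed
  qed
  have mero1: "h meromorphic_on {t0}" if "t0 \<noteq> 0" for t0
  proof -
    have "(\<lambda>t. c (l t0 t)) meromorphic_on {t0}"
      by (rule meromorphic_on_compose[OF cm(1) l(1)[OF that]]) auto
    moreover have "\<forall>\<^sub>F t in at t0. h t = c (l t0 t)"
      using l(3)[OF that] by (simp add: eventually_nhds_conv_at)
    moreover from this have "h meromorphic_on {t0} \<longleftrightarrow> (\<lambda>t. c (l t0 t)) meromorphic_on {t0}"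
      by (intro meromorphic_on_cong) auto
    ultimately show ?thesis by simp
  qed
  obtain R where R: "\<And>T. Re T < R \<Longrightarrow> c analytic_on {T} \<and> norm (c T) \<le> C * exp (- K * Re T)"
    using ev unfolding t_to_0_iff by blast
  have an: "h analytic_on {t}" if t: "t \<noteq> 0" "norm t < exp R" for t
  proof -
    have "Re (l t t) < R"
      using t l(2)[OF t(1)] by (metis exp_less_cancel_iff norm_exp_eq_Re)
    then have "(\<lambda>s. c (l t s)) analytic_on {t}"
      by (intro analytic_on_compose_gen[of "l t" _ c "{l t t}", unfolded o_def] l(1) t) (use R in auto)
    then show ?thesis using analytic_at_cong[OF l(3)[OF t(1)] refl] by simp
  qed
  \<comment> \<open>With N >= K + 1 the function t^N h(t) is O(|t|), so its singularity at 0 is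
    removable.\<close>
  define N where "N = nat \<lceil>K\<rceil> + 1"
  have N: "K + 1 \<le> real N" unfolding N_def by linarith
  define F where "F t = t ^ N * h t" for t
  have mero0: "h meromorphic_on {0}"
  proof -
    have iso: "isolated_singularity_at F 0"
      unfolding isolated_singularity_at_def
    proof (intro exI conjI)
      have "F analytic_on {t}" if "t \<in> ball 0 (exp R) - {0}" for t
        unfolding F_def[abs_def] using an[of t] that by (intro analytic_intros) auto
      then show "F analytic_on ball 0 (exp R) - {0}"
        by (subst analytic_on_analytic_at) auto
    qed simp
    have "\<forall>\<^sub>F t in at 0. norm (F t) \<le> C * norm t"
    proof -
      have "\<forall>\<^sub>F t in at 0. t \<in> ball 0 (min 1 (exp R)) - {0::complex}"
        using eventually_at_in_open[of "ball 0 (min 1 (exp R))" "0::complex"] by simp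
      then show ?thesis
      proof eventually_elim
        case (elim t)
        define T where "T = Ln t"
        have t: "exp T = t" "norm t = exp (Re T)" using elim by (auto simp: T_def norm_exp_eq_Re[symmetric])
        have T: "Re T < R" "Re T < 0" using elim t(2) by auto
        have "norm (F t) = exp (real N * Re T) * norm (c T)"
          using h[of T] by (simp add: F_def norm_mult norm_power t exp_of_nat_mult)
        also have "\<dots> \<le> exp ((K + 1) * Re T) * (C * exp (- K * Re T))"
          using R[OF T(1)] N T by (intro mult_mono) (auto intro: mult_right_mono_neg)
        also have "\<dots> = C * exp (Re T)"
        proof -
          have "exp ((K + 1) * Re T) * exp (- K * Re T) = exp (Re T)"
            unfolding exp_add[symmetric] by (simp add: algebra_simps)
          then show ?thesis by (simp add: mult_ac)
        qed
        finally show ?case by (simp add: t)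
      qed
    qed
    moreover have "((\<lambda>t::complex. C * norm t) \<longlongrightarrow> 0) (at 0)"
      by (auto intro!: tendsto_eq_intros)
    ultimately have "(F \<longlongrightarrow> 0) (at 0)"
      by (rule Lim_null_comparison)
    then have "not_essential F 0" unfolding not_essential_def by blast
    with iso have "F meromorphic_on {0}" by (simp add: meromorphic_at_iff)
    then have "(\<lambda>t. F t / t ^ N) meromorphic_on {0}" by (intro meromorphic_intros)
    moreover have "\<forall>\<^sub>F t in at 0. h t = F t / t ^ N"
      using eventually_neq_at_within[of 0 0 UNIV] by eventually_elim (simp add: F_def)
    moreover from this have "h meromorphic_on {0} \<longleftrightarrow> (\<lambda>t. F t / t ^ N) meromorphic_on {0}"
      by (intro meromorphic_on_cong) auto
    ultimately show ?thesis by simp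
  qed
  have "h meromorphic_on UNIV"
    using mero1 mero0 by (subst meromorphic_on_meromorphic_at) metis
  then show thesis using h by (rule that)
qed

text \<open>The product of the p linear factors belonging to the branches Y(T + 2 \<pi> i k)
  annihilates Y. It may be reducible; \<open>algebroidI\<close> only asks for a nonzero polynomial,
  and this one is monic.\<close>

lemma periodic_algebroid:
  assumes Y: "Y nicely_meromorphic_on UNIV" "moderate Y"
    and p: "p > 0" "\<And>T. Y (T + of_nat p * (2 * of_real pi * \<i>)) = Y T"
  shows "algebroid Y"
proof -
  define \<omega> where "\<omega> = 2 * of_real pi * \<i>"
  define Q where "Q q T = (\<Prod>k<q. [:- Y (T + of_nat k * \<omega>), 1:])" for q :: nat and T
  have mod: "moderate (\<lambda>T. coeff (Q q T) j)" for q j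
  proof (induction q arbitrary: j)
    case 0
    show ?case by (simp add: Q_def moderate_const)
  next
    case (Suc q)
    have s: "moderate (\<lambda>T. - Y (T + of_nat q * \<omega>))"
      using moderate_mult[OF moderate_const[of "- 1"] moderate_shift[OF Y(2), of "of_nat q * \<omega>"]]
      by (simp add: \<omega>_def)
    have "coeff (Q (Suc q) T) j = - Y (T + of_nat q * \<omega>) * coeff (Q q T) j
        + (case j of 0 \<Rightarrow> 0 | Suc i \<Rightarrow> coeff (Q q T) i)" for T
      by (simp add: Q_def coeff_pCons mult.commute[of _ "[:_, 1:]"] split: nat.splits)
    moreover have "moderate (\<lambda>T. case j of 0 \<Rightarrow> 0 | Suc i \<Rightarrow> coeff (Q q T) i)"
      using Suc by (cases j) (auto simp: moderate_const)
    ultimately show ?case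
      using moderate_add[OF moderate_mult[OF s Suc[of j]]] by simp
  qed
  \<comment> \<open>A shift by \<omega> permutes the factors cyclically, as the shift by p \<omega>
    fixes Y.\<close>
  have per: "Q p (T + \<omega>) = Q p T" for T
  proof -
    obtain r where r: "p = Suc r" using p(1) gr0_implies_Suc by blast
    have "Q p (T + \<omega>) = (\<Prod>k<r. [:- Y (T + of_nat (Suc k) * \<omega>), 1:]) * [:- Y (T + of_nat p * \<omega>), 1:]"
      by (simp add: Q_def r algebra_simps)
    also have "\<dots> = [:- Y (T + of_nat 0 * \<omega>), 1:] * (\<Prod>k<r. [:- Y (T + of_nat (Suc k) * \<omega>), 1:])"
      using p(2)[of T] by (simp add: \<omega>_def mult.commute)
    also have "\<dots> = Q p T"
      unfolding Q_def r by (rule prod.lessThan_Suc_shift[symmetric])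
    finally show ?thesis .
  qed
  have "\<exists>h. h meromorphic_on UNIV \<and> (\<forall>T. h (exp T) = coeff (Q p T) j)" for j
    using periodic_descends[OF mod[of p j]] per by (metis \<omega>_def)
  then obtain h where h: "\<And>j. h j meromorphic_on UNIV" "\<And>j T. h j (exp T) = coeff (Q p T) j"
    by metis
  have Ym: "Y meromorphic_on UNIV" using Y by (simp add: nicely_meromorphic_on_def)
  define P where "P = (\<Sum>j\<le>p. monom (abs_mero (h j)) j)"
  have deg: "degree (Q q T) = q" "lead_coeff (Q q T) = 1" for q T
  proof -
    show "degree (Q q T) = q" unfolding Q_def by (subst degree_prod_eq_sum_degree) auto
    show "lead_coeff (Q q T) = 1" unfolding Q_def by (simp add: lead_coeff_prod)
  qed
  note hexp = meromorphic_compose_exp[OF h(1)]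
  have "ev_mero Y P = (\<Sum>j\<le>p. abs_mero (\<lambda>T. h j (exp T)) * abs_mero (\<lambda>T. Y T ^ j))"
    by (simp add: P_def ev_mero_sum ev_mero_monom comp_exp_abs h(1) abs_mero_power Ym)
  also have "\<dots> = (\<Sum>j\<le>p. abs_mero (\<lambda>T. h j (exp T) * Y T ^ j))"
    by (intro sum.cong refl abs_mero_hom hexp meromorphic_intros Ym)
  also have "\<dots> = abs_mero (\<lambda>T. \<Sum>j\<le>p. h j (exp T) * Y T ^ j)"
    by (intro abs_mero_sum meromorphic_intros hexp Ym)
  also have "(\<lambda>T. \<Sum>j\<le>p. h j (exp T) * Y T ^ j) = (\<lambda>T. 0)"
  proof
    fix T
    have "(\<Sum>j\<le>p. h j (exp T) * Y T ^ j) = poly (Q p T) (Y T)"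
      by (simp add: h(2) poly_altdef deg)
    also have "\<dots> = (\<Prod>k<p. poly [:- Y (T + of_nat k * \<omega>), 1:] (Y T))"
      by (simp add: Q_def poly_prod)
    also have "\<dots> = 0" by (rule prod_zero) (use p(1) in \<open>auto intro!: bexI[of _ 0]\<close>)
    finally show "(\<Sum>j\<le>p. h j (exp T) * Y T ^ j) = 0" .
  qed
  finally have ev: "ev_mero Y P = 0" by (simp add: zero_mero_def)
  have "P \<noteq> 0"
  proof
    assume "P = 0"
    then have "coeff P p = 0" by simp
    then have "comp_exp (abs_mero (h p)) = 0" by (simp add: P_def coeff_sum_monom comp_exp_hom)
    moreover have "comp_exp (abs_mero (h p)) = abs_mero (\<lambda>T. 1)"
      using deg[of p] by (simp add: comp_exp_abs[OF h(1)] h(2))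
    ultimately show False by (simp add: one_mero_def[symmetric])
  qed
  with Y(1) ev show ?thesis by (intro algebroidI)
qed

section \<open>The families of solutions\<close>

text \<open>Every branch l of the logarithm has l' = 1/t, so t y'/y is \<open>dlog Y\<close> at
  l(t). The outer derivative d/dt contributes one more factor 1/t, which turns t y - t^2/y^2 into y
  - t/y^2.\<close>

lemma dP3_solutionI:
  assumes Y: "Y nicely_meromorphic_on UNIV" and nz: "\<exists>T. Y T \<noteq> 0" and ode: "\<And>z. Y z \<noteq> 0 \<Longrightarrow> dP3_ode Y z"
  shows "dP3_solution Y"
  unfolding dP3_solution_def Let_def
proof (intro conjI allI impI ballI)
  show "\<exists>T. Y T \<noteq> 0" by fact
  fix U l t assume U: "open U" and l: "l holomorphic_on U" "\<forall>t\<in>U. exp (l t) = t" and t: "t \<in> U" and Yt: "Y (l t) \<noteq> 0"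
  have an: "Y analytic_on {l t}"
    using Y UNIV_I Yt by (rule nicely_meromorphic_nonzero_imp_analytic)
  have la: "l analytic_on {s}" if "s \<in> U" for s using l(1) U that analytic_at by blast
  have dl: "(l has_field_derivative 1 / s) (at s)" if s: "s \<in> U" for s
  proof -
    have "((\<lambda>s. exp (l s)) has_field_derivative exp (l s) * deriv l s) (at s)"
      by (intro DERIV_fun_exp analytic_has_deriv la s)
    moreover have "((\<lambda>s. exp (l s)) has_field_derivative 1) (at s)"
      by (rule has_field_derivative_transform_within_open[OF DERIV_ident U s]) (use l in auto)
    ultimately have "exp (l s) * deriv l s = 1" by (rule DERIV_unique)
    then have "s * deriv l s = 1" "s \<noteq> 0" using l(2) s by (auto dest: bspec)
    then have "deriv l s = 1 / s" by (simp add: field_simps)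
    then show ?thesis using analytic_has_deriv[OF la[OF s]] by simp
  qed
  have t0: "t \<noteq> 0" using l(2) t exp_not_eq_zero by metis
  have "isCont l t" using la[OF t] by (rule analytic_at_imp_isCont)
  then have lim: "filterlim l (nhds (l t)) (nhds t)"
    using tendsto_at_iff_tendsto_nhds[of l t] by (simp add: isCont_def)
  from eventually_compose_filterlim[OF eventually_analytic_nonzero[OF an Yt] lim] eventually_nhds_in_open[OF U t]
  have ev: "\<forall>\<^sub>F s in nhds t. s * deriv (\<lambda>t. Y (l t)) s / Y (l s) = dlog Y (l s)"
  proof eventually_elim
    case (elim s)
    have "((\<lambda>t. Y (l t)) has_field_derivative deriv Y (l s) * (1 / s)) (at s)"
      by (rule DERIV_chain2[of Y _ l, OF analytic_has_deriv dl]) (use elim in auto)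
    then have "deriv (\<lambda>t. Y (l t)) s = deriv Y (l s) * (1 / s)" by (rule DERIV_imp_deriv)
    moreover have "s \<noteq> 0" using l(2) elim(2) exp_not_eq_zero by metis
    ultimately show ?case by (simp add: dlog_def)
  qed
  have "((\<lambda>s. dlog Y (l s)) has_field_derivative
      (exp (l t) * Y (l t) - exp (l t) ^ 2 / (Y (l t))\<^sup>2) * (1 / t)) (at t)"
    by (rule DERIV_chain2[of "dlog Y" _ l, OF dlog_has_deriv_ode[OF an Yt ode[OF Yt]] dl[OF t]])
  then have "deriv (\<lambda>s. dlog Y (l s)) t = (t * Y (l t) - t ^ 2 / (Y (l t))\<^sup>2) * (1 / t)"
    using l(2) t by (simp add: DERIV_imp_deriv)
  also have "\<dots> = Y (l t) - t / (Y (l t))\<^sup>2"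
    using t0 by (simp add: field_simps power2_eq_square)
  finally show "deriv (\<lambda>s. s * deriv (\<lambda>t. Y (l t)) s / Y (l s)) t = Y (l t) - t / (Y (l t))\<^sup>2"
    using deriv_cong_ev[OF ev refl] by simp
qed

text \<open>The period is 4\<alpha> times 2 \<pi> i, which shifts X = T/\<alpha> by 4 times 2 \<pi>
  i. Although \<alpha> need not be an integer, 4(n + 1 - \<alpha>) is one, so the prefactor is
  unchanged too.\<close>

lemma local_sol_periodic:
  "local_sol n m w (T + of_nat (m + 2 * n + 3) * (2 * of_real pi * \<i>)) = local_sol n m w T"
proof -
  define \<alpha> where "\<alpha> = alpha n m"
  have \<alpha>: "\<alpha> \<noteq> 0" "of_nat (m + 2 * n + 3) = 4 * \<alpha>"
    by (simp_all add: \<alpha>_def, simp add: alpha_def)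
  define P where "P = 2 * of_real pi * \<i>"
  have d: "(T + of_nat (m + 2 * n + 3) * P) / \<alpha> = T / \<alpha> + 4 * P"
    unfolding \<alpha>(2) using \<alpha>(1) by (simp add: add_divide_distrib)
  have e: "exp (x + of_int k * P) = exp x" for x and k :: int
  proof -
    have "of_int k * P = of_int (2 * k) * (of_real pi * \<i>)" by (simp add: P_def)
    then show ?thesis
      using exp_eq[of "x + of_int k * P" x] by (auto simp: mult.assoc)
  qed
  have "(of_nat n + 1 - \<alpha>) * (T / \<alpha> + 4 * P) = (of_nat n + 1 - \<alpha>) * (T / \<alpha>)
      + of_int (4 * (int n + 1) - int (m + 2 * n + 3)) * P"
  proof -
    have h: "(of_int (4 * (int n + 1) - int (m + 2 * n + 3)) :: complex) = 4 * (of_nat n + 1) - 4 * \<alpha>"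
      unfolding of_int_diff of_int_of_nat_eq \<alpha>(2) by simp
    show ?thesis unfolding h by (simp add: algebra_simps)
  qed
  moreover have "exp (T / \<alpha> + 4 * P) = exp (T / \<alpha>)" using e[of "T / \<alpha>" 4] by simp
  ultimately show ?thesis
    unfolding local_sol_def \<alpha>_def[symmetric] P_def[symmetric] d by (simp only: e)
qed

text \<open>The prefactor has modulus |t|^k and w is bounded near 0.\<close>

lemma local_sol_moderate:
  assumes Y: "Y meromorphic_on UNIV" and ev: "\<forall>\<^sub>F T in t_to_0. Y T = local_sol n m w T"
    and w: "w_solution n m a0 w" and a0: "a0 \<noteq> 0"
  shows "moderate Y"
proof -
  define k where "k = (real n + 1 - (real m + 2 * real n + 3) / 4) / ((real m + 2 * real n + 3) / 4)"
  have k: "(of_nat n + 1 - alpha n m) * (T / alpha n m) = of_real k * T" for T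
  proof -
    have "(of_nat n + 1 - alpha n m) / alpha n m = of_real k"
      by (simp add: k_def alpha_real)
    then show ?thesis by (metis times_divide_eq_left times_divide_eq_right)
  qed
  have "isCont w 0" using w by (intro analytic_at_imp_isCont) (simp add: w_solution_def)
  then have "filterlim w (nhds (w 0)) (nhds 0)"
    using tendsto_at_iff_tendsto_nhds[of w 0] by (simp add: isCont_def)
  then have "\<forall>\<^sub>F x in nhds 0. norm (w x) < norm (w 0) + 1"
    by (intro order_tendstoD(2)[OF tendsto_norm]) auto
  from eventually_t_to_0_exp[OF this, of n m]
  have wb: "\<forall>\<^sub>F T in t_to_0. norm (w (exp (T / alpha n m))) < norm (w 0) + 1" .
  have "\<forall>\<^sub>F T in t_to_0. \<forall>\<^sub>F S in nhds T. Y S = local_sol n m w S"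
  proof -
    obtain R where R: "\<And>T. Re T < R \<Longrightarrow> Y T = local_sol n m w T" using ev unfolding t_to_0_iff by blast
    have "\<forall>\<^sub>F S in nhds T. Y S = local_sol n m w S" if "Re T < R" for T
    proof -
      have "\<forall>\<^sub>F S in nhds T. S \<in> {S. Re S < R}"
        using that by (intro eventually_nhds_in_open) (auto simp: open_halfspace_Re_lt)
      then show ?thesis by eventually_elim (use R in auto)
    qed
    then show ?thesis unfolding t_to_0_iff by blast
  qed
  with local_sol_regular[OF w a0] wb
  have "\<forall>\<^sub>F T in t_to_0. Y analytic_on {T} \<and> norm (Y T) \<le> (norm (w 0) + 1) * exp (- (- k) * Re T)"
  proof eventually_elim
    case (elim T)
    have "Y analytic_on {T}" using elim analytic_at_cong[OF elim(3) refl] by simp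
    moreover have "Y T = local_sol n m w T" using eventually_nhds_x_imp_x[OF elim(3)] .
    then have "norm (Y T) = exp (k * Re T) * norm (w (exp (T / alpha n m)))"
      by (simp only: local_sol_def k norm_mult norm_exp_eq_Re) simp
    ultimately show ?case using elim(2) by (simp add: mult.commute)
  qed
  with Y show ?thesis unfolding moderate_def by blast
qed

section \<open>Uniqueness and existence for given n, m and a0\<close>

lemma solution_unique:
  assumes "algebroid_solution Y" "arises_from n m a0 Y" "algebroid_solution Y'" "arises_from n m a0 Y'" "a0 \<noteq> 0"
  shows "Y = Y'"
proof (rule halfplane_unique)
  show "Y nicely_meromorphic_on UNIV" "Y' nicely_meromorphic_on UNIV"
    using assms by (auto simp: algebroid_solution_def algebroid_def)
  obtain w where w: "w_solution n m a0 w" "\<forall>\<^sub>F T in t_to_0. Y T = local_sol n m w T"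
    using assms(2) unfolding arises_from_iff t_to_0_iff by blast
  obtain w' where w': "w_solution n m a0 w'" "\<forall>\<^sub>F T in t_to_0. Y' T = local_sol n m w' T"
    using assms(4) unfolding arises_from_iff t_to_0_iff by blast
  have "\<forall>\<^sub>F x in nhds 0. w x = w' x" using w_solution_unique w(1) w'(1) assms(5) by blast
  from eventually_t_to_0_exp[OF this, of n m] w(2) w'(2)
  show "\<forall>\<^sub>F T in t_to_0. Y T = Y' T" by eventually_elim (simp add: local_sol_def)
qed

lemma solution_exists:
  assumes "a0 \<noteq> 0"
  shows "\<exists>Y. algebroid_solution Y \<and> arises_from n m a0 Y"
proof -
  obtain w where w: "w_solution n m a0 w" using w_solution_exists[OF assms] .
  obtain Y where Y: "Y nicely_meromorphic_on UNIV" "\<forall>\<^sub>F T in t_to_0. Y T = local_sol n m w T"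
    "\<And>z. Y z \<noteq> 0 \<Longrightarrow> dP3_ode Y z"
    by (rule global_sol_exists[OF w assms]) blast
  have ar: "arises_from n m a0 Y"
    using w Y(2) unfolding arises_from_iff t_to_0_iff by blast
  have Ym: "Y meromorphic_on UNIV" using Y(1) by (simp add: nicely_meromorphic_on_def)
  have "\<forall>\<^sub>F T in t_to_0. Y T \<noteq> 0"
    using Y(2) local_sol_regular[OF w assms] by eventually_elim auto
  then have nz: "\<exists>T. Y T \<noteq> 0" using t_to_0_neq_bot eventually_happens by blast
  define p where "p = m + 2 * n + 3"
  define P where "P = of_nat p * (2 * of_real pi * \<i>)"
  have "Re P = 0" by (simp add: P_def)
  \<comment> \<open>The shift P is imaginary and so preserves left half planes, where Y is the
    periodic germ; the identity theorem spreads the period to the whole plane.\<close>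
  have "(\<lambda>T. Y (T + P)) = Y"
  proof (rule halfplane_unique)
    show "(\<lambda>T. Y (T + P)) nicely_meromorphic_on UNIV"
    proof -
      have "(\<lambda>T. Y (T + P)) meromorphic_on UNIV"
        by (rule meromorphic_on_compose[OF Ym]) (auto intro: analytic_intros)
      moreover have "(is_pole (\<lambda>T. Y (T + P)) z \<and> Y (z + P) = 0) \<or> (\<lambda>T. Y (T + P)) \<midarrow>z\<rightarrow> Y (z + P)" for z
      proof -
        have shift: "filterlim (\<lambda>T. T + P) (at (z + P)) (at z)"
          by (intro filterlim_atI tendsto_intros) (auto simp: eventually_at_filter)
        have "(is_pole Y (z + P) \<and> Y (z + P) = 0) \<or> Y \<midarrow>z + P\<rightarrow> Y (z + P)"
          using Y(1) unfolding nicely_meromorphic_on_def by blast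
        then show ?thesis
          unfolding is_pole_def using filterlim_compose[OF _ shift, of Y] by auto
      qed
      ultimately show ?thesis by (simp add: nicely_meromorphic_on_def)
    qed
    show "Y nicely_meromorphic_on UNIV" by fact
    obtain R where R: "\<And>T. Re T < R \<Longrightarrow> Y T = local_sol n m w T" using Y(2) unfolding t_to_0_iff by blast
    have "Y (T + P) = Y T" if "Re T < R" for T
      using R[of T] R[of "T + P"] that \<open>Re P = 0\<close> local_sol_periodic[of n m w T]
      by (simp add: P_def p_def)
    then show "\<forall>\<^sub>F T in t_to_0. Y (T + P) = Y T" unfolding t_to_0_iff by blast
  qed
  then have "algebroid Y"
    by (intro periodic_algebroid[of Y p] Y(1) local_sol_moderate[OF Ym Y(2) w assms])
       (auto simp: p_def P_def fun_eq_iff)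
  then have "algebroid_solution Y"
    using dP3_solutionI[OF Y(1) nz Y(3)] by (simp add: algebroid_solution_def)
  with ar show ?thesis by blast
qed

text \<open>The representative y(t; a0) of the claim, in the coordinate T.\<close>

definition the_solution :: "nat \<Rightarrow> nat \<Rightarrow> complex \<Rightarrow> complex \<Rightarrow> complex" where
  "the_solution n m a0 = (THE Y. algebroid_solution Y \<and> arises_from n m a0 Y)"

lemma the_solution:
  assumes "a0 \<noteq> 0"
  shows "algebroid_solution (the_solution n m a0)" "arises_from n m a0 (the_solution n m a0)"
proof -
  have "\<exists>!Y. algebroid_solution Y \<and> arises_from n m a0 Y"
    using solution_exists[OF assms] solution_unique assms by blast
  from theI'[OF this] show "algebroid_solution (the_solution n m a0)" "arises_from n m a0 (the_solution n m a0)"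
    by (auto simp: the_solution_def)
qed

lemma family_eq: "family n m = {the_solution n m a0 | a0. a0 \<noteq> 0}"
  unfolding family_def using the_solution solution_unique by blast

section \<open>Pairs with the same quotient\<close>

lemma alpha_scale:
  assumes "n' + 1 = d * (n + 1)" "m' + 1 = d * (m + 1)"
  shows "alpha n' m' = of_nat d * alpha n m"
proof -
  have "4 * alpha n' m' = of_nat (m' + 1) + 2 * of_nat (n' + 1)" by (simp add: alpha_def)
  also have "\<dots> = 4 * (of_nat d * alpha n m)" unfolding assms by (simp add: alpha_def algebra_simps)
  finally show ?thesis by simp
qed

text \<open>Under x -> x^d the operator x d/dx acquires a factor d, so x w'/w becomes d g(x^d). The
  outer derivative gives d x^(d-1); the powers combine through d - 1 + d n = n' and d - 1 + d m =
  m', and d^2 is absorbed by \<alpha>' = d \<alpha>.\<close>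

lemma w_solution_power:
  assumes w: "w_solution n m a0 w" and a0: "a0 \<noteq> 0" and d: "d > 0"
    and nm: "n' + 1 = d * (n + 1)" "m' + 1 = d * (m + 1)"
  shows "w_solution n' m' a0 (\<lambda>x. w (x ^ d))"
proof -
  note al = alpha_scale[OF nm]
  obtain e where e: "d = Suc e" using d gr0_implies_Suc by blast
  define g where "g z = z * deriv w z / w z" for z
  have an: "w analytic_on {0}" and w0: "w 0 = - a0"
    and ode: "\<forall>\<^sub>F x in nhds 0. deriv g x = (alpha n m)\<^sup>2 * (x ^ n * w x - x ^ m / (w x)\<^sup>2)"
    using w by (auto simp: w_solution_def g_def[abs_def])
  have w0': "w 0 \<noteq> 0" using w0 a0 by simp
  have lim: "filterlim (\<lambda>x::complex. x ^ d) (nhds 0) (nhds 0)"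
  proof -
    have "isCont (\<lambda>x::complex. x ^ d) 0" by (intro continuous_intros)
    then show ?thesis
      using d tendsto_at_iff_tendsto_nhds[of "\<lambda>x::complex. x ^ d" 0] by (simp add: isCont_def zero_power)
  qed
  have an': "(\<lambda>x. w (x ^ d)) analytic_on {0}"
    by (rule analytic_on_compose_gen[of "\<lambda>x. x ^ d" _ w "{0}", unfolded o_def])
       (use an d in \<open>auto intro!: analytic_intros\<close>)
  have reg: "\<forall>\<^sub>F x in nhds 0. w analytic_on {x} \<and> w x \<noteq> 0"
    using an w0' by (rule eventually_analytic_nonzero)
  have pd: "((\<lambda>x. x ^ d) has_field_derivative of_nat d * x ^ e) (at x)" for x :: complex
    using DERIV_power[where n = d, OF DERIV_ident[where F = "at x"]] by (simp add: e)
  have "\<forall>\<^sub>F x in nhds 0. x * deriv (\<lambda>x. w (x ^ d)) x / w (x ^ d) = of_nat d * g (x ^ d)"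
    using eventually_compose_filterlim[OF reg lim]
  proof eventually_elim
    case (elim x)
    have "((\<lambda>x. w (x ^ d)) has_field_derivative deriv w (x ^ d) * (of_nat d * x ^ e)) (at x)"
      by (rule DERIV_chain2[of w _ "\<lambda>x. x ^ d", OF analytic_has_deriv pd]) (use elim in auto)
    then have "deriv (\<lambda>x. w (x ^ d)) x = deriv w (x ^ d) * (of_nat d * x ^ e)" by (rule DERIV_imp_deriv)
    then show ?case by (simp add: g_def e)
  qed
  then have "\<forall>\<^sub>F x in nhds 0. \<forall>\<^sub>F z in nhds x. z * deriv (\<lambda>x. w (x ^ d)) z / w (z ^ d) = of_nat d * g (z ^ d)"
    by (simp add: eventually_eventually)
  then have "\<forall>\<^sub>F x in nhds 0. deriv (\<lambda>z. z * deriv (\<lambda>x. w (x ^ d)) z / w (z ^ d)) x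
      = (alpha n' m')\<^sup>2 * (x ^ n' * w (x ^ d) - x ^ m' / (w (x ^ d))\<^sup>2)"
    using eventually_compose_filterlim[OF reg lim] eventually_compose_filterlim[OF ode lim]
  proof eventually_elim
    case (elim x)
    have ga: "g analytic_on {x ^ d}"
      unfolding g_def[abs_def] using elim(2) by (intro analytic_intros) auto
    have "((\<lambda>z. of_nat d * g (z ^ d)) has_field_derivative of_nat d * (deriv g (x ^ d) * (of_nat d * x ^ e))) (at x)"
      by (intro DERIV_cmult DERIV_chain2[of g _ "\<lambda>x. x ^ d", OF analytic_has_deriv pd] ga)
    then have "deriv (\<lambda>z. of_nat d * g (z ^ d)) x = of_nat d * (deriv g (x ^ d) * (of_nat d * x ^ e))"
      by (rule DERIV_imp_deriv)
    also have "\<dots> = (alpha n' m')\<^sup>2 * (x ^ e * (x ^ d) ^ n * w (x ^ d) - x ^ e * (x ^ d) ^ m / (w (x ^ d))\<^sup>2)"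
      unfolding elim(3) al by (simp add: power2_eq_square right_diff_distrib left_diff_distrib mult_ac)
    also have "x ^ e * (x ^ d) ^ n = x ^ n'"
    proof -
      have "e + d * n = n'" using nm e by simp
      then show ?thesis by (metis power_add power_mult)
    qed
    also have "x ^ e * (x ^ d) ^ m = x ^ m'"
    proof -
      have "e + d * m = m'" using nm e by simp
      then show ?thesis by (metis power_add power_mult)
    qed
    finally show ?case using deriv_cong_ev[OF elim(1) refl] by simp
  qed
  with an' w0 d show ?thesis by (simp add: w_solution_def zero_power)
qed

text \<open>Replacing x by x^d does not change the function of T, because n + 1 and \<alpha> are
  multiplied by the same d.\<close>

lemma arises_from_scale:
  assumes ar: "arises_from n m a0 Y" and a0: "a0 \<noteq> 0" and d: "d > 0"
    and nm: "n' + 1 = d * (n + 1)" "m' + 1 = d * (m + 1)"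
  shows "arises_from n' m' a0 Y"
proof -
  note al = alpha_scale[OF nm]
  have n': "of_nat n' + 1 = (of_nat d * (of_nat n + 1) :: complex)"
    using arg_cong[OF nm(1), of "of_nat :: nat \<Rightarrow> complex"] by (simp add: algebra_simps)
  obtain w where w: "w_solution n m a0 w" "\<exists>R. \<forall>T. Re T < R \<longrightarrow> Y T = local_sol n m w T"
    using ar unfolding arises_from_iff by blast
  have "local_sol n' m' (\<lambda>x. w (x ^ d)) T = local_sol n m w T" for T
  proof -
    have "exp (T / alpha n' m') ^ d = exp (T / alpha n m)"
      unfolding exp_of_nat_mult[symmetric] al using d by simp
    moreover have "(of_nat n' + 1 - alpha n' m') * (T / alpha n' m') = (of_nat n + 1 - alpha n m) * (T / alpha n m)"
      unfolding n' al using d by (simp add: right_diff_distrib[symmetric])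
    ultimately show ?thesis by (simp add: local_sol_def)
  qed
  with w(2) w_solution_power[OF w(1) a0 d nm] show ?thesis
    unfolding arises_from_iff by (intro exI[of _ "\<lambda>x. w (x ^ d)"]) simp
qed

lemma family_scale:
  assumes "d > 0" "n' + 1 = d * (n + 1)" "m' + 1 = d * (m + 1)"
  shows "family n' m' = family n m"
proof -
  have "the_solution n' m' a0 = the_solution n m a0" if "a0 \<noteq> 0" for a0
    using the_solution[OF that] arises_from_scale[OF _ that assms] that solution_unique by metis
  then show ?thesis unfolding family_eq by (metis (no_types, lifting))
qed

lemma family_asymptotics:
  assumes ar: "arises_from n m a0 Y" and a0: "a0 \<noteq> 0"
    and k: "of_nat n + 1 - alpha n m = k * alpha n m"
  shows "Y \<sim>[t_to_0] (\<lambda>T. - a0 * exp (k * T))"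
proof (rule asymp_equivI')
  obtain w where w: "w_solution n m a0 w" "\<forall>\<^sub>F T in t_to_0. Y T = local_sol n m w T"
    using ar unfolding arises_from_iff t_to_0_iff by blast
  have w0: "w 0 = - a0" "isCont w 0" using w by (auto simp: w_solution_def intro: analytic_at_imp_isCont)
  have "((\<lambda>T. w (exp (T / alpha n m)) / (- a0)) \<longlongrightarrow> w 0 / (- a0)) t_to_0"
    by (intro tendsto_divide isCont_tendsto_compose[OF w0(2) exp_tendsto_t_to_0] tendsto_const) (use a0 in auto)
  then have lim: "((\<lambda>T. w (exp (T / alpha n m)) / (- a0)) \<longlongrightarrow> 1) t_to_0"
    using w0 a0 by simp
  have "\<forall>\<^sub>F T in t_to_0. w (exp (T / alpha n m)) / (- a0) = Y T / (- a0 * exp (k * T))"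
    using w(2) by eventually_elim (simp add: local_sol_def k)
  with lim show "((\<lambda>T. Y T / (- a0 * exp (k * T))) \<longlongrightarrow> 1) t_to_0"
    by (rule Lim_transform_eventually)
qed

text \<open>The exponent of t is (n + 1)/\<alpha> - 1 = 4q/(1 + 2q) - 1 = 1 - 2/(1 + 2q), that is, 1
  - 4\<rho>.\<close>

lemma exponent_eq:
  fixes q :: real
  assumes q: "q = (real n + 1) / (real m + 1)"
  shows "of_nat n + 1 - alpha n m = of_real (1 - 2 / (1 + 2 * q)) * alpha n m"
proof -
  have "(real n + 1) - (real m + 2 * real n + 3) / 4
      = (1 - 2 / (1 + 2 * q)) * ((real m + 2 * real n + 3) / 4)"
  proof -
    define D where "D = real m + 2 * real n + 3"
    have D: "D > 0" by (simp add: D_def add_nonneg_pos)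
    have m: "real m + 1 > 0" by simp
    have "1 + 2 * q = D / (real m + 1)"
      using q m by (simp add: D_def field_simps)
    then have "2 / (1 + 2 * q) = 2 * (real m + 1) / D" by simp
    then have "(1 - 2 / (1 + 2 * q)) * (D / 4) = D / 4 - 2 * (real m + 1) / D * (D / 4)"
      by (simp only: left_diff_distrib mult_1)
    also have "2 * (real m + 1) / D * (D / 4) = (real m + 1) / 2"
      using D by (simp add: field_simps)
    also have "D / 4 - (real m + 1) / 2 = (real n + 1) - D / 4" by (simp add: D_def field_simps)
    finally show ?thesis by (simp add: D_def)
  qed
  then have "complex_of_real ((real n + 1) - (real m + 2 * real n + 3) / 4)
      = of_real ((1 - 2 / (1 + 2 * q)) * ((real m + 2 * real n + 3) / 4))"
    by (rule arg_cong)
  then show ?thesis unfolding alpha_real by (simp only: of_real_diff of_real_add of_real_mult of_real_of_nat_eq of_real_1)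
qed

lemma family_of_rat_eq:
  assumes "q > 0"
  obtains n m where "family_of_rat q = family n m" "real_of_rat q = (real n + 1) / (real m + 1)"
    "coprime (n + 1) (m + 1)"
proof -
  obtain a b where ab: "quotient_of q = (a, b)" by fastforce
  have b: "b > 0" "coprime a b" and qab: "q = of_int a / of_int b"
    using ab quotient_of_denom_pos quotient_of_coprime quotient_of_div by auto
  have a: "a > 0" using assms b unfolding qab by (simp add: zero_less_divide_iff)
  \<comment> \<open>Numerator and denominator are positive, so neither \<open>nat\<close> nor the
    truncated subtraction loses anything.\<close>
  define n where "n = nat a - 1"
  define m where "m = nat b - 1"
  have nm: "a = int (n + 1)" "b = int (m + 1)" using a b by (auto simp: n_def m_def)
  show thesis
  proof (rule that)
    show "family_of_rat q = family n m" by (simp add: family_of_rat_def ab n_def m_def)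
    show "real_of_rat q = (real n + 1) / (real m + 1)"
      unfolding qab nm by (simp add: of_rat_divide of_rat_add add.commute)
    show "coprime (n + 1) (m + 1)" using b(2) unfolding nm coprime_int_iff .
  qed
qed

text \<open>The quotient of the two leading terms has modulus proportional to exp ((l - k) Re T),
  which tends to 0 and not to 1.\<close>

lemma exponent_unique:
  assumes Y: "Y \<sim>[t_to_0] (\<lambda>T. - a * exp (of_real k * T))" "Y \<sim>[t_to_0] (\<lambda>T. - b * exp (of_real l * T))"
    and "a \<noteq> 0" "b \<noteq> 0" "k < l"
  shows False
proof -
  have "(\<lambda>T. - b * exp (of_real l * T)) \<sim>[t_to_0] (\<lambda>T. - a * exp (of_real k * T))"
    using Y asymp_equiv_sym asymp_equiv_trans by blast
  then have "((\<lambda>T. (- b * exp (of_real l * T)) / (- a * exp (of_real k * T))) \<longlongrightarrow> 1) t_to_0"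
    by (rule asymp_equivD_strong) (use assms(3) in simp)
  then have "((\<lambda>T. norm ((- b * exp (of_real l * T)) / (- a * exp (of_real k * T)))) \<longlongrightarrow> norm (1::complex)) t_to_0"
    by (rule tendsto_norm)
  moreover have "norm ((- b * exp (of_real l * T)) / (- a * exp (of_real k * T))) = norm b / norm a * exp ((l - k) * Re T)" for T
    by (simp add: norm_mult norm_divide left_diff_distrib exp_diff)
  ultimately have "((\<lambda>T. norm b / norm a * exp ((l - k) * Re T)) \<longlongrightarrow> 1) t_to_0" by simp
  moreover have "((\<lambda>T. norm b / norm a * exp ((l - k) * Re T)) \<longlongrightarrow> 0) t_to_0"
  proof -
    have "l - k > 0" using assms by simp
    then have "((\<lambda>x. exp ((l - k) * x)) \<longlongrightarrow> 0) at_bot" by real_asymp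
    then have "((\<lambda>x. norm b / norm a * exp ((l - k) * x)) \<longlongrightarrow> norm b / norm a * 0) at_bot"
      by (rule tendsto_mult_left)
    then have "((\<lambda>x. norm b / norm a * exp ((l - k) * x)) \<longlongrightarrow> 0) at_bot" by simp
    then show ?thesis
      unfolding t_to_0_def by (rule filterlim_compose) (rule filterlim_filtercomap)
  qed
  ultimately show False using tendsto_unique[OF t_to_0_neq_bot] by fastforce
qed

theorem corollary3p1:
  shows "bij_betw family_of_rat {q. 0 < q} ALG_dP3 \<and>
    (\<forall>q>0. \<forall>\<rho>::real. 2 * \<rho> = 1 / (1 + 2 * real_of_rat q) \<longrightarrow>
      (\<exists>y :: complex \<Rightarrow> complex \<Rightarrow> complex.
         family_of_rat q = {y a0 | a0. a0 \<noteq> 0} \<and>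
         (\<forall>a0. a0 \<noteq> 0 \<longrightarrow>
            y a0 \<sim>[t_to_0] (\<lambda>T. - a0 * exp (of_real (1 - 4 * \<rho>) * T)))))"
proof (intro conjI allI impI)
  have asym: "\<exists>y :: complex \<Rightarrow> complex \<Rightarrow> complex. family_of_rat q = {y a0 | a0. a0 \<noteq> 0} \<and>
      (\<forall>a0. a0 \<noteq> 0 \<longrightarrow>
         y a0 \<sim>[t_to_0] (\<lambda>T. - a0 * exp (of_real (1 - 2 / (1 + 2 * real_of_rat q)) * T)))" if q0: "q > 0" for q
  proof -
    obtain n m where nm: "family_of_rat q = family n m" "real_of_rat q = (real n + 1) / (real m + 1)"
      using family_of_rat_eq[OF q0] by metis
    show ?thesis
      by (intro exI[of _ "the_solution n m"] conjI allI impI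
          family_asymptotics[OF the_solution(2) _ exponent_eq[OF nm(2)]])
         (auto simp: nm(1) family_eq)
  qed
  fix q :: rat and \<rho> :: real
  assume q: "0 < q" and \<rho>: "2 * \<rho> = 1 / (1 + 2 * real_of_rat q)"
  have "1 - 4 * \<rho> = 1 - 2 / (1 + 2 * real_of_rat q)" using \<rho> by simp
  then show "\<exists>y :: complex \<Rightarrow> complex \<Rightarrow> complex. family_of_rat q = {y a0 | a0. a0 \<noteq> 0} \<and>
      (\<forall>a0. a0 \<noteq> 0 \<longrightarrow> y a0 \<sim>[t_to_0] (\<lambda>T. - a0 * exp (of_real (1 - 4 * \<rho>) * T)))"
    using asym[OF q] by simp
next
  show "bij_betw family_of_rat {q. 0 < q} ALG_dP3"
    unfolding bij_betw_def
  proof (intro conjI set_eqI iffI)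
    show "inj_on family_of_rat {q. 0 < q}"
    \<comment> \<open>The exponent 1 - 2/(1 + 2q) increases with q, so for q < r no function can
      belong to both families.\<close>
    proof (rule linorder_inj_onI)
      fix q r :: rat assume qr: "q < r" "q \<in> {q. 0 < q}" "r \<in> {q. 0 < q}"
      show "family_of_rat q \<noteq> family_of_rat r"
      proof
        assume eq: "family_of_rat q = family_of_rat r"
        obtain n m where nm: "family_of_rat q = family n m" "real_of_rat q = (real n + 1) / (real m + 1)"
          using family_of_rat_eq qr(2) unfolding mem_Collect_eq by metis
        obtain n' m' where nm': "family_of_rat r = family n' m'" "real_of_rat r = (real n' + 1) / (real m' + 1)"
          using family_of_rat_eq qr(3) unfolding mem_Collect_eq by metis
        define Y where "Y = the_solution n m 1"
        have "Y \<in> family n m" unfolding family_eq Y_def by (auto intro!: exI[of _ "1::complex"])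
        then have "Y \<in> family n' m'" using eq nm nm' by simp
        then obtain b where b: "b \<noteq> 0" "arises_from n' m' b Y" unfolding family_def by blast
        have Y1: "Y \<sim>[t_to_0] (\<lambda>T. - 1 * exp (of_real (1 - 2 / (1 + 2 * real_of_rat q)) * T))"
          unfolding Y_def by (intro family_asymptotics[OF the_solution(2) _ exponent_eq[OF nm(2)]]) auto
        have Y2: "Y \<sim>[t_to_0] (\<lambda>T. - b * exp (of_real (1 - 2 / (1 + 2 * real_of_rat r)) * T))"
          by (intro family_asymptotics[OF b(2) b(1) exponent_eq[OF nm'(2)]])
        have "0 < real_of_rat q" "real_of_rat q < real_of_rat r"
          using qr by (auto simp: of_rat_less)
        then have "2 / (1 + 2 * real_of_rat r) < 2 / (1 + 2 * real_of_rat q)"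
          by (intro divide_strict_left_mono mult_pos_pos; linarith)
        then have "1 - 2 / (1 + 2 * real_of_rat q) < 1 - 2 / (1 + 2 * real_of_rat r)" by simp
        then show False by (rule exponent_unique[OF Y1 Y2 _ b(1), rotated]) simp
      qed
    qed auto
    fix S assume "S \<in> family_of_rat ` {q. 0 < q}"
    then obtain q where "q > 0" "S = family_of_rat q" by blast
    then show "S \<in> ALG_dP3" using family_of_rat_eq[of q] unfolding ALG_dP3_def by blast
  next
    fix S assume "S \<in> ALG_dP3"
    then obtain n m where S: "S = family n m" unfolding ALG_dP3_def by blast
    define q where "q = (of_nat (n + 1) / of_nat (m + 1) :: rat)"
    have q: "q > 0" by (simp add: q_def)
    obtain n' m' where nm': "family_of_rat q = family n' m'" "real_of_rat q = (real n' + 1) / (real m' + 1)"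
      "coprime (n' + 1) (m' + 1)"
      using family_of_rat_eq[OF q] .
    have "real (n + 1) / real (m + 1) = real (n' + 1) / real (m' + 1)"
      using nm'(2) by (simp add: q_def of_rat_divide of_rat_add add.commute)
    then have "real ((n + 1) * (m' + 1)) = real ((n' + 1) * (m + 1))"
      by (simp add: field_simps)
    then have cross: "(n + 1) * (m' + 1) = (n' + 1) * (m + 1)" by (simp only: of_nat_eq_iff)
    \<comment> \<open>The pair (n, m) need not be reduced. As n' + 1 is coprime to m' + 1,
      cross-multiplication shows that (n + 1, m + 1) is d times the reduced pair.\<close>
    then have "n' + 1 dvd (n + 1) * (m' + 1)" by (metis dvd_triv_left)
    then have "n' + 1 dvd n + 1" using nm'(3) coprime_dvd_mult_left_iff by blast
    then obtain d where d: "n + 1 = d * (n' + 1)" by (metis dvd_def mult.commute)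
    then have "d > 0" by (cases d) auto
    have "(n' + 1) * (d * (m' + 1)) = (n' + 1) * (m + 1)" using cross d by (simp only: mult_ac)
    then have "m + 1 = d * (m' + 1)" by (metis mult_cancel1 add_is_0 one_neq_zero)
    then have "family n m = family n' m'" using family_scale \<open>d > 0\<close> d by blast
    then show "S \<in> family_of_rat ` {q. 0 < q}" using S nm'(1) q by auto
  qed
qed

end
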